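(* Let $\mathfrak g=gl(1|1)$ and let $\mathcal N$ be an irreducible weight module for the Weyl vertex algebra $M$ such that $\beta(0)$ acts semisimply on $\mathcal N$: $$\mathcal N=\bigoplus_{s\in\mathbb Z+\Delta}\mathcal N^s,\qquad \beta(0)|_{\mathcal N^s}\equiv s\,\mathrm{Id}\qquad(\Delta\in\mathbb C).$$ Then $\mathcal N\otimes F$ is a completely reducible $V_1(\mathfrak g)$-module: $$\mathcal N\otimes F=\bigoplus_{s\in\mathbb Z}\mathcal L_s(\mathcal N),\qquad \mathcal L_s(\mathcal N)=\{v\in\mathcal N\otimes F\mid E(0)v=(s+\Delta)v\},$$ and each $\mathcal L_s(\mathcal N)$ is an irreducible $V_1(\mathfrak g)$-module.
   Context: **Weyl vertex algebra.** The Weyl algebra $\widehat{\mathcal A}$ is the associative algebra with generators $a(n),a^*(n)$ ($n\in\mathbb Z$) and relations $[a(n),a^*(m)]=\delta_{n+m,0}$, $[a(n),a(m)]=[a^*(n),a^*(m)]=0$. Let $M$ be the simple $\widehat{\mathcal A}$-module generated by $\mathbf 1$ with $a(n)\mathbf 1=a^*(n+1)\mathbf 1=0$ for $n\ge0$, with its vertex algebra structure $Y(a(-1)\mathbf 1,z)=\sum_n a(n)z^{-n-1}$, $Y(a^*(0)\mathbf 1,z)=\sum_n a^*(n)z^{-n}$. Put $\omega=a(-1)a^*(-1)\mathbf 1$, $Y(\omega,z)=\sum_nL(n)z^{-n-2}$, $\beta=a(-1)a^*(0)\mathbf 1$, $Y(\beta,z)=\sum_n\beta(n)z^{-n-1}$.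 An $M$-module is called weight if $\beta(0)$ and $L(0)$ act semisimply on it. **Clifford vertex algebra.** $F$ is the vertex superalgebra generated by odd fields $\psi(z)=\sum_{n\in\mathbb Z}\psi(n+\frac12)z^{-n-1}$, $\psi^*(z)=\sum_{n\in\mathbb Z}\psi^*(n+\frac12)z^{-n-1}$ whose modes satisfy the (anti)commutation relations $[\psi(r),\psi^*(s)]=\delta_{r+s,0}$, $[\psi(r),\psi(s)]=[\psi^*(r),\psi^*(s)]=0$; as a vector space $F\cong\bigwedge(\{\psi(r),\psi^*(s)\mid r,s<0\})$. Let $\gamma=\psi(-\frac12)\psi^*(-\frac12)\mathbf 1$. **Affine $gl(1|1)$.** $\mathfrak g=gl(1\vert1)$ has even basis $E,N$ and odd basis $\Psi^\pm$ with $[\Psi^+,\Psi^-]=E$, $[E,\cdot]=0$, $[N,\Psi^\pm]=\pm\Psi^\pm$, other brackets trivial, and invariant supersymmetric form $(\Psi^+,\Psi^-)=-(\Psi^-,\Psi^+)=1$, $(N,E)=(E,N)=1$, other products $0$. The affine Lie superalgebra is $\hat{\mathfrak g}=\mathfrak g\otimes\mathbb C[t,t^{-1}]+\mathbb CK$, $[x(n),y(m)]=[x,y](n+m)+n(x,y)\delta_{n+m,0}K$, $K$ central, $x(n)=x\otimes t^n$. $V_1(\mathfrak g)$ is the simple affine vertex superalgebra of level $1$. The vectors $\Psi^+=a(-1)\psi$, $\Psi^-=a^*(0)\psi^*$, $E=\gamma+\beta$, $N=\frac12(\gamma-\beta)$ of $M\otimes F$ (where $\psi=\psi(-\frac12)\mathbf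 1$, $\psi^*=\psi^*(-\frac12)\mathbf 1$) generate a level-$1$ action of $\hat{\mathfrak g}$, with $X(z)=Y(X,z)=\sum_nX(n)z^{-n-1}$, and the vertex subalgebra they generate is isomorphic to $V_1(\mathfrak g)$ (it equals the kernel of $E(0)$ on $M\otimes F$). Every $M\otimes F$-module is thereby a $V_1(\mathfrak g)$-module. *)

theory Defs
  imports Complex_Main "HOL-Library.Poly_Mapping" "HOL-Library.Groups_Big_Fun"
begin

section \<open>Complex vector spaces\<close>

class complex_vs = ab_group_add +
  fixes cscale :: "complex \<Rightarrow> 'a \<Rightarrow> 'a"  (infixr \<open>*\<^sub>C\<close> 75)
  assumes cscale_add_right: "c *\<^sub>C (x + y) = c *\<^sub>C x + c *\<^sub>C y"
    and cscale_add_left: "(c + d) *\<^sub>C x = c *\<^sub>C x + d *\<^sub>C x"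
    and cscale_cscale: "c *\<^sub>C d *\<^sub>C x = (c * d) *\<^sub>C x"
    and cscale_one: "1 *\<^sub>C x = x"

global_interpretation cvs: vector_space "cscale :: complex \<Rightarrow> 'a \<Rightarrow> 'a::complex_vs"
  by unfold_locales
    (simp_all add: cscale_add_right cscale_add_left cscale_cscale cscale_one)

abbreviation clinear :: "('a::complex_vs \<Rightarrow> 'b::complex_vs) \<Rightarrow> bool" where
  "clinear \<equiv> Vector_Spaces.linear cscale cscale"

definition cbilinear :: "('a::complex_vs \<Rightarrow> 'b::complex_vs \<Rightarrow> 'c::complex_vs) \<Rightarrow> bool" where
  "cbilinear h \<longleftrightarrow> (\<forall>a. clinear (h a)) \<and> (\<forall>b. clinear (\<lambda>a. h a b))"

text \<open>The whole space is the internal direct sum of the subspaces \<open>W i\<close>, \<open>i \<in> I\<close>.\<close>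

definition internal_direct_sum :: "'i set \<Rightarrow> ('i \<Rightarrow> 'a::complex_vs set) \<Rightarrow> bool" where
  "internal_direct_sum I W \<longleftrightarrow>
     (\<forall>i\<in>I. cvs.subspace (W i)) \<and>
     (\<forall>v. \<exists>!f. (\<forall>i\<in>I. f i \<in> W i) \<and> (\<forall>i. i \<notin> I \<longrightarrow> f i = 0) \<and>
               finite {i. f i \<noteq> 0} \<and> v = (\<Sum>i | f i \<noteq> 0. f i))"

definition eigenspace :: "('a::complex_vs \<Rightarrow> 'a) \<Rightarrow> complex \<Rightarrow> 'a set" where
  "eigenspace T c = {v. T v = c *\<^sub>C v}"

definition acts_semisimply :: "('a::complex_vs \<Rightarrow> 'a) \<Rightarrow> bool" where
  "acts_semisimply T \<longleftrightarrow> internal_direct_sum UNIV (eigenspace T)"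


section \<open>Tensor products\<close>

text \<open>The free complex vector space on \<open>'a \<times> 'b\<close> modulo the bilinearity relations.
  All relators carry a coefficient, so that the additive closure is a linear subspace.\<close>

inductive_set tensor_null :: "(('a::complex_vs \<times> 'b::complex_vs) \<Rightarrow>\<^sub>0 complex) set" where
  zero: "0 \<in> tensor_null"
| add: "s \<in> tensor_null \<Longrightarrow> t \<in> tensor_null \<Longrightarrow> s + t \<in> tensor_null"
| add_left: "Poly_Mapping.single (a + a', b) c - Poly_Mapping.single (a, b) c
     - Poly_Mapping.single (a', b) c \<in> tensor_null"
| add_right: "Poly_Mapping.single (a, b + b') c - Poly_Mapping.single (a, b) c
     - Poly_Mapping.single (a, b') c \<in> tensor_null"
| scale_left: "Poly_Mapping.single (z *\<^sub>C a, b) c - Poly_Mapping.single (a, b) (c * z) \<in> tensor_null"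
| scale_right: "Poly_Mapping.single (a, z *\<^sub>C b) c - Poly_Mapping.single (a, b) (c * z) \<in> tensor_null"

definition free_scale :: "complex \<Rightarrow> ('x \<Rightarrow>\<^sub>0 complex) \<Rightarrow> ('x \<Rightarrow>\<^sub>0 complex)" where
  "free_scale z = Poly_Mapping.map ((*) z)"

lemma lookup_free_scale [simp]:
  "Poly_Mapping.lookup (free_scale z s) x = z * Poly_Mapping.lookup s x"
  unfolding free_scale_def by (simp add: Poly_Mapping.map.rep_eq when_def)

lemma free_scale_0 [simp]: "free_scale z 0 = 0"
  and free_scale_add: "free_scale z (s + t) = free_scale z s + free_scale z t"
  and free_scale_diff: "free_scale z (s - t) = free_scale z s - free_scale z t"
  and free_scale_single: "free_scale z (Poly_Mapping.single x c) = Poly_Mapping.single x (z * c)"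
  by (auto intro!: poly_mapping_eqI
      simp: lookup_add lookup_minus lookup_single when_def algebra_simps)

lemma free_scale_tensor_null:
  assumes "s \<in> tensor_null" shows "free_scale z s \<in> tensor_null"
  using assms
proof induction
  case (add_left a a' b c)
  then show ?case using tensor_null.add_left[of a a' b "z * c"]
    by (simp add: free_scale_diff free_scale_single)
next
  case (add_right a b b' c)
  then show ?case using tensor_null.add_right[of a b b' "z * c"]
    by (simp add: free_scale_diff free_scale_single)
next
  case (scale_left y a b c)
  then show ?case using tensor_null.scale_left[of y a b "z * c"]
    by (simp add: free_scale_diff free_scale_single mult.assoc)
next
  case (scale_right a y b c)
  then show ?case using tensor_null.scale_right[of a y b "z * c"]
    by (simp add: free_scale_diff free_scale_single mult.assoc)
qed (auto simp: free_scale_add intro: tensor_null.intros)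

lemma uminus_tensor_null: "s \<in> tensor_null \<Longrightarrow> - s \<in> tensor_null"
proof -
  assume "s \<in> tensor_null"
  moreover have "free_scale (-1) s = - s" by (rule poly_mapping_eqI) simp
  ultimately show ?thesis using free_scale_tensor_null[of s "-1"] by simp
qed

lemma diff_tensor_null: "s \<in> tensor_null \<Longrightarrow> t \<in> tensor_null \<Longrightarrow> s - t \<in> tensor_null"
  using tensor_null.add[of s "- t"] uminus_tensor_null[of t] by simp

definition tensor_rel ::
  "(('a::complex_vs \<times> 'b::complex_vs) \<Rightarrow>\<^sub>0 complex) \<Rightarrow> (('a \<times> 'b) \<Rightarrow>\<^sub>0 complex) \<Rightarrow> bool" where
  "tensor_rel s t \<longleftrightarrow> s - t \<in> tensor_null"

lemma equivp_tensor_rel: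
  "equivp (tensor_rel :: (('a::complex_vs \<times> 'b::complex_vs) \<Rightarrow>\<^sub>0 complex) \<Rightarrow> _ \<Rightarrow> _)"
proof (rule equivpI)
  show "reflp (tensor_rel :: (('a \<times> 'b) \<Rightarrow>\<^sub>0 complex) \<Rightarrow> _ \<Rightarrow> _)"
    by (auto simp: reflp_def tensor_rel_def intro: tensor_null.zero)
  show "symp (tensor_rel :: ('a \<times> 'b \<Rightarrow>\<^sub>0 complex) \<Rightarrow> _ \<Rightarrow> _)"
  proof (rule sympI)
    fix s t :: "('a \<times> 'b) \<Rightarrow>\<^sub>0 complex"
    assume "tensor_rel s t"
    then show "tensor_rel t s" using uminus_tensor_null[of "s - t"] by (simp add: tensor_rel_def)
  qed
  show "transp (tensor_rel :: ('a \<times> 'b \<Rightarrow>\<^sub>0 complex) \<Rightarrow> _ \<Rightarrow> _)"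
  proof (rule transpI)
    fix s t u :: "('a \<times> 'b) \<Rightarrow>\<^sub>0 complex"
    assume "tensor_rel s t" "tensor_rel t u"
    moreover have "s - u = (s - t) + (t - u)" by simp
    ultimately show "tensor_rel s u" unfolding tensor_rel_def by (metis tensor_null.add)
  qed
qed

quotient_type (overloaded) ('a, 'b) tensor =
    "('a::complex_vs \<times> 'b::complex_vs) \<Rightarrow>\<^sub>0 complex" / tensor_rel
  by (rule equivp_tensor_rel)

instantiation tensor :: (complex_vs, complex_vs) complex_vs
begin

lift_definition zero_tensor :: "('a, 'b) tensor" is 0 .

lift_definition plus_tensor :: "('a, 'b) tensor \<Rightarrow> ('a, 'b) tensor \<Rightarrow> ('a, 'b) tensor" is "(+)"
proof -
  fix s s' t t' :: "('a \<times> 'b) \<Rightarrow>\<^sub>0 complex"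
  assume "tensor_rel s s'" "tensor_rel t t'"
  moreover have "s + t - (s' + t') = (s - s') + (t - t')" by simp
  ultimately show "tensor_rel (s + t) (s' + t')"
    unfolding tensor_rel_def by (metis tensor_null.add)
qed

lift_definition uminus_tensor :: "('a, 'b) tensor \<Rightarrow> ('a, 'b) tensor" is uminus
proof -
  fix s t :: "('a \<times> 'b) \<Rightarrow>\<^sub>0 complex"
  assume "tensor_rel s t"
  then show "tensor_rel (- s) (- t)"
    using uminus_tensor_null[of "s - t"] by (simp add: tensor_rel_def)
qed

lift_definition minus_tensor :: "('a, 'b) tensor \<Rightarrow> ('a, 'b) tensor \<Rightarrow> ('a, 'b) tensor" is "(-)"
proof -
  fix s s' t t' :: "('a \<times> 'b) \<Rightarrow>\<^sub>0 complex"
  assume "tensor_rel s s'" "tensor_rel t t'"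
  moreover have "s - t - (s' - t') = (s - s') - (t - t')" by simp
  ultimately show "tensor_rel (s - t) (s' - t')"
    unfolding tensor_rel_def by (metis diff_tensor_null)
qed

lift_definition cscale_tensor :: "complex \<Rightarrow> ('a, 'b) tensor \<Rightarrow> ('a, 'b) tensor" is free_scale
proof -
  fix z :: complex and s t :: "('a \<times> 'b) \<Rightarrow>\<^sub>0 complex"
  assume "tensor_rel s t"
  then show "tensor_rel (free_scale z s) (free_scale z t)"
    using free_scale_tensor_null[of "s - t" z] by (simp add: tensor_rel_def free_scale_diff)
qed

instance
proof
  fix x y z :: "('a, 'b) tensor" and c d :: complex
  have eq: "s = t \<Longrightarrow> tensor_rel s t" for s t :: "('a \<times> 'b) \<Rightarrow>\<^sub>0 complex"
    using equivp_reflp[OF equivp_tensor_rel] by simp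
  show "x + y + z = x + (y + z)" by transfer (simp add: eq add.assoc)
  show "x + y = y + x" by transfer (simp add: eq add.commute)
  show "0 + x = x" by transfer (simp add: eq)
  show "- x + x = 0" by transfer (simp add: eq)
  show "x - y = x + - y" by transfer (simp add: eq)
  show "c *\<^sub>C (x + y) = c *\<^sub>C x + c *\<^sub>C y" by transfer (simp add: eq free_scale_add)
  show "(c + d) *\<^sub>C x = c *\<^sub>C x + d *\<^sub>C x"
    by transfer (rule eq, rule poly_mapping_eqI, simp add: lookup_add algebra_simps)
  show "c *\<^sub>C d *\<^sub>C x = (c * d) *\<^sub>C x"
    by transfer (rule eq, rule poly_mapping_eqI, simp add: algebra_simps)
  show "1 *\<^sub>C x = x" by transfer (rule eq, rule poly_mapping_eqI, simp)
qed

end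

lift_definition tens :: "'a::complex_vs \<Rightarrow> 'b::complex_vs \<Rightarrow> ('a, 'b) tensor"  (infixl \<open>\<otimes>\<close> 76)
  is "\<lambda>a b. Poly_Mapping.single (a, b) 1" .

text \<open>The linear map induced by a bilinear \<open>h\<close>, evaluated on an arbitrary representative;
  lemma \<open>tensor_lift_tens\<close> below is the universal property.\<close>

definition free_lift :: "('a \<Rightarrow> 'b \<Rightarrow> 'c::complex_vs) \<Rightarrow> (('a \<times> 'b) \<Rightarrow>\<^sub>0 complex) \<Rightarrow> 'c" where
  "free_lift h s = (\<Sum>p\<in>Poly_Mapping.keys s. Poly_Mapping.lookup s p *\<^sub>C h (fst p) (snd p))"

definition tensor_lift ::
  "('a::complex_vs \<Rightarrow> 'b::complex_vs \<Rightarrow> 'c::complex_vs) \<Rightarrow> ('a, 'b) tensor \<Rightarrow> 'c" where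
  "tensor_lift h t = free_lift h (rep_tensor t)"

lemma free_lift_superset:
  assumes "finite A" "Poly_Mapping.keys s \<subseteq> A"
  shows "free_lift h s = (\<Sum>p\<in>A. Poly_Mapping.lookup s p *\<^sub>C h (fst p) (snd p))"
  unfolding free_lift_def
  by (rule sum.mono_neutral_left) (use assms in \<open>auto simp: in_keys_iff\<close>)

lemma free_lift_0 [simp]: "free_lift h 0 = 0"
  and free_lift_single [simp]: "free_lift h (Poly_Mapping.single (a, b) c) = c *\<^sub>C h a b"
  by (auto simp: free_lift_def)

lemma free_lift_add: "free_lift h (s + t) = free_lift h s + free_lift h t"
proof -
  let ?A = "Poly_Mapping.keys s \<union> Poly_Mapping.keys t"
  have "Poly_Mapping.keys (s + t) \<subseteq> ?A" by (rule Poly_Mapping.keys_add)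
  then show ?thesis
    by (simp add: free_lift_superset[of ?A] lookup_add cscale_add_left sum.distrib)
qed

lemma free_lift_scale: "free_lift h (free_scale z s) = z *\<^sub>C free_lift h s"
proof -
  have "Poly_Mapping.keys (free_scale z s) \<subseteq> Poly_Mapping.keys s" by (auto simp: in_keys_iff)
  then show ?thesis
    by (simp add: free_lift_superset[of "Poly_Mapping.keys s"] cvs.scale_sum_right)
qed

lemma free_lift_diff: "free_lift h (s - t) = free_lift h s - free_lift h t"
  using free_lift_add[of h "s - t" t] by simp

lemma free_lift_tensor_null:
  assumes "cbilinear h" "s \<in> tensor_null" shows "free_lift h s = 0"
  using assms(2)
proof induction
  have lin: "h (a + a') b = h a b + h a' b" "h a (b + b') = h a b + h a b'"
    "h (z *\<^sub>C a) b = z *\<^sub>C h a b" "h a (z *\<^sub>C b) = z *\<^sub>C h a b" for a a' b b' z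
    using assms(1) unfolding cbilinear_def
    by (auto simp: Vector_Spaces.linear_iff)
  {
    case (add_left a a' b c) then show ?case by (simp add: free_lift_diff lin cscale_add_right)
  next
    case (add_right a b b' c) then show ?case by (simp add: free_lift_diff lin cscale_add_right)
  next
    case (scale_left y a b c) then show ?case by (simp add: free_lift_diff lin)
  next
    case (scale_right a y b c) then show ?case by (simp add: free_lift_diff lin)
  }
qed (auto simp: free_lift_add)

lemma tensor_lift_abs:
  assumes "cbilinear h" shows "tensor_lift h (abs_tensor s) = free_lift h s"
proof -
  have "tensor_rel (rep_tensor (abs_tensor s)) s"
    by (rule rep_abs_rsp_left[OF Quotient3_tensor]) (rule equivp_reflp[OF equivp_tensor_rel])
  then have "free_lift h (rep_tensor (abs_tensor s) - s) = 0"
    unfolding tensor_rel_def by (rule free_lift_tensor_null[OF assms])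
  then show ?thesis by (simp add: tensor_lift_def free_lift_diff)
qed

lemma tensor_lift_tens:
  assumes "cbilinear h"
  shows "clinear (tensor_lift h)" and "tensor_lift h (a \<otimes> b) = h a b"
proof -
  have "tensor_lift h (s + t) = tensor_lift h s + tensor_lift h t" for s t
  proof -
    obtain x y where "s = abs_tensor x" "t = abs_tensor y"
      by (metis Quotient3_abs_rep[OF Quotient3_tensor])
    then show ?thesis by (simp add: tensor_lift_abs[OF assms] plus_tensor.abs_eq free_lift_add)
  qed
  moreover have "tensor_lift h (z *\<^sub>C t) = z *\<^sub>C tensor_lift h t" for z t
  proof -
    obtain x where "t = abs_tensor x" by (metis Quotient3_abs_rep[OF Quotient3_tensor])
    then show ?thesis by (simp add: tensor_lift_abs[OF assms] cscale_tensor.abs_eq free_lift_scale)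
  qed
  ultimately show "clinear (tensor_lift h)"
    by (simp add: Vector_Spaces.linear_iff cvs.vector_space_axioms)
  show "tensor_lift h (a \<otimes> b) = h a b"
    by (simp add: tens.abs_eq tensor_lift_abs[OF assms])
qed


section \<open>Vertex superalgebras and their modules\<close>

text \<open>\<open>prd V u n v\<close> is the \<open>n\<close>-th product \<open>u\<^sub>n v\<close>, where
  \<open>Y(u,z) = \<Sum>\<^sub>n u\<^sub>n z\<^sup>-\<^sup>n\<^sup>-\<^sup>1\<close>; \<open>part V False\<close> and \<open>part V True\<close> are the even and the odd part.\<close>

record 'v vsa =
  vac :: 'v
  prd :: "'v \<Rightarrow> int \<Rightarrow> 'v \<Rightarrow> 'v"
  part :: "bool \<Rightarrow> 'v set"

definition koszul :: "bool \<Rightarrow> bool \<Rightarrow> complex" where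
  "koszul p q = (if p \<and> q then - 1 else 1)"

text \<open>The Borcherds (Jacobi) identity in components. By truncation the sums over \<open>j\<close>
  have finite support, so \<open>Sum_any\<close> is the intended sum.\<close>

definition borcherds_identity ::
  "'v::complex_vs vsa \<Rightarrow> ('v \<Rightarrow> int \<Rightarrow> 'w::complex_vs \<Rightarrow> 'w) \<Rightarrow> bool" where
  "borcherds_identity V Y \<longleftrightarrow>
     (\<forall>p q. \<forall>u\<in>part V p. \<forall>v\<in>part V q. \<forall>w. \<forall>m n k :: int.
        Sum_any (\<lambda>j::nat. (of_int m gchoose j) *\<^sub>C Y (prd V u (n + int j) v) (m + k - int j) w) =
        Sum_any (\<lambda>j::nat. ((-1) ^ j * (of_int n gchoose j)) *\<^sub>C
          (Y u (m + n - int j) (Y v (k + int j) w)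
           - (koszul p q * (-1) powi n) *\<^sub>C Y v (n + k - int j) (Y u (m + int j) w))))"

text \<open>\<open>Y v n\<close> is the mode \<open>v\<^sub>n\<close> acting on the module, with the same indexing as for \<open>prd\<close>.\<close>

definition vsa_module ::
  "'v::complex_vs vsa \<Rightarrow> ('v \<Rightarrow> int \<Rightarrow> 'w::complex_vs \<Rightarrow> 'w) \<Rightarrow> bool" where
  "vsa_module V Y \<longleftrightarrow>
     (\<forall>n. cbilinear (\<lambda>v. Y v n)) \<and>
     (\<forall>v w. \<exists>N. \<forall>n\<ge>N. Y v n w = 0) \<and>
     (\<forall>n w. Y (vac V) n w = (if n = - 1 then w else 0)) \<and>
     borcherds_identity V Y"

definition vertex_superalgebra :: "'v::complex_vs vsa \<Rightarrow> bool" where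
  "vertex_superalgebra V \<longleftrightarrow>
     internal_direct_sum UNIV (part V) \<and>
     vac V \<in> part V False \<and>
     (\<forall>p q n. \<forall>u\<in>part V p. \<forall>v\<in>part V q. prd V u n v \<in> part V (p \<noteq> q)) \<and>
     (\<forall>v. prd V v (- 1) (vac V) = v) \<and>
     (\<forall>v. \<forall>n\<ge>0. prd V v n (vac V) = 0) \<and>
     vsa_module V (prd V)"

definition vsa_submodule :: "('v \<Rightarrow> int \<Rightarrow> 'w::complex_vs \<Rightarrow> 'w) \<Rightarrow> 'w set \<Rightarrow> bool" where
  "vsa_submodule Y W \<longleftrightarrow> cvs.subspace W \<and> (\<forall>v n. \<forall>w\<in>W. Y v n w \<in> W)"

definition irreducible_submodule :: "('v \<Rightarrow> int \<Rightarrow> 'w::complex_vs \<Rightarrow> 'w) \<Rightarrow> 'w set \<Rightarrow> bool" where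
  "irreducible_submodule Y W \<longleftrightarrow>
     vsa_submodule Y W \<and> W \<noteq> {0} \<and> (\<forall>U\<subseteq>W. vsa_submodule Y U \<longrightarrow> U = {0} \<or> U = W)"

definition irreducible_module ::
  "'v::complex_vs vsa \<Rightarrow> ('v \<Rightarrow> int \<Rightarrow> 'w::complex_vs \<Rightarrow> 'w) \<Rightarrow> bool" where
  "irreducible_module V Y \<longleftrightarrow> vsa_module V Y \<and> irreducible_submodule Y UNIV"

definition completely_reducible_module ::
  "'v::complex_vs vsa \<Rightarrow> ('v \<Rightarrow> int \<Rightarrow> 'w::complex_vs \<Rightarrow> 'w) \<Rightarrow> bool" where
  "completely_reducible_module V Y \<longleftrightarrow>
     vsa_module V Y \<and>
     (\<exists>S. (\<forall>W\<in>S. irreducible_submodule Y W) \<and> internal_direct_sum S (\<lambda>W. W))"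

definition vertex_subalgebra :: "'v::complex_vs vsa \<Rightarrow> 'v set \<Rightarrow> bool" where
  "vertex_subalgebra V U \<longleftrightarrow>
     cvs.subspace U \<and> vac V \<in> U \<and> (\<forall>u\<in>U. \<forall>v\<in>U. \<forall>n. prd V u n v \<in> U)"

definition generated_subalgebra :: "'v::complex_vs vsa \<Rightarrow> 'v set \<Rightarrow> 'v set" where
  "generated_subalgebra V X = \<Inter> {U. vertex_subalgebra V U \<and> X \<subseteq> U}"

text \<open>Ideals are two-sided (hence stable under the translation \<open>v \<mapsto> v\<^sub>-\<^sub>2 \<one>\<close>) and graded.\<close>

definition vsa_ideal :: "'v::complex_vs vsa \<Rightarrow> 'v set \<Rightarrow> bool" where
  "vsa_ideal V I \<longleftrightarrow>
     cvs.subspace I \<and>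
     (\<forall>v\<in>I. \<exists>x\<in>I \<inter> part V False. \<exists>y\<in>I \<inter> part V True. v = x + y) \<and>
     (\<forall>u n. \<forall>v\<in>I. prd V u n v \<in> I \<and> prd V v n u \<in> I)"

definition simple_vsa :: "'v::complex_vs vsa \<Rightarrow> bool" where
  "simple_vsa V \<longleftrightarrow>
     vertex_superalgebra V \<and> (UNIV :: 'v set) \<noteq> {0} \<and>
     (\<forall>I. vsa_ideal V I \<longrightarrow> I = {0} \<or> I = UNIV)"

definition vsa_hom ::
  "'v::complex_vs vsa \<Rightarrow> 'w::complex_vs vsa \<Rightarrow> ('v \<Rightarrow> 'w) \<Rightarrow> bool" where
  "vsa_hom V W f \<longleftrightarrow>
     clinear f \<and> f (vac V) = vac W \<and> (\<forall>p. f ` part V p \<subseteq> part W p) \<and>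
     (\<forall>u n v. f (prd V u n v) = prd W (f u) n (f v))"

text \<open>\<open>(u \<otimes> f)\<^sub>n (x \<otimes> g) = \<Sum>\<^sub>i u\<^sub>i x \<otimes> f\<^sub>n\<^sub>-\<^sub>i\<^sub>-\<^sub>1 g\<close>, i.e. \<open>Y(u \<otimes> f, z) = Y(u,z) \<otimes> Y(f,z)\<close>, extended
  bilinearly. No Koszul sign occurs because the first tensor factor (a vertex algebra or one
  of its modules) is always purely even here.\<close>

definition tensor_action ::
  "('m::complex_vs \<Rightarrow> int \<Rightarrow> 'n::complex_vs \<Rightarrow> 'n) \<Rightarrow> ('f::complex_vs \<Rightarrow> int \<Rightarrow> 'g::complex_vs \<Rightarrow> 'g) \<Rightarrow>
   ('m, 'f) tensor \<Rightarrow> int \<Rightarrow> ('n, 'g) tensor \<Rightarrow> ('n, 'g) tensor" where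
  "tensor_action Y Z s n t =
     tensor_lift (\<lambda>u f. tensor_lift
       (\<lambda>x g. Sum_any (\<lambda>i::int. Y u i x \<otimes> Z f (n - i - 1) g)) t) s"

definition tensor_vsa ::
  "'m::complex_vs vsa \<Rightarrow> 'f::complex_vs vsa \<Rightarrow> ('m, 'f) tensor vsa" where
  "tensor_vsa M F =
     \<lparr> vac = vac M \<otimes> vac F,
       prd = tensor_action (prd M) (prd F),
       part = (\<lambda>p. cvs.span {u \<otimes> f | u f. f \<in> part F p}) \<rparr>"


section \<open>The Weyl vertex algebra\<close>

text \<open>A module for the Weyl algebra: operators \<open>A n\<close>, \<open>B n\<close> representing \<open>a(n)\<close>, \<open>a\<^sup>*(n)\<close>.\<close>

definition weyl_module :: "(int \<Rightarrow> 'v::complex_vs \<Rightarrow> 'v) \<Rightarrow> (int \<Rightarrow> 'v \<Rightarrow> 'v) \<Rightarrow> bool" where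
  "weyl_module A B \<longleftrightarrow>
     (\<forall>n. clinear (A n) \<and> clinear (B n)) \<and>
     (\<forall>n m v. A n (B m v) - B m (A n v) = (if n + m = 0 then v else 0)) \<and>
     (\<forall>n m v. A n (A m v) = A m (A n v)) \<and>
     (\<forall>n m v. B n (B m v) = B m (B n v))"

definition weyl_submodule ::
  "(int \<Rightarrow> 'v::complex_vs \<Rightarrow> 'v) \<Rightarrow> (int \<Rightarrow> 'v \<Rightarrow> 'v) \<Rightarrow> 'v set \<Rightarrow> bool" where
  "weyl_submodule A B W \<longleftrightarrow> cvs.subspace W \<and> (\<forall>n. \<forall>w\<in>W. A n w \<in> W \<and> B n w \<in> W)"

definition simple_weyl_module :: "(int \<Rightarrow> 'v::complex_vs \<Rightarrow> 'v) \<Rightarrow> (int \<Rightarrow> 'v \<Rightarrow> 'v) \<Rightarrow> bool" where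
  "simple_weyl_module A B \<longleftrightarrow>
     weyl_module A B \<and> (UNIV :: 'v set) \<noteq> {0} \<and>
     (\<forall>W. weyl_submodule A B W \<longrightarrow> W = {0} \<or> W = UNIV)"

text \<open>\<open>a\<close> is the vector \<open>a(-1)\<one>\<close> and \<open>b\<close> is \<open>a\<^sup>*(0)\<one>\<close>. Since
  \<open>Y(b,z) = \<Sum>\<^sub>n a\<^sup>*(n) z\<^sup>-\<^sup>n\<close>, the operator \<open>a\<^sup>*(n)\<close> is the mode \<open>b\<^sub>n\<^sub>-\<^sub>1\<close>.\<close>

definition weyl_vertex_algebra :: "'m::complex_vs vsa \<Rightarrow> 'm \<Rightarrow> 'm \<Rightarrow> bool" where
  "weyl_vertex_algebra M a b \<longleftrightarrow>
     (let A = (\<lambda>n. prd M a n); B = (\<lambda>n. prd M b (n - 1)) in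
       vertex_superalgebra M \<and> part M True = {0} \<and>
       simple_weyl_module A B \<and>
       (\<forall>W. weyl_submodule A B W \<and> vac M \<in> W \<longrightarrow> W = UNIV) \<and>
       (\<forall>n\<ge>0. A n (vac M) = 0 \<and> B (n + 1) (vac M) = 0) \<and>
       a = A (- 1) (vac M) \<and> b = B 0 (vac M))"

definition weyl_beta :: "'m vsa \<Rightarrow> 'm \<Rightarrow> 'm \<Rightarrow> 'm" where
  "weyl_beta M a b = prd M a (- 1) b"

text \<open>\<open>\<omega> = a(-1) a\<^sup>*(-1) \<one>\<close>; then \<open>L(0) = \<omega>\<^sub>1\<close>.\<close>

definition weyl_omega :: "'m vsa \<Rightarrow> 'm \<Rightarrow> 'm \<Rightarrow> 'm" where
  "weyl_omega M a b = prd M a (- 1) (prd M b (- 2) (vac M))"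

definition weight_module ::
  "'m vsa \<Rightarrow> 'm \<Rightarrow> 'm \<Rightarrow> ('m::complex_vs \<Rightarrow> int \<Rightarrow> 'n::complex_vs \<Rightarrow> 'n) \<Rightarrow> bool" where
  "weight_module M a b Y \<longleftrightarrow>
     vsa_module M Y \<and>
     acts_semisimply (Y (weyl_beta M a b) 0) \<and> acts_semisimply (Y (weyl_omega M a b) 1)"


section \<open>The Clifford vertex algebra\<close>

text \<open>\<open>x\<close>, \<open>y\<close> are the vectors \<open>\<psi>\<close>, \<open>\<psi>\<^sup>*\<close>, and \<open>\<psi>(n + 1/2) = x\<^sub>n\<close>, \<open>\<psi>\<^sup>*(n + 1/2) = y\<^sub>n\<close>.
  The Fock module of the Clifford algebra is simple, so \<open>F \<noteq> 0\<close> already forces \<open>F\<close> to be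
  the exterior algebra on the negative modes.\<close>

definition clifford_vertex_algebra :: "'f::complex_vs vsa \<Rightarrow> 'f \<Rightarrow> 'f \<Rightarrow> bool" where
  "clifford_vertex_algebra F x y \<longleftrightarrow>
     vertex_superalgebra F \<and> (UNIV :: 'f set) \<noteq> {0} \<and>
     x \<in> part F True \<and> y \<in> part F True \<and>
     generated_subalgebra F {x, y} = UNIV \<and>
     (\<forall>m n v. prd F x m (prd F y n v) + prd F y n (prd F x m v) = (if m + n + 1 = 0 then v else 0)) \<and>
     (\<forall>m n v. prd F x m (prd F x n v) + prd F x n (prd F x m v) = 0) \<and>
     (\<forall>m n v. prd F y m (prd F y n v) + prd F y n (prd F y m v) = 0)"

definition clifford_gamma :: "'f vsa \<Rightarrow> 'f \<Rightarrow> 'f \<Rightarrow> 'f" where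
  "clifford_gamma F x y = prd F x (- 1) y"


section \<open>Affine \<open>gl(1|1)\<close>\<close>

datatype gl11 = gE | gN | gPsi_plus | gPsi_minus

fun gl11_odd :: "gl11 \<Rightarrow> bool" where
  "gl11_odd gE = False"
| "gl11_odd gN = False"
| "gl11_odd gPsi_plus = True"
| "gl11_odd gPsi_minus = True"

text \<open>\<open>gl11_bracket g h\<close> is the coordinate function of \<open>[g, h]\<close>.\<close>

fun gl11_bracket :: "gl11 \<Rightarrow> gl11 \<Rightarrow> gl11 \<Rightarrow> complex" where
  "gl11_bracket gPsi_plus gPsi_minus = (\<lambda>_. 0)(gE := 1)"
| "gl11_bracket gPsi_minus gPsi_plus = (\<lambda>_. 0)(gE := 1)"
| "gl11_bracket gN gPsi_plus = (\<lambda>_. 0)(gPsi_plus := 1)"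
| "gl11_bracket gPsi_plus gN = (\<lambda>_. 0)(gPsi_plus := - 1)"
| "gl11_bracket gN gPsi_minus = (\<lambda>_. 0)(gPsi_minus := - 1)"
| "gl11_bracket gPsi_minus gN = (\<lambda>_. 0)(gPsi_minus := 1)"
| "gl11_bracket _ _ = (\<lambda>_. 0)"

fun gl11_form :: "gl11 \<Rightarrow> gl11 \<Rightarrow> complex" where
  "gl11_form gPsi_plus gPsi_minus = 1"
| "gl11_form gPsi_minus gPsi_plus = - 1"
| "gl11_form gN gE = 1"
| "gl11_form gE gN = 1"
| "gl11_form _ _ = 0"

text \<open>A level \<open>k\<close> module of the affine Lie superalgebra: \<open>R g n\<close> represents \<open>g \<otimes> t\<^sup>n\<close>, and \<open>K\<close>
  acts by \<open>k\<close>.\<close>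

definition affine_gl11_action ::
  "complex \<Rightarrow> (gl11 \<Rightarrow> int \<Rightarrow> 'v::complex_vs \<Rightarrow> 'v) \<Rightarrow> bool" where
  "affine_gl11_action k R \<longleftrightarrow>
     (\<forall>g n. clinear (R g n)) \<and>
     (\<forall>g h m n v.
        R g m (R h n v) - koszul (gl11_odd g) (gl11_odd h) *\<^sub>C R h n (R g m v) =
        (\<Sum>l\<in>{gE, gN, gPsi_plus, gPsi_minus}. gl11_bracket g h l *\<^sub>C R l (m + n) v)
        + (if m + n = 0 then of_int m * gl11_form g h * k else 0) *\<^sub>C v)"

text \<open>\<open>V\<close> is the simple affine vertex superalgebra \<open>V\<^sub>k(gl(1|1))\<close>: the simple vertex superalgebra
  generated by the fields of a level \<open>k\<close> action; \<open>x g\<close> is the vector \<open>g(-1)\<one>\<close>.\<close>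

definition simple_affine_gl11 :: "complex \<Rightarrow> 'v::complex_vs vsa \<Rightarrow> (gl11 \<Rightarrow> 'v) \<Rightarrow> bool" where
  "simple_affine_gl11 k V x \<longleftrightarrow>
     simple_vsa V \<and>
     (\<forall>g. x g \<in> part V (gl11_odd g)) \<and>
     affine_gl11_action k (\<lambda>g. prd V (x g)) \<and>
     generated_subalgebra V (range x) = UNIV"

text \<open>The free field realization in \<open>M \<otimes> F\<close>.\<close>

fun gl11_vector ::
  "'m::complex_vs vsa \<Rightarrow> 'm \<Rightarrow> 'm \<Rightarrow> 'f::complex_vs vsa \<Rightarrow> 'f \<Rightarrow> 'f \<Rightarrow> gl11 \<Rightarrow> ('m, 'f) tensor" where
  "gl11_vector M a b F x y gPsi_plus = a \<otimes> x"
| "gl11_vector M a b F x y gPsi_minus = b \<otimes> y"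
| "gl11_vector M a b F x y gE =
     vac M \<otimes> clifford_gamma F x y + weyl_beta M a b \<otimes> vac F"
| "gl11_vector M a b F x y gN =
     (1 / 2) *\<^sub>C (vac M \<otimes> clifford_gamma F x y - weyl_beta M a b \<otimes> vac F)"

end

theory Submission
  imports Defs
begin

text \<open>
  Coefficientwise, the Borcherds identity says that three functions of \<open>(m, n, k)\<close>, all subject
  to the recursion \<open>H (m + 1) n k = H m (n + 1) k + H m n (k + 1)\<close> of
  \<open>z\<^sub>1 = (z\<^sub>1 - z\<^sub>2) + z\<^sub>2\<close> and each truncated in one variable, add up to zero. Such a function is
  determined by its truncation and one slice, which makes the identity multiplicative and
  turns \<open>N \<otimes> F\<close> into a module for \<open>M \<otimes> F\<close>, hence for \<open>V\<close>. The summands are the eigenspaces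
  of \<open>E(0)\<close>.

  Let \<open>U\<close> be a nonzero submodule of one of them. Since \<open>\<psi>(-1/2)\<^sup>2 = 0\<close>, all vectors
  \<open>\<psi>(-1/2) \<psi>\<^sup>*(-j-1/2) \<one>\<close> arise from \<open>\<gamma>\<close>, and by interpolating in the mode index \<open>U\<close> is stable
  under every single product \<open>\<psi>(p) \<psi>\<^sup>*(q)\<close>. Commuting these with \<open>\<Psi>\<^sup>\<plusminus>\<close> isolates the products
  \<open>a(n) \<psi>(p)\<close> and \<open>a\<^sup>*(n) \<psi>\<^sup>*(q)\<close>, so \<open>U\<close> is stable under all products of one operator of
  charge 1 and one of charge -1. It is then the charge zero part of a graded subspace stable
  under all Weyl and Clifford operators, which is everything because \<open>N\<close> is irreducible and
  \<open>F\<close> is a Fock space.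
\<close>

section \<open>Linear maps, sums of finite support, tensors\<close>

text \<open>No single \<open>a(n)\<close> or \<open>psi(p)\<close> preserves an eigenspace of
  \<open>E(0)\<close>, and the currents that do preserve it act by infinite sums of quadratic terms.
  The terms can be separated on the fermionic side. At fixed total mode \<open>d\<close>, the modes
  of \<open>psi(-1/2) psi*(-j-1/2) 1\<close> are, up to sign, sums of the same normally ordered
  products with weights \<open>binom(d-p+j, j)\<close>; for varying \<open>j\<close> these weights
  span all polynomials in \<open>p\<close>. Only \<open>j = 0\<close> is given. The others follow
  because translation and the mode \<open>-1\<close> of \<open>gamma\<close> send the vector number
  \<open>j\<close> to combinations of the same two vectors with different coefficients. Once the
  fermion pairs are free they serve as probes: a commutator with one of them cuts the series of
  \<open>Psi+\<close> or \<open>Psi-\<close> down to a single term, and an inserted pair with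
  anticommutator 1 disappears again to leave \<open>a*(m) a(n)\<close>. The return to all operators
  rests on the fact that a raising and a lowering operator commute up to a sign and a scalar.
  Applying such operators to \<open>U\<close> therefore creates nothing new in charge zero.\<close>

lemma clinear_iff:
  "clinear f \<longleftrightarrow> (\<forall>x y. f (x + y) = f x + f y) \<and> (\<forall>c x. f (c *\<^sub>C x) = c *\<^sub>C f x)"
  by (simp add: Vector_Spaces.linear_iff cvs.vector_space_axioms)

lemma clinear_add: "clinear f \<Longrightarrow> f (x + y) = f x + f y"
  and clinear_scale: "clinear f \<Longrightarrow> f (c *\<^sub>C x) = c *\<^sub>C f x"
  by (simp_all add: clinear_iff)

lemma clinear_zero: "clinear f \<Longrightarrow> f 0 = 0"
  using clinear_scale[of f 0 0] by simp

lemma clinear_minus: "clinear f \<Longrightarrow> f (- x) = - f x"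
  using clinear_scale[of f "-1" x] by simp

lemma clinear_diff: "clinear f \<Longrightarrow> f (x - y) = f x - f y"
  using clinear_add[of f x "- y"] clinear_minus[of f y] by simp

lemma clinear_sum: "clinear f \<Longrightarrow> f (sum g A) = (\<Sum>a\<in>A. f (g a))"
  by (induction A rule: infinite_finite_induct) (simp_all add: clinear_zero clinear_add)

lemma clinear_compose: "clinear f \<Longrightarrow> clinear g \<Longrightarrow> clinear (\<lambda>x. f (g x))"
  by (simp add: clinear_iff)

lemma clinear_id: "clinear (\<lambda>x. x)"
  and clinear_const_zero: "clinear (\<lambda>x. 0)"
  and clinear_plus: "clinear f \<Longrightarrow> clinear g \<Longrightarrow> clinear (\<lambda>x. f x + g x)"
  and clinear_minus_fun: "clinear f \<Longrightarrow> clinear g \<Longrightarrow> clinear (\<lambda>x. f x - g x)"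
  and clinear_scaled: "clinear f \<Longrightarrow> clinear (\<lambda>x. c *\<^sub>C f x)"
  by (simp_all add: clinear_iff cvs.scale_right_distrib cvs.scale_right_diff_distrib mult.commute)

lemma clinear_uminus: "clinear f \<Longrightarrow> clinear (\<lambda>x. - f x)"
  using clinear_scaled[of f "-1"] by simp

lemmas clinear_intros = clinear_id clinear_const_zero clinear_compose clinear_plus
  clinear_minus_fun clinear_scaled clinear_uminus

lemma cbilinearD:
  assumes "cbilinear h"
  shows "clinear (h a)" "clinear (\<lambda>a. h a b)"
  using assms by (simp_all add: cbilinear_def)

section \<open>Sums of finite support\<close>

lemma Sum_any_eq_sum:
  assumes "finite A" "\<And>a. a \<notin> A \<Longrightarrow> f a = 0"
  shows "Sum_any f = sum f A"
  using assms by (intro Sum_any.expand_superset) auto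

lemma Sum_any_single:
  assumes "\<And>i. i \<noteq> k \<Longrightarrow> f i = 0"
  shows "Sum_any f = f k"
  using Sum_any_eq_sum[of "{k}" f] assms by simp

lemma clinear_span_mem:
  assumes f: "clinear f" and S: "cvs.subspace S" and E: "\<And>w. w \<in> E \<Longrightarrow> f w \<in> S"
    and v: "v \<in> cvs.span E"
  shows "f v \<in> S"
  using v
proof (induction rule: cvs.span_induct_alt)
  case base
  show ?case by (simp add: clinear_zero[OF f] cvs.subspace_0[OF S])
next
  case (step c u v)
  show ?case
    unfolding clinear_add[OF f] clinear_scale[OF f]
    by (intro cvs.subspace_add[OF S] cvs.subspace_scale[OF S] E step)
qed

lemma clinear_Sum_any:
  assumes "clinear h" "finite {a. f a \<noteq> 0}"
  shows "h (Sum_any f) = Sum_any (\<lambda>a. h (f a))"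
proof -
  have "Sum_any (\<lambda>a. h (f a)) = (\<Sum>a | f a \<noteq> 0. h (f a))"
    using assms by (intro Sum_any_eq_sum) (auto simp: clinear_zero)
  then show ?thesis
    by (simp add: Sum_any.expand_set clinear_sum[OF assms(1)])
qed

lemma Sum_any_uminus: "Sum_any (\<lambda>a. - f a) = - Sum_any (f :: 'i \<Rightarrow> 'a::ab_group_add)"
  by (simp add: Sum_any.expand_set sum_negf)

lemma Sum_any_diff:
  fixes f g :: "'i \<Rightarrow> 'a::ab_group_add"
  assumes "finite {a. f a \<noteq> 0}" "finite {a. g a \<noteq> 0}"
  shows "Sum_any (\<lambda>a. f a - g a) = Sum_any f - Sum_any g"
  using Sum_any.distrib[of f "\<lambda>a. - g a"] assms by (simp add: Sum_any_uminus)

lemma Sum_any_scale: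
  "Sum_any (\<lambda>a. c *\<^sub>C f a) = c *\<^sub>C Sum_any f" if "finite {a. f a \<noteq> 0}"
  using clinear_Sum_any[of "\<lambda>x. c *\<^sub>C x" f] that by (simp add: clinear_intros)

lemma Sum_any_subspace:
  assumes "cvs.subspace U" "\<And>a. f a \<in> U"
  shows "Sum_any f \<in> U"
  unfolding Sum_any.expand_set using assms by (intro cvs.subspace_sum)

lemma finite_int_bounded:
  assumes "\<And>i. P i \<Longrightarrow> a \<le> i" "\<And>i. P i \<Longrightarrow> i \<le> b"
  shows "finite {i::int. P i}"
proof (rule finite_subset)
  show "{i. P i} \<subseteq> {a..b}" using assms by (metis (mono_tags) atLeastAtMost_iff mem_Collect_eq subsetI)
qed simp

lemma finite_nat_bounded:
  assumes "\<And>j. P j \<Longrightarrow> int j \<le> b"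
  shows "finite {j::nat. P j}"
proof (rule finite_subset)
  have "j \<le> nat b" if "P j" for j using assms[OF that] by simp
  then show "{j. P j} \<subseteq> {..nat b}" by blast
qed simp

section \<open>Pure tensors and linear maps out of a tensor product\<close>

lemma tens_add_left: "(a + a') \<otimes> b = a \<otimes> b + a' \<otimes> b"
  by transfer (use tensor_null.add_left[of _ _ _ 1] in \<open>simp add: tensor_rel_def diff_diff_eq\<close>)

lemma tens_add_right: "a \<otimes> (b + b') = a \<otimes> b + a \<otimes> b'"
  by transfer (use tensor_null.add_right[of _ _ _ 1] in \<open>simp add: tensor_rel_def diff_diff_eq\<close>)

lemma tens_scale_left: "(c *\<^sub>C a) \<otimes> b = c *\<^sub>C (a \<otimes> b)"
  by transfer (use tensor_null.scale_left[of _ _ _ 1] in \<open>simp add: tensor_rel_def free_scale_single\<close>)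

lemma tens_scale_right: "a \<otimes> (c *\<^sub>C b) = c *\<^sub>C (a \<otimes> b)"
  by transfer (use tensor_null.scale_right[of _ _ _ 1] in \<open>simp add: tensor_rel_def free_scale_single\<close>)

lemma clinear_tens_left: "clinear (\<lambda>a. a \<otimes> b)"
  and clinear_tens_right: "clinear (\<lambda>b. a \<otimes> b)"
  by (simp_all add: clinear_iff tens_add_left tens_add_right tens_scale_left tens_scale_right)

lemma tens_zero [simp]: "0 \<otimes> b = 0" "a \<otimes> 0 = 0"
  using clinear_zero[OF clinear_tens_left] clinear_zero[OF clinear_tens_right] by auto

lemma tens_uminus_right: "a \<otimes> (- b) = - (a \<otimes> b)"
  and tens_diff_left: "(a - a') \<otimes> b = a \<otimes> b - a' \<otimes> b"
  and tens_diff_right: "a \<otimes> (b - b') = a \<otimes> b - a \<otimes> b'"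
  using clinear_minus[OF clinear_tens_right]
    clinear_diff[OF clinear_tens_left] clinear_diff[OF clinear_tens_right] by auto

text \<open>A coefficient can be absorbed into the left factor of a pure tensor, so finite sums of
  pure tensors exhaust the space and no case for scalars arises.\<close>

lemma tensor_induct [case_names tens add]:
  assumes tens: "\<And>a b. P (a \<otimes> b)" and add: "\<And>s t. P s \<Longrightarrow> P t \<Longrightarrow> P (s + t)"
  shows "P t"
proof -
  obtain s where t: "t = abs_tensor s"
    by (metis Quotient3_abs_rep[OF Quotient3_tensor])
  have single: "P (abs_tensor (Poly_Mapping.single p c))" for p c
  proof -
    obtain a b where p: "p = (a, b)" by force
    have "abs_tensor (Poly_Mapping.single p c) = c *\<^sub>C (a \<otimes> b)"
      by (simp add: p tens.abs_eq cscale_tensor.abs_eq free_scale_single)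
    then show ?thesis using tens[of "c *\<^sub>C a" b] by (simp add: tens_scale_left)
  qed
  have "P (abs_tensor s)"
  proof (induction s rule: update_induct)
    case const
    show ?case using tens[of 0 0] by (simp add: zero_tensor.abs_eq)
  next
    case (update f p c)
    have "Poly_Mapping.update p c f = f + Poly_Mapping.single p c"
      using update(1) by (intro poly_mapping_eqI)
        (auto simp: lookup_add lookup_single lookup_update when_def in_keys_iff)
    then show ?case
      using add[OF update(3) single[of p c]] by (simp add: plus_tensor.abs_eq)
  qed
  then show ?thesis by (simp add: t)
qed

lemma clinear_tensor_eqI:
  assumes "clinear f" "clinear g" "\<And>a b. f (a \<otimes> b) = g (a \<otimes> b)"
  shows "f t = g t"
  by (induction t rule: tensor_induct) (simp_all add: assms clinear_add)

text \<open>A coordinate functional \<open>\<phi>\<close> with \<open>\<phi> a = 1\<close>, obtained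
  by extending \<open>a\<close> to a basis, contracts the left factor and sends
  \<open>a \<otimes> b\<close> to \<open>b\<close>.\<close>

lemma tens_nonzero:
  fixes a :: "'a::complex_vs" and b :: "'b::complex_vs"
  assumes "a \<noteq> 0" "b \<noteq> 0"
  shows "a \<otimes> b \<noteq> 0"
proof -
  have ind: "cvs.independent {a}" using assms by simp
  define B where "B = cvs.extend_basis {a}"
  have B: "cvs.independent B" "cvs.span B = UNIV" "a \<in> B"
    using cvs.independent_extend_basis[OF ind] cvs.span_extend_basis[OF ind]
      cvs.extend_basis_superset[OF ind] by (auto simp: B_def)
  define \<phi> where "\<phi> x = cvs.representation B x a" for x
  have "cbilinear (\<lambda>x y::'b. \<phi> x *\<^sub>C y)"
    unfolding cbilinear_def clinear_iff \<phi>_def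
    by (auto simp: B cvs.representation_add cvs.representation_scale cvs.scale_right_distrib
        cvs.scale_left_distrib mult.commute)
  then have "tensor_lift (\<lambda>x y::'b. \<phi> x *\<^sub>C y) (a \<otimes> b) = \<phi> a *\<^sub>C b"
    and "tensor_lift (\<lambda>x y::'b. \<phi> x *\<^sub>C y) (0 :: ('a, 'b) tensor) = 0"
    using tensor_lift_tens clinear_zero by (blast, blast)
  moreover have "\<phi> a = 1"
    using B by (simp add: \<phi>_def cvs.representation_basis)
  ultimately show ?thesis using assms by (metis cscale_one)
qed

section \<open>Operators and fields on tensor products\<close>

definition tensor_map ::
  "('a::complex_vs \<Rightarrow> 'c::complex_vs) \<Rightarrow> ('b::complex_vs \<Rightarrow> 'd::complex_vs) \<Rightarrow>
   ('a, 'b) tensor \<Rightarrow> ('c, 'd) tensor" where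
  "tensor_map f g = tensor_lift (\<lambda>a b. f a \<otimes> g b)"

lemma
  assumes "clinear f" "clinear g"
  shows clinear_tensor_map: "clinear (tensor_map f g)"
    and tensor_map_tens: "tensor_map f g (a \<otimes> b) = f a \<otimes> g b"
proof -
  have "cbilinear (\<lambda>a b. f a \<otimes> g b)"
    unfolding cbilinear_def
    using clinear_compose[OF clinear_tens_left assms(1)] clinear_compose[OF clinear_tens_right assms(2)]
    by auto
  then show "clinear (tensor_map f g)" "tensor_map f g (a \<otimes> b) = f a \<otimes> g b"
    unfolding tensor_map_def by (simp_all add: tensor_lift_tens)
qed

text \<open>These axioms make every sum below finite. They are kept apart from the Borcherds
  identity because they are needed before that identity is available on the tensor product.\<close>

definition field_action :: "('u::complex_vs \<Rightarrow> int \<Rightarrow> 'w::complex_vs \<Rightarrow> 'w) \<Rightarrow> bool" where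
  "field_action Y \<longleftrightarrow> (\<forall>n. cbilinear (\<lambda>v. Y v n)) \<and> (\<forall>v w. \<exists>N. \<forall>n\<ge>N. Y v n w = 0)"

lemma vsa_module_field_action: "vsa_module V Y \<Longrightarrow> field_action Y"
  by (simp add: vsa_module_def field_action_def)

lemma
  assumes "field_action Y"
  shows field_action_linear: "clinear (Y u n)"
    and field_action_linear_left: "clinear (\<lambda>u. Y u n w)"
    and field_action_bounded: "\<exists>N. \<forall>n\<ge>N. Y u n w = 0"
  using assms cbilinearD[of "\<lambda>v. Y v n"] by (simp_all add: field_action_def)

context
  fixes Y :: "'u::complex_vs \<Rightarrow> int \<Rightarrow> 'w::complex_vs \<Rightarrow> 'w"
    and Z :: "'f::complex_vs \<Rightarrow> int \<Rightarrow> 'g::complex_vs \<Rightarrow> 'g"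
  assumes Y: "field_action Y" and Z: "field_action Z"
begin

lemma finite_tensor_terms: "finite {i. Y u i w \<otimes> Z f (n - i - 1) g \<noteq> 0}"
proof -
  obtain N1 N2 where "\<forall>i\<ge>N1. Y u i w = 0" "\<forall>i\<ge>N2. Z f i g = 0"
    using field_action_bounded[OF Y] field_action_bounded[OF Z] by metis
  then show ?thesis
    by - (rule finite_int_bounded[of _ "n - N2" N1]; rule ccontr; auto)
qed

lemma tensor_term_add:
  shows "Sum_any (\<lambda>i. Y u i (w + w') \<otimes> Z f (n - i - 1) g) =
      Sum_any (\<lambda>i. Y u i w \<otimes> Z f (n - i - 1) g) + Sum_any (\<lambda>i. Y u i w' \<otimes> Z f (n - i - 1) g)"
    and "Sum_any (\<lambda>i. Y u i w \<otimes> Z f (n - i - 1) (g + g')) =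
      Sum_any (\<lambda>i. Y u i w \<otimes> Z f (n - i - 1) g) + Sum_any (\<lambda>i. Y u i w \<otimes> Z f (n - i - 1) g')"
    and "Sum_any (\<lambda>i. Y (u + u') i w \<otimes> Z f (n - i - 1) g) =
      Sum_any (\<lambda>i. Y u i w \<otimes> Z f (n - i - 1) g) + Sum_any (\<lambda>i. Y u' i w \<otimes> Z f (n - i - 1) g)"
    and "Sum_any (\<lambda>i. Y u i w \<otimes> Z (f + f') (n - i - 1) g) =
      Sum_any (\<lambda>i. Y u i w \<otimes> Z f (n - i - 1) g) + Sum_any (\<lambda>i. Y u i w \<otimes> Z f' (n - i - 1) g)"
  by (subst Sum_any.distrib[symmetric, OF finite_tensor_terms finite_tensor_terms],
      simp add: clinear_add[OF field_action_linear[OF Y]] clinear_add[OF field_action_linear[OF Z]]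
        clinear_add[OF field_action_linear_left[OF Y]] clinear_add[OF field_action_linear_left[OF Z]]
        tens_add_left tens_add_right)+

lemma tensor_term_scale:
  shows "Sum_any (\<lambda>i. Y u i (c *\<^sub>C w) \<otimes> Z f (n - i - 1) g) =
      c *\<^sub>C Sum_any (\<lambda>i. Y u i w \<otimes> Z f (n - i - 1) g)"
    and "Sum_any (\<lambda>i. Y u i w \<otimes> Z f (n - i - 1) (c *\<^sub>C g)) =
      c *\<^sub>C Sum_any (\<lambda>i. Y u i w \<otimes> Z f (n - i - 1) g)"
    and "Sum_any (\<lambda>i. Y (c *\<^sub>C u) i w \<otimes> Z f (n - i - 1) g) =
      c *\<^sub>C Sum_any (\<lambda>i. Y u i w \<otimes> Z f (n - i - 1) g)"
    and "Sum_any (\<lambda>i. Y u i w \<otimes> Z (c *\<^sub>C f) (n - i - 1) g) =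
      c *\<^sub>C Sum_any (\<lambda>i. Y u i w \<otimes> Z f (n - i - 1) g)"
  by (subst Sum_any_scale[symmetric, OF finite_tensor_terms],
      simp add: clinear_scale[OF field_action_linear[OF Y]] clinear_scale[OF field_action_linear[OF Z]]
        clinear_scale[OF field_action_linear_left[OF Y]] clinear_scale[OF field_action_linear_left[OF Z]]
        tens_scale_left tens_scale_right)+

lemma cbilinear_tensor_terms: "cbilinear (\<lambda>w g. Sum_any (\<lambda>i. Y u i w \<otimes> Z f (n - i - 1) g))"
  unfolding cbilinear_def clinear_iff by (simp add: tensor_term_add tensor_term_scale)

lemma cbilinear_tensor_action_aux:
  "cbilinear (\<lambda>u f. tensor_lift (\<lambda>w g. Sum_any (\<lambda>i. Y u i w \<otimes> Z f (n - i - 1) g)) t)"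
proof -
  define h where "h u f w g = Sum_any (\<lambda>i. Y u i w \<otimes> Z f (n - i - 1) g)" for u f w g
  have h: "cbilinear (h u f)" for u f
    using cbilinear_tensor_terms by (simp add: h_def[abs_def])
  note lin = tensor_lift_tens(1)[OF h] and tens = tensor_lift_tens(2)[OF h]
  have "tensor_lift (h (u + u') f) t = tensor_lift (h u f) t + tensor_lift (h u' f) t"
    "tensor_lift (h u (f + f')) t = tensor_lift (h u f) t + tensor_lift (h u f') t"
    "tensor_lift (h (c *\<^sub>C u) f) t = c *\<^sub>C tensor_lift (h u f) t"
    "tensor_lift (h u (c *\<^sub>C f)) t = c *\<^sub>C tensor_lift (h u f) t" for u u' f f' c
    by (rule clinear_tensor_eqI; (intro clinear_plus clinear_scaled lin)?;
        simp only: tens; simp add: h_def tensor_term_add tensor_term_scale)+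
  then show ?thesis
    unfolding cbilinear_def clinear_iff by (simp add: h_def[abs_def])
qed

lemma tensor_action_tens:
  "tensor_action Y Z (u \<otimes> f) n (w \<otimes> g) = Sum_any (\<lambda>i. Y u i w \<otimes> Z f (n - i - 1) g)"
  unfolding tensor_action_def tensor_lift_tens(2)[OF cbilinear_tensor_action_aux]
  by (rule tensor_lift_tens(2)[OF cbilinear_tensor_terms])

lemma clinear_tensor_action_left: "clinear (\<lambda>s. tensor_action Y Z s n t)"
  unfolding tensor_action_def by (rule tensor_lift_tens(1)[OF cbilinear_tensor_action_aux])

lemma clinear_tensor_action: "clinear (tensor_action Y Z s n)"
proof (induction s rule: tensor_induct)
  case (tens a b)
  then show ?case
    unfolding tensor_action_def tensor_lift_tens(2)[OF cbilinear_tensor_action_aux]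
    by (rule tensor_lift_tens(1)[OF cbilinear_tensor_terms])
next
  case (add s t)
  have "tensor_action Y Z (s + t) n = (\<lambda>x. tensor_action Y Z s n x + tensor_action Y Z t n x)"
    by (rule ext) (rule clinear_add[OF clinear_tensor_action_left])
  then show ?case using add by (simp add: clinear_plus)
qed

lemma field_action_tensor: "field_action (tensor_action Y Z)"
  unfolding field_action_def cbilinear_def
proof (intro conjI allI clinear_tensor_action_left clinear_tensor_action)
  fix s t
  show "\<exists>N. \<forall>n\<ge>N. tensor_action Y Z s n t = 0"
  proof (induction s rule: tensor_induct)
    case (tens u f)
    show ?case
    proof (induction t rule: tensor_induct)
      case (tens w g)
      obtain N1 N2 where "\<forall>i\<ge>N1. Y u i w = 0" "\<forall>i\<ge>N2. Z f i g = 0"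
        using field_action_bounded[OF Y] field_action_bounded[OF Z] by metis
      \<comment> \<open>For \<open>i < N1\<close> the other index satisfies
        \<open>n - i - 1 \<ge> n - N1 \<ge> N2\<close>, so one factor vanishes for every
        \<open>i\<close>.\<close>
      then have "Y u i w \<otimes> Z f (n - i - 1) g = 0" if "n \<ge> N1 + N2" for i n
        using that by (cases "i \<ge> N1") auto
      then show ?case by (intro exI[of _ "N1 + N2"]) (simp add: tensor_action_tens)
    next
      case (add s t)
      then obtain N1 N2 where "\<forall>n\<ge>N1. tensor_action Y Z (u \<otimes> f) n s = 0"
        "\<forall>n\<ge>N2. tensor_action Y Z (u \<otimes> f) n t = 0" by auto
      then show ?case
        by (intro exI[of _ "max N1 N2"]) (simp add: clinear_add[OF clinear_tensor_action])
    qed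
  next
    case (add s s')
    then obtain N1 N2 where "\<forall>n\<ge>N1. tensor_action Y Z s n t = 0"
      "\<forall>n\<ge>N2. tensor_action Y Z s' n t = 0" by auto
    then show ?case
      by (intro exI[of _ "max N1 N2"]) (simp add: clinear_add[OF clinear_tensor_action_left])
  qed
qed

end

section \<open>The Borcherds identity for tensor products\<close>

text \<open>\<open>H m n k\<close> behaves like the residue of a fixed distribution against
  \<open>z1^m (z1 - z2)^n z2^k\<close>.\<close>

definition pascal3 :: "(int \<Rightarrow> int \<Rightarrow> int \<Rightarrow> 'a::complex_vs) \<Rightarrow> bool" where
  "pascal3 H \<longleftrightarrow> (\<forall>m n k. H (m + 1) n k = H m (n + 1) k + H m n (k + 1))"

lemma pascal3D: "pascal3 H \<Longrightarrow> H (m + 1) n k = H m (n + 1) k + H m n (k + 1)"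
  by (simp add: pascal3_def)

lemma pascal3_diff: "pascal3 H \<Longrightarrow> pascal3 G \<Longrightarrow> pascal3 (\<lambda>m n k. H m n k - G m n k)"
  by (simp add: pascal3_def)

section \<open>Vanishing criteria for solutions of the recursion\<close>

lemma downward_int_induct:
  assumes "\<And>k::int. k \<ge> K \<Longrightarrow> P k" "\<And>k. P (k + 1) \<Longrightarrow> P k"
  shows "P k"
proof (cases "k \<ge> K")
  case False
  then have "k \<le> K" by simp
  then show ?thesis
  proof (induction k rule: int_le_induct)
    case (step i) then show ?case using assms(2)[of "i - 1"] by simp
  qed (simp add: assms)
qed (simp add: assms)

lemma both_directions_int_induct:
  assumes "P (0::int)" "\<And>n. P n \<Longrightarrow> P (n + 1)" "\<And>n. P (n + 1) \<Longrightarrow> P n"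
  shows "P n"
proof (induction n rule: int_induct[of _ 0])
  case (step2 i) then show ?case using assms(3)[of "i - 1"] by simp
qed (use assms in auto)

text \<open>Upwards in \<open>n\<close> the recursion is explicit. Downwards, once row
  \<open>n + 1\<close> vanishes, it reads \<open>H (m + 1) n k = H m n (k + 1)\<close>, which trades
  a value for one with larger \<open>m\<close> or larger \<open>k\<close>. Truncation in
  \<open>k\<close> is the case of the product; the variants truncated in \<open>m\<close> and in
  \<open>n\<close> serve the reversed product and the iterate.\<close>

lemma pascal3_zero_k:
  assumes H: "pascal3 H" and k: "\<And>m n k. k \<ge> K \<Longrightarrow> H m n k = 0" and n: "\<And>m k. H m 0 k = 0"
  shows "H m n k = 0"
proof -
  have "\<forall>m k. H m n k = 0"
  proof (induction n rule: both_directions_int_induct)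
    case (2 n)
    then have "H m (n + 1) k = 0" for m k using pascal3D[OF H, of m n k] by simp
    then show ?case by blast
  next
    case (3 n)
    have "\<forall>m. H m n k = 0" for k
    proof (induction k rule: downward_int_induct[of K])
      case (2 k)
      then have "H m n k = 0" for m using 3 pascal3D[OF H, of "m - 1" n k] by simp
      then show ?case by blast
    qed (simp add: k)
    then show ?case by blast
  qed (simp add: n)
  then show ?thesis by simp
qed

lemma pascal3_zero_m:
  assumes H: "pascal3 H" and m: "\<And>m n k. m \<ge> M \<Longrightarrow> H m n k = 0" and n: "\<And>m k. H m 0 k = 0"
  shows "H m n k = 0"
proof -
  have "\<forall>m k. H m n k = 0"
  proof (induction n rule: both_directions_int_induct)
    case (2 n)
    then have "H m (n + 1) k = 0" for m k using pascal3D[OF H, of m n k] by simp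
    then show ?case by blast
  next
    case (3 n)
    have "\<forall>k. H m n k = 0" for m
    proof (induction m rule: downward_int_induct[of M])
      case (2 m)
      then have "H m n k = 0" for k using 3 pascal3D[OF H, of m n "k - 1"] by simp
      then show ?case by blast
    qed (simp add: m)
    then show ?case by blast
  qed (simp add: n)
  then show ?thesis by simp
qed

text \<open>With row \<open>m + 1\<close> zero the recursion reads
  \<open>H m n (k + 1) = - H m (n + 1) k\<close>, which pushes \<open>n\<close> up into the
  truncated range.\<close>

lemma pascal3_zero_step:
  assumes H: "pascal3 H" and n: "\<And>m n k. n \<ge> N \<Longrightarrow> H m n k = 0"
    and m: "\<forall>n k. H (m + 1) n k = 0"
  shows "\<forall>n k. H m n k = 0"
proof -
  have "\<forall>k. H m n k = 0" for n
  proof (induction n rule: downward_int_induct[of N])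
    case (2 n)
    then have "H m n k = 0" for k using m pascal3D[OF H, of m n "k - 1"] by simp
    then show ?case by blast
  qed (simp add: n)
  then show ?thesis by blast
qed

lemma pascal3_zero_n:
  assumes H: "pascal3 H" and n: "\<And>m n k. n \<ge> N \<Longrightarrow> H m n k = 0" and m: "\<And>n k. H 0 n k = 0"
  shows "H m n k = 0"
proof -
  have "\<forall>n k. H m n k = 0"
  proof (induction m rule: both_directions_int_induct)
    case (2 m)
    then show ?case by (simp add: pascal3D[OF H])
  next
    case (3 m)
    show ?case by (rule pascal3_zero_step[OF H n 3])
  qed (simp add: m)
  then show ?thesis by simp
qed

text \<open>Truncation in \<open>m\<close> takes the place of a known slice: large \<open>m\<close>
  starts the descent. This is the form that annihilates the defect of the Borcherds identity, about
  which no slice is known beforehand.\<close>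

lemma pascal3_zero_nm:
  assumes H: "pascal3 H" and n: "\<And>m n k. n \<ge> N \<Longrightarrow> H m n k = 0"
    and m: "\<And>m n k. m \<ge> M \<Longrightarrow> H m n k = 0"
  shows "H m n k = 0"
proof -
  have "\<forall>n k. H m n k = 0"
  proof (induction m rule: downward_int_induct[of M])
    case (2 m)
    show ?case by (rule pascal3_zero_step[OF H n 2])
  qed (simp add: m)
  then show ?thesis by simp
qed

text \<open>\<open>trunc2 X\<close> says that \<open>\<Sum> X m k z\<^sub>1\<^sup>-\<^sup>m\<^sup>-\<^sup>1 z\<^sub>2\<^sup>-\<^sup>k\<^sup>-\<^sup>1\<close> lies in \<open>W((z\<^sub>1))((z\<^sub>2))\<close>, and \<open>conv\<close> is the
  coefficientwise product of such series.\<close>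

definition trunc2 :: "(int \<Rightarrow> int \<Rightarrow> 'a::complex_vs) \<Rightarrow> bool" where
  "trunc2 X \<longleftrightarrow> (\<exists>K. \<forall>k\<ge>K. \<forall>m. X m k = 0) \<and> (\<forall>k. \<exists>M. \<forall>m\<ge>M. X m k = 0)"

definition conv :: "(int \<Rightarrow> int \<Rightarrow> 'a::complex_vs) \<Rightarrow> (int \<Rightarrow> int \<Rightarrow> 'b::complex_vs) \<Rightarrow>
    int \<Rightarrow> int \<Rightarrow> ('a, 'b) tensor" where
  "conv X Y m k = Sum_any (\<lambda>p. X (fst p) (snd p) \<otimes> Y (m - 1 - fst p) (k - 1 - snd p))"

text \<open>A condition on the pair of series that does not say which variable is truncated first.
  It is symmetric under exchanging the variables, so one theory of products serves all three
  expansions in the Borcherds identity.\<close>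

definition boxed :: "(int \<Rightarrow> int \<Rightarrow> 'a::complex_vs) \<Rightarrow> (int \<Rightarrow> int \<Rightarrow> 'b::complex_vs) \<Rightarrow> bool" where
  "boxed X Y \<longleftrightarrow> (\<forall>m k. \<exists>B. \<forall>i l. X i l \<noteq> 0 \<longrightarrow> Y (m - 1 - i) (k - 1 - l) \<noteq> 0 \<longrightarrow>
     i \<in> {-B..B} \<and> l \<in> {-B..B})"

lemma trunc2_uniform:
  assumes "trunc2 X" shows "\<exists>M. \<forall>m\<ge>M. \<forall>k\<ge>k0. X m k = 0"
proof -
  obtain K where K: "\<And>m k. k \<ge> K \<Longrightarrow> X m k = 0" using assms unfolding trunc2_def by blast
  obtain M where M: "\<And>m k. m \<ge> M k \<Longrightarrow> X m k = 0" using assms unfolding trunc2_def by metis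
  \<comment> \<open>Only the finitely many \<open>k\<close> between \<open>k0\<close> and
    \<open>K\<close> need a bound of their own.\<close>
  have "X m k = 0" if "m \<ge> Max (insert 0 (M ` {k0..<K}))" "k \<ge> k0" for m k
  proof (cases "k \<ge> K")
    case False
    then have "M k \<le> Max (insert 0 (M ` {k0..<K}))" using that by (intro Max_ge) auto
    then show ?thesis using that(1) M by (meson order_trans)
  qed (simp add: K)
  then show ?thesis by blast
qed

lemma trunc2_bound:
  assumes "trunc2 X" obtains K where "\<And>m k. k \<ge> K \<Longrightarrow> X m k = 0"
  using assms unfolding trunc2_def by blast

text \<open>The uniform bounds in the second variable confine \<open>l\<close> to a finite interval,
  and over that interval the bounds in the first variable can be chosen uniformly.\<close>

lemma boxed_trunc2:
  assumes "trunc2 X" "trunc2 Y" shows "boxed X Y"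
  unfolding boxed_def
proof (intro allI)
  fix m k :: int
  obtain K where K: "\<And>m k. k \<ge> K \<Longrightarrow> X m k = 0" using trunc2_bound[OF assms(1)] by blast
  obtain L where L: "\<And>m k. k \<ge> L \<Longrightarrow> Y m k = 0" using trunc2_bound[OF assms(2)] by blast
  obtain M where M: "\<And>i l. i \<ge> M \<Longrightarrow> l \<ge> k - 1 - L \<Longrightarrow> X i l = 0"
    using trunc2_uniform[OF assms(1)] by blast
  obtain N where N: "\<And>i l. i \<ge> N \<Longrightarrow> l \<ge> k - 1 - K \<Longrightarrow> Y i l = 0"
    using trunc2_uniform[OF assms(2)] by blast
  define B where "B = \<bar>K\<bar> + \<bar>k - 1 - L\<bar> + \<bar>M\<bar> + \<bar>m - 1 - N\<bar>"
  have "i \<in> {-B..B} \<and> l \<in> {-B..B}" if X: "X i l \<noteq> 0" and Y: "Y (m - 1 - i) (k - 1 - l) \<noteq> 0" for i l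
  proof -
    have "l < K" using X K by (meson not_le)
    moreover have "k - 1 - l < L" using Y L by (meson not_le)
    moreover from this have "i < M" using X M[of i l] by (cases "i \<ge> M") auto
    moreover have "m - 1 - i < N" using Y N[of "m - 1 - i" "k - 1 - l"] \<open>l < K\<close> by (cases "m - 1 - i \<ge> N") auto
    ultimately show ?thesis unfolding B_def atLeastAtMost_iff by (intro conjI; linarith)
  qed
  then show "\<exists>B. \<forall>i l. X i l \<noteq> 0 \<longrightarrow> Y (m - 1 - i) (k - 1 - l) \<noteq> 0 \<longrightarrow>
     i \<in> {-B..B} \<and> l \<in> {-B..B}" by blast
qed

lemma boxed_swap:
  assumes "boxed X Y" shows "boxed (\<lambda>l i. X i l) (\<lambda>l i. Y i l)"
  unfolding boxed_def
proof (intro allI)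
  fix m k
  obtain B where "\<forall>i l. X i l \<noteq> 0 \<longrightarrow> Y (k - 1 - i) (m - 1 - l) \<noteq> 0 \<longrightarrow> i \<in> {-B..B} \<and> l \<in> {-B..B}"
    using assms unfolding boxed_def by blast
  then show "\<exists>B. \<forall>i l. X l i \<noteq> 0 \<longrightarrow> Y (k - 1 - l) (m - 1 - i) \<noteq> 0 \<longrightarrow> i \<in> {-B..B} \<and> l \<in> {-B..B}"
    by blast
qed

lemma boxed_finite:
  assumes "boxed X Y"
  shows "finite {p. X (fst p) (snd p) \<otimes> Y (m - 1 - fst p) (k - 1 - snd p) \<noteq> 0}"
proof -
  obtain B where "\<And>i l. X i l \<noteq> 0 \<Longrightarrow> Y (m - 1 - i) (k - 1 - l) \<noteq> 0 \<Longrightarrow> i \<in> {-B..B} \<and> l \<in> {-B..B}"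
    using assms unfolding boxed_def by metis
  then have "{p. X (fst p) (snd p) \<otimes> Y (m - 1 - fst p) (k - 1 - snd p) \<noteq> 0} \<subseteq> {-B..B} \<times> {-B..B}"
    by (auto, (metis tens_zero atLeastAtMost_iff)+)
  then show ?thesis by (rule finite_subset) auto
qed

text \<open>Composing two tensor actions produces nested sums. The order of nesting differs between
  the product and the other two terms, so both forms are required.\<close>

lemma conv_iterated:
  assumes "boxed X Y"
  shows "conv X Y m k = Sum_any (\<lambda>i. Sum_any (\<lambda>l. X i l \<otimes> Y (m - 1 - i) (k - 1 - l)))"
    and "conv X Y m k = Sum_any (\<lambda>l. Sum_any (\<lambda>i. X i l \<otimes> Y (m - 1 - i) (k - 1 - l)))"
proof -
  obtain B where B: "\<And>i l. X i l \<noteq> 0 \<Longrightarrow> Y (m - 1 - i) (k - 1 - l) \<noteq> 0 \<Longrightarrow> i \<in> {-B..B} \<and> l \<in> {-B..B}"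
    using assms unfolding boxed_def by metis
  define g where "g i l = X i l \<otimes> Y (m - 1 - i) (k - 1 - l)" for i l
  have g: "g i l \<noteq> 0 \<Longrightarrow> i \<in> {-B..B} \<and> l \<in> {-B..B}" for i l
    unfolding g_def by (rule B) (metis tens_zero)+
  then have sub: "{i. \<exists>l. g i l \<noteq> 0} \<times> {l. \<exists>i. g i l \<noteq> 0} \<subseteq> {-B..B} \<times> {-B..B}" by blast
  have fin: "finite ({-B..B} \<times> {-B..B})" by simp
  have "Sum_any (\<lambda>i. Sum_any (g i)) = Sum_any (\<lambda>(i, l). g i l)"
    by (rule Sum_any.cartesian_product[OF fin sub])
  moreover have "Sum_any (\<lambda>i. Sum_any (g i)) = Sum_any (\<lambda>l. Sum_any (\<lambda>i. g i l))"
    by (rule Sum_any.swap[OF fin sub])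
  moreover have "Sum_any (\<lambda>(i, l). g i l) = conv X Y m k"
    by (simp add: conv_def g_def case_prod_beta)
  ultimately show "conv X Y m k = Sum_any (\<lambda>i. Sum_any (\<lambda>l. X i l \<otimes> Y (m - 1 - i) (k - 1 - l)))"
    "conv X Y m k = Sum_any (\<lambda>l. Sum_any (\<lambda>i. X i l \<otimes> Y (m - 1 - i) (k - 1 - l)))"
    by (simp_all add: g_def)
qed

lemma conv_swap: "conv (\<lambda>l i. X i l) (\<lambda>l i. Y i l) k m = conv X Y m k"
  unfolding conv_def by (rule Sum_any.reindex_cong[of prod.swap]) auto

lemma conv_zero_if:
  assumes "\<And>i l. X i l = 0 \<or> Y (m - 1 - i) (k - 1 - l) = 0"
  shows "conv X Y m k = 0"
proof -
  have "X (fst p) (snd p) \<otimes> Y (m - 1 - fst p) (k - 1 - snd p) = 0" for p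
    using assms by (metis tens_zero)
  then show ?thesis by (simp add: conv_def)
qed

lemma conv_zero_bound:
  assumes "\<And>i l. l \<ge> K \<Longrightarrow> X i l = 0" "\<And>i l. l \<ge> L \<Longrightarrow> Y i l = 0" "k \<ge> K + L"
  shows "conv X Y m k = 0"
proof (rule conv_zero_if)
  fix i l
  show "X i l = 0 \<or> Y (m - 1 - i) (k - 1 - l) = 0"
    using assms(1)[of l i] assms(2)[of "k - 1 - l" "m - 1 - i"] assms(3) by (cases "l \<ge> K") auto
qed

lemma conv_zero_bound_transposed:
  assumes "\<And>i l. i \<ge> K \<Longrightarrow> X i l = 0" "\<And>i l. i \<ge> L \<Longrightarrow> Y i l = 0" "m \<ge> K + L"
  shows "conv X Y m k = 0"
  unfolding conv_swap[of X Y, symmetric] using assms by (intro conv_zero_bound)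

lemma trunc2_conv:
  assumes "trunc2 X" "trunc2 Y" shows "trunc2 (conv X Y)"
proof -
  obtain K where K: "\<And>m k. k \<ge> K \<Longrightarrow> X m k = 0" using trunc2_bound[OF assms(1)] by blast
  obtain L where L: "\<And>m k. k \<ge> L \<Longrightarrow> Y m k = 0" using trunc2_bound[OF assms(2)] by blast
  have "conv X Y m k = 0" if "k \<ge> K + L" for m k
    using K L that by (rule conv_zero_bound)
  moreover have "\<exists>M. \<forall>m\<ge>M. conv X Y m k = 0" for k
  proof -
    obtain M where M: "\<And>i l. i \<ge> M \<Longrightarrow> l \<ge> k - L \<Longrightarrow> X i l = 0"
      using trunc2_uniform[OF assms(1)] by blast
    obtain N where N: "\<And>i l. i \<ge> N \<Longrightarrow> l \<ge> k - K \<Longrightarrow> Y i l = 0"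
      using trunc2_uniform[OF assms(2)] by blast
    have "conv X Y m k = 0" if "m \<ge> M + N" for m
    proof (rule conv_zero_if)
      fix i l
      show "X i l = 0 \<or> Y (m - 1 - i) (k - 1 - l) = 0"
        using K[of l i] L[of "k - 1 - l" "m - 1 - i"] M[of i l] N[of "m - 1 - i" "k - 1 - l"] that
        by (cases "l \<ge> K"; cases "l < k - L"; cases "i \<ge> M") auto
    qed
    then show ?thesis by blast
  qed
  ultimately show ?thesis unfolding trunc2_def by blast
qed

lemma conv_add_left:
  assumes "boxed X Y" "boxed X' Y"
  shows "conv (\<lambda>i l. X i l + s *\<^sub>C X' i l) Y m k = conv X Y m k + s *\<^sub>C conv X' Y m k"
proof -
  have fin: "finite {p. s *\<^sub>C (X' (fst p) (snd p) \<otimes> Y (m - 1 - fst p) (k - 1 - snd p)) \<noteq> 0}"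
    by (rule finite_subset[OF _ boxed_finite[OF assms(2), of m k]]) auto
  show ?thesis
    unfolding conv_def Sum_any_scale[OF boxed_finite[OF assms(2), of m k], symmetric]
      Sum_any.distrib[OF boxed_finite[OF assms(1), of m k] fin, symmetric]
    by (simp add: tens_add_left tens_scale_left)
qed

lemma conv_add_right:
  assumes "boxed X Y" "boxed X Y'"
  shows "conv X (\<lambda>i l. Y i l + s *\<^sub>C Y' i l) m k = conv X Y m k + s *\<^sub>C conv X Y' m k"
proof -
  have fin: "finite {p. s *\<^sub>C (X (fst p) (snd p) \<otimes> Y' (m - 1 - fst p) (k - 1 - snd p)) \<noteq> 0}"
    by (rule finite_subset[OF _ boxed_finite[OF assms(2), of m k]]) auto
  show ?thesis
    unfolding conv_def Sum_any_scale[OF boxed_finite[OF assms(2), of m k], symmetric]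
      Sum_any.distrib[OF boxed_finite[OF assms(1), of m k] fin, symmetric]
    by (simp add: tens_add_right tens_scale_right)
qed

lemma conv_shift_left:
  "conv (\<lambda>i l. X (i + 1) l) Y m k = conv X Y (m + 1) k"
  "conv (\<lambda>i l. X i (l + 1)) Y m k = conv X Y m (k + 1)"
proof -
  have bij: "bij (\<lambda>p::int \<times> int. (fst p + 1, snd p))" "bij (\<lambda>p::int \<times> int. (fst p, snd p + 1))"
    by (rule o_bij[of "\<lambda>p. (fst p - 1, snd p)"]; auto simp: fun_eq_iff)
       (rule o_bij[of "\<lambda>p. (fst p, snd p - 1)"]; auto simp: fun_eq_iff)
  show "conv (\<lambda>i l. X (i + 1) l) Y m k = conv X Y (m + 1) k"
    unfolding conv_def
    by (rule sym, rule Sum_any.reindex_cong[OF bij(1)]) (auto simp: fun_eq_iff algebra_simps)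
  show "conv (\<lambda>i l. X i (l + 1)) Y m k = conv X Y m (k + 1)"
    unfolding conv_def
    by (rule sym, rule Sum_any.reindex_cong[OF bij(2)]) (auto simp: fun_eq_iff algebra_simps)
qed

lemma conv_shift_right:
  "conv X (\<lambda>i l. Y (i + 1) l) m k = conv X Y (m + 1) k"
  "conv X (\<lambda>i l. Y i (l + 1)) m k = conv X Y m (k + 1)"
  by (simp_all add: conv_def algebra_simps)

lemma boxed_shift:
  assumes box: "boxed X Y"
  shows "boxed (\<lambda>i l. X (i + 1) l) Y" "boxed (\<lambda>i l. X i (l + 1)) Y"
    "boxed X (\<lambda>i l. Y (i + 1) l)" "boxed X (\<lambda>i l. Y i (l + 1))"
proof -
  have left: "boxed (\<lambda>i l. X (i + 1) l) Y" if box: "boxed X Y"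
    for X :: "int \<Rightarrow> int \<Rightarrow> 'u::complex_vs" and Y :: "int \<Rightarrow> int \<Rightarrow> 'v::complex_vs"
    unfolding boxed_def
  proof (intro allI)
    fix m k
    obtain B where B: "\<And>i l. X i l \<noteq> 0 \<Longrightarrow> Y (m + 1 - 1 - i) (k - 1 - l) \<noteq> 0 \<Longrightarrow> i \<in> {-B..B} \<and> l \<in> {-B..B}"
      using box unfolding boxed_def by metis
    show "\<exists>B. \<forall>i l. X (i + 1) l \<noteq> 0 \<longrightarrow> Y (m - 1 - i) (k - 1 - l) \<noteq> 0 \<longrightarrow> i \<in> {-B..B} \<and> l \<in> {-B..B}"
    proof (intro exI[of _ "B + 1"] allI impI)
      fix i l assume "X (i + 1) l \<noteq> 0" "Y (m - 1 - i) (k - 1 - l) \<noteq> 0"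
      then show "i \<in> {-(B+1)..B+1} \<and> l \<in> {-(B+1)..B+1}"
        using B[of "i + 1" l] by (simp add: algebra_simps)
    qed
  qed
  have right: "boxed X (\<lambda>i l. Y (i + 1) l)" if box: "boxed X Y"
    for X :: "int \<Rightarrow> int \<Rightarrow> 'u::complex_vs" and Y :: "int \<Rightarrow> int \<Rightarrow> 'v::complex_vs"
    unfolding boxed_def
  proof (intro allI)
    fix m k
    show "\<exists>B. \<forall>i l. X i l \<noteq> 0 \<longrightarrow> Y (m - 1 - i + 1) (k - 1 - l) \<noteq> 0 \<longrightarrow> i \<in> {-B..B} \<and> l \<in> {-B..B}"
      using box[unfolded boxed_def, rule_format, of "m + 1" k] by (simp add: algebra_simps)
  qed
  show "boxed (\<lambda>i l. X (i + 1) l) Y" "boxed X (\<lambda>i l. Y (i + 1) l)"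
    by (rule left[OF box], rule right[OF box])
  show "boxed (\<lambda>i l. X i (l + 1)) Y" "boxed X (\<lambda>i l. Y i (l + 1))"
    using boxed_swap[OF left[OF boxed_swap[OF box]]] boxed_swap[OF right[OF boxed_swap[OF box]]] by simp_all
qed

text \<open>Multiplication by \<open>z1 + s z2\<close> passes freely between either factor and the
  product. The sign \<open>s = -1\<close> raises \<open>n\<close> on slices in
  \<open>(m, k)\<close>, and \<open>s = 1\<close> raises \<open>m\<close> on slices in
  \<open>(n, k)\<close>.\<close>

lemma conv_step:
  assumes "boxed X Y"
  shows "conv (\<lambda>i l. X (i + 1) l + s *\<^sub>C X i (l + 1)) Y m k =
      conv X Y (m + 1) k + s *\<^sub>C conv X Y m (k + 1)"
    and "conv X (\<lambda>i l. Y (i + 1) l + s *\<^sub>C Y i (l + 1)) m k =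
      conv X Y (m + 1) k + s *\<^sub>C conv X Y m (k + 1)"
  by (simp_all add: conv_add_left conv_add_right boxed_shift[OF assms] conv_shift_left conv_shift_right)

lemma split_independent:
  fixes f :: "int \<Rightarrow> int \<Rightarrow> 'x"
  assumes "\<And>n n'. f (n + 1) n' = f n (n' + 1)"
  shows "f n n' = f (n + n') 0"
proof -
  have "\<forall>n. f n n' = f (n + n') 0"
  proof (induction n' rule: both_directions_int_induct)
    case (2 n')
    then show ?case using assms[of _ n'] by (simp add: algebra_simps)
  next
    case (3 n')
    show ?case
    proof
      fix n
      have "f n n' = f (n - 1) (n' + 1)" using assms[of "n - 1" n'] by simp
      then show "f n n' = f (n + n') 0" using 3 by simp
    qed
  qed simp
  then show ?thesis by blast
qed

text \<open>Raising \<open>n\<close> multiplies a slice by \<open>z1 - z2\<close>, and it does not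
  matter which factor absorbs this. Hence the product sees only \<open>n + n'\<close>, and it
  satisfies the recursion again.\<close>

lemma conv_slices_n:
  assumes H: "pascal3 H" and G: "pascal3 G"
    and box: "\<And>n n'. boxed (\<lambda>m k. H m n k) (\<lambda>m k. G m n' k)"
  shows "conv (\<lambda>m k. H m n k) (\<lambda>m k. G m n' k) = conv (\<lambda>m k. H m (n + n') k) (\<lambda>m k. G m 0 k)"
    and "pascal3 (\<lambda>m n k. conv (\<lambda>m k. H m n k) (\<lambda>m k. G m 0 k) m k)"
proof -
  define f where "f n n' = conv (\<lambda>m k. H m n k) (\<lambda>m k. G m n' k)" for n n'
  have "(\<lambda>m k. H m (n + 1) k) = (\<lambda>m k. H (m + 1) n k + (-1) *\<^sub>C H m n (k + 1))"
    and "(\<lambda>m k. G m (n + 1) k) = (\<lambda>m k. G (m + 1) n k + (-1) *\<^sub>C G m n (k + 1))" for n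
    by (simp_all add: fun_eq_iff pascal3D[OF H] pascal3D[OF G])
  then have step: "f (n + 1) n' m k = f n n' (m + 1) k - f n n' m (k + 1)"
    and step': "f n (n' + 1) m k = f n n' (m + 1) k - f n n' m (k + 1)" for n n' m k
    unfolding f_def
    using conv_step[OF box[of n n'], of "-1" m k] by simp_all
  have "f n n' = f (n + n') 0" for n n'
    by (rule split_independent) (simp add: fun_eq_iff step step')
  then show "conv (\<lambda>m k. H m n k) (\<lambda>m k. G m n' k) = conv (\<lambda>m k. H m (n + n') k) (\<lambda>m k. G m 0 k)"
    by (simp add: f_def)
  show "pascal3 (\<lambda>m n k. conv (\<lambda>m k. H m n k) (\<lambda>m k. G m 0 k) m k)"
    using step[of _ 0] by (simp add: pascal3_def f_def)
qed

text \<open>The same argument in the coordinates \<open>(z0, z2)\<close>, where raising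
  \<open>m\<close> multiplies by \<open>z1 = z0 + z2\<close>.\<close>

lemma conv_slices_m:
  assumes H: "pascal3 H" and G: "pascal3 G"
    and box: "\<And>m m'. boxed (\<lambda>n k. H m n k) (\<lambda>n k. G m' n k)"
  shows "conv (\<lambda>n k. H m n k) (\<lambda>n k. G m' n k) = conv (\<lambda>n k. H (m + m') n k) (\<lambda>n k. G 0 n k)"
    and "pascal3 (\<lambda>m n k. conv (\<lambda>n k. H m n k) (\<lambda>n k. G 0 n k) n k)"
proof -
  define f where "f m m' = conv (\<lambda>n k. H m n k) (\<lambda>n k. G m' n k)" for m m'
  have "(\<lambda>n k. H (m + 1) n k) = (\<lambda>n k. H m (n + 1) k + 1 *\<^sub>C H m n (k + 1))"
    and "(\<lambda>n k. G (m + 1) n k) = (\<lambda>n k. G m (n + 1) k + 1 *\<^sub>C G m n (k + 1))" for m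
    by (simp_all add: fun_eq_iff pascal3D[OF H] pascal3D[OF G])
  then have step: "f (m + 1) m' n k = f m m' (n + 1) k + f m m' n (k + 1)"
    and step': "f m (m' + 1) n k = f m m' (n + 1) k + f m m' n (k + 1)" for n m' m k
    unfolding f_def
    using conv_step[OF box[of m m'], of 1 n k] by (simp_all only: cscale_one)
  have "f m m' = f (m + m') 0" for m m'
    by (rule split_independent) (simp add: fun_eq_iff step step')
  then show "conv (\<lambda>n k. H m n k) (\<lambda>n k. G m' n k) = conv (\<lambda>n k. H (m + m') n k) (\<lambda>n k. G 0 n k)"
    by (simp add: f_def)
  show "pascal3 (\<lambda>m n k. conv (\<lambda>n k. H m n k) (\<lambda>n k. G 0 n k) n k)"
    using step[of _ 0] by (simp add: pascal3_def f_def)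
qed

section \<open>Changing coordinates in a product of series\<close>

lemma sum_int_telescope:
  fixes h :: "int \<Rightarrow> 'a::ab_group_add"
  assumes "a \<le> b" shows "(\<Sum>i\<in>{a..<b}. h (i + 1) - h i) = h b - h a"
  using assms
proof (induction b rule: int_ge_induct)
  case (step i)
  then have "{a..<i + 1} = insert i {a..<i}" by auto
  then show ?case using step by simp
qed simp

text \<open>A discrete Green formula on a quadrant, for a closed form supported below an antidiagonal.\<close>

lemma closed_form_quadrant:
  fixes f g :: "int \<Rightarrow> int \<Rightarrow> 'a::ab_group_add"
  assumes closed: "\<And>p q. f (p + 1) q - f p q = g p (q + 1) - g p q"
    and f: "\<And>p q. p + q \<ge> T \<Longrightarrow> f p q = 0" and g: "\<And>p q. p + q \<ge> T \<Longrightarrow> g p q = 0"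
  shows "(\<Sum>p\<in>{p0..<T - q0}. g p q0) = (\<Sum>q\<in>{q0..<T - p0}. f p0 q)"
proof -
  \<comment> \<open>The far edges of the rectangle: \<open>f\<close> vanishes on the column
    \<open>P\<close> and \<open>g\<close> on the row \<open>Q\<close>. The maxima keep both
    intervals correctly oriented for telescoping.\<close>
  define P where "P = max p0 (T - q0)"
  define Q where "Q = max q0 (T - p0)"
  have "(\<Sum>q\<in>{q0..<Q}. f P q - f p0 q) = (\<Sum>q\<in>{q0..<Q}. \<Sum>p\<in>{p0..<P}. f (p + 1) q - f p q)"
    by (intro sum.cong refl sum_int_telescope[where h = "\<lambda>p. f p _", symmetric]) (simp add: P_def)
  also have "\<dots> = (\<Sum>p\<in>{p0..<P}. \<Sum>q\<in>{q0..<Q}. g p (q + 1) - g p q)"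
    by (subst sum.swap) (simp add: closed)
  also have "\<dots> = (\<Sum>p\<in>{p0..<P}. g p Q - g p q0)"
    by (intro sum.cong refl sum_int_telescope) (simp add: Q_def)
  also have "\<dots> = (\<Sum>p\<in>{p0..<P}. - g p q0)"
    by (intro sum.cong refl) (auto simp: Q_def intro!: g)
  also have "(\<Sum>q\<in>{q0..<Q}. f P q - f p0 q) = (\<Sum>q\<in>{q0..<Q}. - f p0 q)"
    by (intro sum.cong refl) (auto simp: P_def intro!: f)
  finally have "(\<Sum>p\<in>{p0..<P}. g p q0) = (\<Sum>q\<in>{q0..<Q}. f p0 q)"
    by (simp add: sum_negf)
  moreover have "{p0..<P} = {p0..<T - q0}" "{q0..<Q} = {q0..<T - p0}"
    by (auto simp: P_def Q_def)
  ultimately show ?thesis by simp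
qed

text \<open>In the expansion for \<open>|z1| > |z2|\<close> the variables \<open>z1\<close> and
  \<open>z1 - z2\<close> have the same leading term, so only the sum \<open>m + n\<close> is
  bounded. This makes the slices at fixed \<open>n\<close> and those at fixed \<open>m\<close>
  truncated alike.\<close>

definition trunc3 :: "(int \<Rightarrow> int \<Rightarrow> int \<Rightarrow> 'a::complex_vs) \<Rightarrow> bool" where
  "trunc3 H \<longleftrightarrow> (\<exists>K. \<forall>k\<ge>K. \<forall>m n. H m n k = 0) \<and>
     (\<forall>k0. \<exists>T. \<forall>m n k. k \<ge> k0 \<longrightarrow> m + n \<ge> T \<longrightarrow> H m n k = 0)"

lemma trunc3_slices:
  assumes "trunc3 H"
  shows "trunc2 (\<lambda>m k. H m n k)" "trunc2 (\<lambda>n k. H m n k)"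
proof -
  obtain K where "\<forall>k\<ge>K. \<forall>m n. H m n k = 0" using assms by (auto simp: trunc3_def)
  moreover have "\<exists>T. \<forall>m n. m + n \<ge> T \<longrightarrow> H m n k = 0" for k
    using assms unfolding trunc3_def by (meson order_refl)
  moreover from this have "\<exists>M. \<forall>m\<ge>M. H m n k = 0" "\<exists>M. \<forall>n\<ge>M. H m n k = 0" for m n k
    by (metis diff_le_eq, metis diff_le_eq add.commute)
  ultimately show "trunc2 (\<lambda>m k. H m n k)" "trunc2 (\<lambda>n k. H m n k)"
    unfolding trunc2_def by blast+
qed

text \<open>The product of two series in \<open>W((z\<^sub>1))((z\<^sub>2))\<close> may be computed in the coordinates
  \<open>(z\<^sub>1, z\<^sub>2)\<close> or \<open>(z\<^sub>0, z\<^sub>2)\<close> with \<open>z\<^sub>0 = z\<^sub>1 - z\<^sub>2\<close>.\<close>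

lemma conv_change_coordinates:
  assumes H: "pascal3 H" "trunc3 H" and G: "pascal3 G" "trunc3 G"
  shows "conv (\<lambda>m k. H m n k) (\<lambda>m k. G m 0 k) m k = conv (\<lambda>n k. H m n k) (\<lambda>n k. G 0 n k) n k"
proof -
  obtain K where K: "\<And>m n k. k \<ge> K \<Longrightarrow> H m n k = 0" using H unfolding trunc3_def by blast
  obtain L where L: "\<And>m n k. k \<ge> L \<Longrightarrow> G m n k = 0" using G unfolding trunc3_def by blast
  obtain T where T: "\<And>m n l. l \<ge> k - L \<Longrightarrow> m + n \<ge> T \<Longrightarrow> H m n l = 0" using H unfolding trunc3_def by blast
  obtain T' where T': "\<And>m n l. l \<ge> k - K \<Longrightarrow> m + n \<ge> T' \<Longrightarrow> G m n l = 0" using G unfolding trunc3_def by blast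
  \<comment> \<open>Only the variable \<open>z2\<close> is convolved; the exponents of
    \<open>z1\<close> and \<open>z0\<close> in both factors stay free and are then distributed along
    a path.\<close>
  define \<theta> where "\<theta> m1 n1 m2 n2 k = Sum_any (\<lambda>l. H m1 n1 l \<otimes> G m2 n2 (k - 1 - l))" for m1 n1 m2 n2 k
  have fin: "finite {l. H m1 n1 l \<otimes> G m2 n2 (k - 1 - l) \<noteq> 0}" for m1 n1 m2 n2 k
  proof (rule finite_int_bounded[of _ "k - 1 - L" K])
    fix l assume nz: "H m1 n1 l \<otimes> G m2 n2 (k - 1 - l) \<noteq> 0"
    then show "l \<le> K" using K[of l] by (metis linear tens_zero(1))
    show "k - 1 - L \<le> l" using L[of "k - 1 - l"] nz by (smt (verit) tens_zero(2))
  qed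
  have \<theta>_step: "\<theta> (m1 + 1) n1 m2 n2 k = \<theta> m1 (n1 + 1) m2 n2 k + \<theta> m1 n1 m2 n2 (k + 1)"
    "\<theta> m1 n1 (m2 + 1) n2 k = \<theta> m1 n1 m2 (n2 + 1) k + \<theta> m1 n1 m2 n2 (k + 1)" for m1 n1 m2 n2 k
  proof -
    have bij: "bij (\<lambda>l::int. l + 1)" by (rule o_bij[of "\<lambda>l. l - 1"]) (auto simp: fun_eq_iff)
    have shift: "\<theta> m1 n1 m2 n2 (k + 1) = Sum_any (\<lambda>l. H m1 n1 (l + 1) \<otimes> G m2 n2 (k - 1 - l))"
      unfolding \<theta>_def by (rule Sum_any.reindex_cong[OF bij]) (auto simp: fun_eq_iff algebra_simps)
    have shift': "\<theta> m1 n1 m2 n2 (k + 1) = Sum_any (\<lambda>l. H m1 n1 l \<otimes> G m2 n2 (k - 1 - l + 1))"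
      unfolding \<theta>_def by (simp add: algebra_simps)
    have fin1: "finite {l. H m1 n1 (l + 1) \<otimes> G m2 n2 (k - 1 - l) \<noteq> 0}"
      using finite_vimageI[OF fin[of m1 n1 m2 n2 "k + 1"], of "\<lambda>l. l + 1"]
      by (simp add: vimage_def algebra_simps inj_def)
    have fin2: "finite {l. H m1 n1 l \<otimes> G m2 n2 (k - 1 - l + 1) \<noteq> 0}"
      using fin[of m1 n1 m2 n2 "k + 1"] by (simp add: algebra_simps)
    show "\<theta> (m1 + 1) n1 m2 n2 k = \<theta> m1 (n1 + 1) m2 n2 k + \<theta> m1 n1 m2 n2 (k + 1)"
      unfolding shift unfolding \<theta>_def Sum_any.distrib[OF fin fin1, symmetric]
      by (simp add: pascal3D[OF H(1)] tens_add_left)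
    show "\<theta> m1 n1 (m2 + 1) n2 k = \<theta> m1 n1 m2 (n2 + 1) k + \<theta> m1 n1 m2 n2 (k + 1)"
      unfolding shift' unfolding \<theta>_def Sum_any.distrib[OF fin fin2, symmetric]
      by (simp add: pascal3D[OF G(1)] tens_add_right)
  qed
  have \<theta>_zero: "\<theta> m1 n1 m2 n2 k = 0" if "m1 + n1 \<ge> T \<or> m2 + n2 \<ge> T'" for m1 n1 m2 n2
  proof -
    have "H m1 n1 l \<otimes> G m2 n2 (k - 1 - l) = 0" for l
      using that T[of l m1 n1] T'[of "k - 1 - l" m2 n2] K[of l m1 n1] L[of "k - 1 - l" m2 n2]
      by (cases "l \<ge> K"; cases "l \<ge> k - L") auto
    then show ?thesis by (simp add: \<theta>_def)
  qed
  \<comment> \<open>Summing \<open>f\<close> along a column gives the product in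
    \<open>(z0, z2)\<close>, and summing \<open>g\<close> along a row gives the one in
    \<open>(z1, z2)\<close>. The two recursions say exactly that the discrete form with components
    \<open>f\<close> and \<open>g\<close> is closed.\<close>
  define f where "f p q = \<theta> p q (m - p) (n - 1 - q) k" for p q
  define g where "g p q = \<theta> p q (m - 1 - p) (n - q) k" for p q
  have "f (p + 1) q - f p q = g p (q + 1) - g p q" for p q
    using \<theta>_step(1)[of p q "m - 1 - p" "n - 1 - q" k] \<theta>_step(2)[of p q "m - 1 - p" "n - 1 - q" k]
    by (simp add: f_def g_def algebra_simps)
  moreover have "f p q = 0" "g p q = 0" if "p + q \<ge> T" for p q
    using that by (simp_all add: f_def g_def \<theta>_zero)
  moreover define S where "S = m + n - T'"
  ultimately have quad: "(\<Sum>p\<in>{m..<T - (S - m - 1)}. g p (S - m - 1)) = (\<Sum>q\<in>{S - m - 1..<T - m}. f m q)"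
    by (intro closed_form_quadrant)
  have low: "f p q = 0" "g p q = 0" if "p + q \<le> S - 1" for p q
    using that by (simp_all add: f_def g_def \<theta>_zero S_def)
  note box = boxed_trunc2[OF trunc3_slices(1)[OF H(2)] trunc3_slices(1)[OF G(2)]]
    and box' = boxed_trunc2[OF trunc3_slices(2)[OF H(2)] trunc3_slices(2)[OF G(2)]]
  \<comment> \<open>The corner \<open>(m, ?q)\<close> lies on the antidiagonal
    \<open>p + q = S - 1\<close>, at and below which \<open>f\<close> and \<open>g\<close> vanish.
    The two edges of the quadrant therefore carry the full row sum and the full column sum.\<close>
  let ?q = "S - m - 1"
  have "conv (\<lambda>m k. H m n k) (\<lambda>m k. G m 0 k) m k = conv (\<lambda>m k. H m ?q k) (\<lambda>m k. G m (n - ?q) k) m k"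
    by (subst (2) conv_slices_n(1)[OF H(1) G(1) box]) simp
  also have "\<dots> = Sum_any (\<lambda>p. g p ?q)"
    by (simp add: conv_iterated(1)[OF box] g_def \<theta>_def)
  also have "\<dots> = (\<Sum>p\<in>{m..<T - ?q}. g p ?q)"
    using low(2)[of _ ?q] \<open>\<And>p q. p + q \<ge> T \<Longrightarrow> g p q = 0\<close>[of _ ?q]
    by (intro Sum_any_eq_sum) force+
  also have "\<dots> = (\<Sum>q\<in>{?q..<T - m}. f m q)" by (rule quad)
  also have "\<dots> = Sum_any (f m)"
    using low(1)[of m] \<open>\<And>p q. p + q \<ge> T \<Longrightarrow> f p q = 0\<close>[of m]
    by (intro Sum_any_eq_sum[symmetric]) force+
  also have "\<dots> = conv (\<lambda>n k. H m n k) (\<lambda>n k. G 0 n k) n k"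
    by (simp add: conv_iterated(1)[OF box'] f_def[abs_def] \<theta>_def)
  finally show ?thesis .
qed

text \<open>The three sums of the Borcherds identity, for \<open>X m k = u\<^sub>m v\<^sub>k w\<close>,
  \<open>X' m k = \<plusminus> v\<^sub>k u\<^sub>m w\<close> and \<open>Z n k = (u\<^sub>n v)\<^sub>k w\<close>.\<close>

definition product_side :: "(int \<Rightarrow> int \<Rightarrow> 'a::complex_vs) \<Rightarrow> int \<Rightarrow> int \<Rightarrow> int \<Rightarrow> 'a" where
  "product_side X m n k =
     Sum_any (\<lambda>j::nat. ((-1) ^ j * (of_int n gchoose j)) *\<^sub>C X (m + n - int j) (k + int j))"

definition reverse_side :: "(int \<Rightarrow> int \<Rightarrow> 'a::complex_vs) \<Rightarrow> int \<Rightarrow> int \<Rightarrow> int \<Rightarrow> 'a" where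
  "reverse_side X m n k = (-1) powi n *\<^sub>C
     Sum_any (\<lambda>j::nat. ((-1) ^ j * (of_int n gchoose j)) *\<^sub>C X (m + int j) (n + k - int j))"

definition iterate_side :: "(int \<Rightarrow> int \<Rightarrow> 'a::complex_vs) \<Rightarrow> int \<Rightarrow> int \<Rightarrow> int \<Rightarrow> 'a" where
  "iterate_side Z m n k =
     Sum_any (\<lambda>j::nat. (of_int m gchoose j) *\<^sub>C Z (n + int j) (m + k - int j))"

lemma finite_shifted_nat:
  assumes "finite {j::nat. f j \<noteq> (0::'a::zero)}" shows "finite {j. f (Suc j) \<noteq> 0}"
  using finite_vimageI[OF assms, of Suc] by (simp add: vimage_def)

lemma Sum_any_nat_split:
  fixes f :: "nat \<Rightarrow> 'a::ab_group_add"
  assumes "finite {j. f j \<noteq> 0}"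
  shows "Sum_any f = f 0 + Sum_any (\<lambda>j. f (Suc j))"
proof -
  obtain N where N: "{j. f j \<noteq> 0} \<subseteq> {..<N}"
    using assms finite_nat_set_iff_bounded by (metis lessThan_iff subsetI)
  have "Sum_any f = sum f {..<Suc N}" "Sum_any (\<lambda>j. f (Suc j)) = (\<Sum>j<N. f (Suc j))"
    using N by (intro Sum_any_eq_sum; force)+
  then show ?thesis by (simp only: sum.lessThan_Suc_shift)
qed

lemma finite_scaled: "finite {j. f j \<noteq> 0} \<Longrightarrow> finite {j. c j *\<^sub>C f j \<noteq> 0}"
  by (erule rev_finite_subset) auto

text \<open>Pascal's rule for an integer upper index, with the second part shifted by one. All three
  sides of the identity inherit their recursion from it.\<close>

lemma Sum_any_pascal:
  assumes "finite {j. f j \<noteq> 0}"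
  shows "Sum_any (\<lambda>j. ((of_int m + 1) gchoose j) *\<^sub>C f j) =
     Sum_any (\<lambda>j. (of_int m gchoose j) *\<^sub>C f j) + Sum_any (\<lambda>j. (of_int m gchoose j) *\<^sub>C f (Suc j))"
proof -
  note fin = finite_scaled[OF assms] finite_scaled[OF finite_shifted_nat[OF assms]]
    finite_scaled[OF finite_shifted_nat[OF assms], of "\<lambda>j. of_int m gchoose Suc j"]
  show ?thesis
    unfolding Sum_any_nat_split[OF fin(1), of "\<lambda>j. of_int m + 1 gchoose j"]
      Sum_any_nat_split[OF fin(1), of "\<lambda>j. of_int m gchoose j"]
      gbinomial_Suc_Suc cscale_add_left Sum_any.distrib[OF fin(2) fin(3)]
    by (simp add: add.assoc add.commute)
qed

lemma product_side_finite:
  assumes "trunc2 X"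
  shows "finite {j::nat. X (m - int j) (k + int j) \<noteq> 0}"
proof -
  obtain K where K: "\<And>m k. k \<ge> K \<Longrightarrow> X m k = 0" using trunc2_bound[OF assms] by blast
  show ?thesis
    by (rule finite_nat_bounded[of _ "K - k"], rule ccontr) (simp add: K)
qed

lemma pascal3_product_side:
  assumes "trunc2 X" shows "pascal3 (product_side X)"
  unfolding pascal3_def
proof (intro allI)
  fix m n k
  define f where "f j = (-1) ^ j *\<^sub>C X (m + n + 1 - int j) (k + int j)" for j
  have fin: "finite {j. f j \<noteq> 0}"
    unfolding f_def by (rule finite_scaled[OF product_side_finite[OF assms]])
  have "product_side X m (n + 1) k = Sum_any (\<lambda>j. (of_int n + 1 gchoose j) *\<^sub>C f j)"
    by (simp add: product_side_def f_def algebra_simps)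
  moreover have "product_side X (m + 1) n k = Sum_any (\<lambda>j. (of_int n gchoose j) *\<^sub>C f j)"
    by (simp add: product_side_def f_def algebra_simps)
  moreover have "product_side X m n (k + 1) = - Sum_any (\<lambda>j. (of_int n gchoose j) *\<^sub>C f (Suc j))"
    by (simp add: product_side_def f_def algebra_simps Sum_any_uminus[symmetric])
  ultimately show "product_side X (m + 1) n k = product_side X m (n + 1) k + product_side X m n (k + 1)"
    by (simp add: Sum_any_pascal[OF fin])
qed

lemma trunc2_bound_transposed:
  assumes "trunc2 (\<lambda>k m. X m k)" shows "\<exists>M. \<forall>m\<ge>M. \<forall>k. X m k = 0"
  using assms unfolding trunc2_def by simp

lemma trunc2_uniform_transposed:
  assumes "trunc2 (\<lambda>k m. X m k)" shows "\<exists>K. \<forall>k\<ge>K. \<forall>i\<ge>m. X i k = 0"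
  using trunc2_uniform[OF assms, of m] .

lemma reverse_side_finite:
  assumes "trunc2 (\<lambda>k m. X m k)"
  shows "finite {j::nat. X (m + int j) (k - int j) \<noteq> 0}"
proof -
  obtain M where M: "\<And>m k. m \<ge> M \<Longrightarrow> X m k = 0" using trunc2_bound_transposed[OF assms] by blast
  show ?thesis
    by (rule finite_nat_bounded[of _ "M - m"], rule ccontr) (simp add: M)
qed

lemma pascal3_reverse_side:
  assumes "trunc2 (\<lambda>k m. X m k)" shows "pascal3 (reverse_side X)"
  unfolding pascal3_def
proof (intro allI)
  fix m n k
  define f where "f j = (-1) ^ j *\<^sub>C X (m + int j) (n + k + 1 - int j)" for j
  have fin: "finite {j. f j \<noteq> 0}"
    unfolding f_def by (rule finite_scaled[OF reverse_side_finite[OF assms]])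
  have "reverse_side X m (n + 1) k = - ((-1) powi n *\<^sub>C Sum_any (\<lambda>j. (of_int n + 1 gchoose j) *\<^sub>C f j))"
    by (simp add: reverse_side_def f_def algebra_simps power_int_add)
  moreover have "reverse_side X (m + 1) n k =
      - ((-1) powi n *\<^sub>C Sum_any (\<lambda>j. (of_int n gchoose j) *\<^sub>C f (Suc j)))"
    by (simp add: reverse_side_def f_def algebra_simps Sum_any_uminus)
  moreover have "reverse_side X m n (k + 1) = (-1) powi n *\<^sub>C Sum_any (\<lambda>j. (of_int n gchoose j) *\<^sub>C f j)"
    by (simp add: reverse_side_def f_def algebra_simps)
  ultimately show "reverse_side X (m + 1) n k = reverse_side X m (n + 1) k + reverse_side X m n (k + 1)"
    by (simp add: Sum_any_pascal[OF fin] cscale_add_right)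
qed

lemma iterate_side_finite:
  assumes "trunc2 (\<lambda>k n. Z n k)"
  shows "finite {j::nat. Z (n + int j) (k - int j) \<noteq> 0}"
  by (rule reverse_side_finite[OF assms])

lemma pascal3_iterate_side:
  assumes "trunc2 (\<lambda>k n. Z n k)" shows "pascal3 (iterate_side Z)"
  unfolding pascal3_def
proof (intro allI)
  fix m n k
  define f where "f j = Z (n + int j) (m + k + 1 - int j)" for j
  have fin: "finite {j. f j \<noteq> 0}"
    unfolding f_def by (rule iterate_side_finite[OF assms])
  have "iterate_side Z (m + 1) n k = Sum_any (\<lambda>j. (of_int m + 1 gchoose j) *\<^sub>C f j)"
    by (simp add: iterate_side_def f_def algebra_simps)
  moreover have "iterate_side Z m (n + 1) k = Sum_any (\<lambda>j. (of_int m gchoose j) *\<^sub>C f (Suc j))"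
    by (simp add: iterate_side_def f_def algebra_simps)
  moreover have "iterate_side Z m n (k + 1) = Sum_any (\<lambda>j. (of_int m gchoose j) *\<^sub>C f j)"
    by (simp add: iterate_side_def f_def algebra_simps)
  ultimately show "iterate_side Z (m + 1) n k = iterate_side Z m (n + 1) k + iterate_side Z m n (k + 1)"
    by (simp add: Sum_any_pascal[OF fin])
qed

lemma gchoose_zero_left: "((0::complex) gchoose j) = (if j = 0 then 1 else 0)"
  by (cases j) (simp_all add: gbinomial_0)

text \<open>At exponent zero only \<open>j = 0\<close> survives, so each side gives back its
  defining series. These are the slices by which the sides are identified.\<close>

lemma product_side_0: "product_side X m 0 k = X m k"
  and reverse_side_0: "reverse_side X m 0 k = X m k"
  and iterate_side_0: "iterate_side X 0 n k = X n k"
  unfolding product_side_def reverse_side_def iterate_side_def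
  by (subst Sum_any_single[of 0]; simp add: gchoose_zero_left)+

lemma trunc3_product_side:
  assumes "trunc2 X" shows "trunc3 (product_side X)"
proof -
  obtain K where K: "\<And>m k. k \<ge> K \<Longrightarrow> X m k = 0" using trunc2_bound[OF assms] by blast
  then have "product_side X m n k = 0" if "k \<ge> K" for m n k
    using that by (simp add: product_side_def)
  moreover have "\<exists>T. \<forall>m n k. k \<ge> k0 \<longrightarrow> m + n \<ge> T \<longrightarrow> product_side X m n k = 0" for k0
  proof -
    obtain M where M: "\<And>m k. m \<ge> M \<Longrightarrow> k \<ge> k0 \<Longrightarrow> X m k = 0"
      using trunc2_uniform[OF assms] by blast
    \<comment> \<open>If \<open>k + j < K\<close> then \<open>j < K - k0\<close>, which leaves
      \<open>m + n - j\<close> above \<open>M\<close>.\<close>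
    have "X (m + n - int j) (k + int j) = 0" if "k \<ge> k0" "m + n \<ge> M + K - k0" for m n k j
      using that K[of "k + int j" "m + n - int j"] M[of "m + n - int j" "k + int j"]
      by (cases "k + int j \<ge> K") auto
    then show ?thesis by (intro exI[of _ "M + K - k0"]) (simp add: product_side_def)
  qed
  ultimately show ?thesis unfolding trunc3_def by blast
qed

lemma trunc2_reverse_side:
  assumes "trunc2 (\<lambda>k m. X m k)" shows "trunc2 (\<lambda>k m. reverse_side X m n k)"
proof -
  obtain M where M: "\<And>m k. m \<ge> M \<Longrightarrow> X m k = 0" using trunc2_bound_transposed[OF assms] by blast
  then have "reverse_side X m n k = 0" if "m \<ge> M" for m k
    using that by (simp add: reverse_side_def)
  moreover have "\<exists>K. \<forall>k\<ge>K. reverse_side X m n k = 0" for m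
  proof -
    obtain K where K: "\<And>i k. k \<ge> K \<Longrightarrow> i \<ge> m \<Longrightarrow> X i k = 0"
      using trunc2_uniform_transposed[OF assms] by blast
    have "X (m + int j) (n + k - int j) = 0" if "k \<ge> K + M - m - n" for k j
      using that K[of "n + k - int j" "m + int j"] M[of "m + int j" "n + k - int j"]
      by (cases "m + int j \<ge> M") auto
    then show ?thesis by (intro exI[of _ "K + M - m - n"]) (simp add: reverse_side_def)
  qed
  ultimately show ?thesis unfolding trunc2_def by blast
qed

lemma trunc2_iterate_side:
  assumes "trunc2 (\<lambda>k n. Z n k)" shows "trunc2 (\<lambda>k n. iterate_side Z m n k)"
proof -
  obtain N where N: "\<And>n k. n \<ge> N \<Longrightarrow> Z n k = 0" using trunc2_bound_transposed[OF assms] by blast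
  then have "iterate_side Z m n k = 0" if "n \<ge> N" for n k
    using that by (simp add: iterate_side_def)
  moreover have "\<exists>K. \<forall>k\<ge>K. iterate_side Z m n k = 0" for n
  proof -
    obtain K where K: "\<And>i k. k \<ge> K \<Longrightarrow> i \<ge> n \<Longrightarrow> Z i k = 0"
      using trunc2_uniform_transposed[OF assms] by blast
    have "Z (n + int j) (m + k - int j) = 0" if "k \<ge> K + N - m - n" for k j
      using that K[of "m + k - int j" "n + int j"] N[of "n + int j" "m + k - int j"]
      by (cases "n + int j \<ge> N") auto
    then show ?thesis by (intro exI[of _ "K + N - m - n"]) (simp add: iterate_side_def)
  qed
  ultimately show ?thesis unfolding trunc2_def by blast
qed

text \<open>The three truncations record the expansion domains: \<open>X\<close> for
  \<open>|z1| > |z2|\<close>, \<open>X'\<close> for \<open>|z2| > |z1|\<close>, and \<open>Z\<close>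
  for \<open>|z2| > |z1 - z2|\<close>. Any sign from odd fields is part of
  \<open>X'\<close>.\<close>

definition borcherds_triple ::
  "(int \<Rightarrow> int \<Rightarrow> 'a::complex_vs) \<Rightarrow> (int \<Rightarrow> int \<Rightarrow> 'a) \<Rightarrow> (int \<Rightarrow> int \<Rightarrow> 'a) \<Rightarrow> bool" where
  "borcherds_triple X X' Z \<longleftrightarrow>
     trunc2 X \<and> trunc2 (\<lambda>k m. X' m k) \<and> trunc2 (\<lambda>k n. Z n k) \<and>
     (\<forall>m n k. iterate_side Z m n k = product_side X m n k - reverse_side X' m n k)"

lemma iterate_side_vanish:
  assumes "trunc2 (\<lambda>k n. Z n k)" shows "\<exists>N. \<forall>m n k. n \<ge> N \<longrightarrow> iterate_side Z m n k = 0"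
proof -
  obtain N where N: "\<And>n k. n \<ge> N \<Longrightarrow> Z n k = 0" using trunc2_bound_transposed[OF assms] by blast
  then show ?thesis by (intro exI[of _ N]) (simp add: iterate_side_def)
qed

lemma reverse_side_vanish:
  assumes "trunc2 (\<lambda>k m. X m k)" shows "\<exists>M. \<forall>m n k. m \<ge> M \<longrightarrow> reverse_side X m n k = 0"
proof -
  obtain M where M: "\<And>m k. m \<ge> M \<Longrightarrow> X m k = 0" using trunc2_bound_transposed[OF assms] by blast
  then show ?thesis by (intro exI[of _ M]) (simp add: reverse_side_def)
qed

lemma boxed_transposed:
  assumes "trunc2 (\<lambda>k m. X m k)" "trunc2 (\<lambda>k m. Y m k)" shows "boxed X Y"
  using boxed_swap[OF boxed_trunc2[OF assms]] .

lemma trunc2_conv_transposed: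
  assumes "trunc2 (\<lambda>k m. X m k)" "trunc2 (\<lambda>k m. Y m k)" shows "trunc2 (\<lambda>k m. conv X Y m k)"
proof -
  have "(\<lambda>k m. conv X Y m k) = conv (\<lambda>k m. X m k) (\<lambda>k m. Y m k)"
    by (intro ext) (rule conv_swap[symmetric])
  then show ?thesis using trunc2_conv[OF assms] by simp
qed

text \<open>Both expressions solve the recursion, are truncated in \<open>k\<close>, and agree at
  \<open>n = 0\<close>; uniqueness replaces any manipulation of products of binomial sums.\<close>

lemma product_side_conv:
  assumes "trunc2 X" "trunc2 Y"
  shows "product_side (conv X Y) m n k =
    conv (\<lambda>m k. product_side X m n k) (\<lambda>m k. product_side Y m 0 k) m k"
proof -
  note t = trunc3_product_side[OF assms(1)] trunc3_product_side[OF assms(2)]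
  note p = pascal3_product_side[OF assms(1)] pascal3_product_side[OF assms(2)]
  note box = boxed_trunc2[OF trunc3_slices(1)[OF t(1)] trunc3_slices(1)[OF t(2)]]
  obtain K where K: "\<And>m n k. k \<ge> K \<Longrightarrow> product_side X m n k = 0" using t(1) unfolding trunc3_def by blast
  obtain L where L: "\<And>m n k. k \<ge> L \<Longrightarrow> product_side Y m n k = 0" using t(2) unfolding trunc3_def by blast
  obtain J where J: "\<And>m n k. k \<ge> J \<Longrightarrow> product_side (conv X Y) m n k = 0"
    using trunc3_product_side[OF trunc2_conv[OF assms]] unfolding trunc3_def by blast
  define Q where "Q m n k = conv (\<lambda>m k. product_side X m n k) (\<lambda>m k. product_side Y m 0 k) m k" for m n k
  have Q: "Q m n k = 0" if "k \<ge> K + L" for m n k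
    unfolding Q_def by (rule conv_zero_bound[OF K L that])
  have "product_side (conv X Y) m n k - Q m n k = 0"
  proof (rule pascal3_zero_k[where H = "\<lambda>m n k. product_side (conv X Y) m n k - Q m n k" and K = "max J (K + L)"])
    show "pascal3 (\<lambda>m n k. product_side (conv X Y) m n k - Q m n k)"
      unfolding Q_def
      by (intro pascal3_diff pascal3_product_side trunc2_conv assms conv_slices_n(2) p box)
  qed (simp_all add: J Q product_side_0, simp add: Q_def product_side_0)
  then show ?thesis by (simp add: Q_def)
qed

lemma reverse_side_conv:
  assumes "trunc2 (\<lambda>k m. X m k)" "trunc2 (\<lambda>k m. Y m k)"
  shows "reverse_side (conv X Y) m n k =
    conv (\<lambda>m k. reverse_side X m n k) (\<lambda>m k. reverse_side Y m 0 k) m k"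
proof -
  note p = pascal3_reverse_side[OF assms(1)] pascal3_reverse_side[OF assms(2)]
  note box = boxed_transposed[OF trunc2_reverse_side[OF assms(1)] trunc2_reverse_side[OF assms(2)]]
  obtain K where K: "\<And>m n k. m \<ge> K \<Longrightarrow> reverse_side X m n k = 0"
    using reverse_side_vanish[OF assms(1)] by blast
  obtain L where L: "\<And>m n k. m \<ge> L \<Longrightarrow> reverse_side Y m n k = 0"
    using reverse_side_vanish[OF assms(2)] by blast
  obtain J where J: "\<And>m n k. m \<ge> J \<Longrightarrow> reverse_side (conv X Y) m n k = 0"
    using reverse_side_vanish[OF trunc2_conv_transposed[OF assms]] by blast
  define Q where "Q m n k = conv (\<lambda>m k. reverse_side X m n k) (\<lambda>m k. reverse_side Y m 0 k) m k" for m n k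
  have Q: "Q m n k = 0" if "m \<ge> K + L" for m n k
    unfolding Q_def by (rule conv_zero_bound_transposed[OF K L that])
  have "reverse_side (conv X Y) m n k - Q m n k = 0"
  proof (rule pascal3_zero_m[where H = "\<lambda>m n k. reverse_side (conv X Y) m n k - Q m n k" and M = "max J (K + L)"])
    show "pascal3 (\<lambda>m n k. reverse_side (conv X Y) m n k - Q m n k)"
      unfolding Q_def
      by (intro pascal3_diff pascal3_reverse_side trunc2_conv_transposed assms conv_slices_n(2) p box)
  qed (simp_all add: J Q reverse_side_0, simp add: Q_def reverse_side_0)
  then show ?thesis by (simp add: Q_def)
qed

text \<open>Here uniqueness uses truncation in \<open>n\<close> and the slice \<open>m = 0\<close>,
  so the product is formed in the coordinates \<open>(z0, z2)\<close>.\<close>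

lemma iterate_side_conv:
  assumes "trunc2 (\<lambda>k n. X n k)" "trunc2 (\<lambda>k n. Y n k)"
  shows "iterate_side (conv X Y) m n k =
    conv (\<lambda>n k. iterate_side X m n k) (\<lambda>n k. iterate_side Y 0 n k) n k"
proof -
  note p = pascal3_iterate_side[OF assms(1)] pascal3_iterate_side[OF assms(2)]
  note box = boxed_transposed[OF trunc2_iterate_side[OF assms(1)] trunc2_iterate_side[OF assms(2)]]
  obtain K where K: "\<And>m n k. n \<ge> K \<Longrightarrow> iterate_side X m n k = 0"
    using iterate_side_vanish[OF assms(1)] by blast
  obtain L where L: "\<And>m n k. n \<ge> L \<Longrightarrow> iterate_side Y m n k = 0"
    using iterate_side_vanish[OF assms(2)] by blast
  obtain J where J: "\<And>m n k. n \<ge> J \<Longrightarrow> iterate_side (conv X Y) m n k = 0"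
    using iterate_side_vanish[OF trunc2_conv_transposed[OF assms]] by blast
  define Q where "Q m n k = conv (\<lambda>n k. iterate_side X m n k) (\<lambda>n k. iterate_side Y 0 n k) n k" for m n k
  have Q: "Q m n k = 0" if "n \<ge> K + L" for m n k
    unfolding Q_def by (rule conv_zero_bound_transposed[OF K L that])
  have "iterate_side (conv X Y) m n k - Q m n k = 0"
  proof (rule pascal3_zero_n[where H = "\<lambda>m n k. iterate_side (conv X Y) m n k - Q m n k" and N = "max J (K + L)"])
    show "pascal3 (\<lambda>m n k. iterate_side (conv X Y) m n k - Q m n k)"
      unfolding Q_def
      by (intro pascal3_diff pascal3_iterate_side trunc2_conv_transposed assms conv_slices_m(2) p box)
  qed (simp_all add: J Q iterate_side_0, simp add: Q_def iterate_side_0)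
  then show ?thesis by (simp add: Q_def)
qed

text \<open>The defect of the identity for the product vanishes for large \<open>n\<close>, where both
  orders agree in each factor, and for large \<open>m\<close>, where the iterate agrees with the product
  in each factor; the recursion in \<open>(m, n, k)\<close> then forces it to vanish identically.\<close>

theorem borcherds_triple_conv:
  assumes "borcherds_triple X X' Z" "borcherds_triple Y Y' W"
  shows "borcherds_triple (conv X Y) (conv X' Y') (conv Z W)"
proof -
  have t: "trunc2 X" "trunc2 (\<lambda>k m. X' m k)" "trunc2 (\<lambda>k n. Z n k)"
    "trunc2 Y" "trunc2 (\<lambda>k m. Y' m k)" "trunc2 (\<lambda>k n. W n k)"
    and XZ: "\<And>m n k. iterate_side Z m n k = product_side X m n k - reverse_side X' m n k"
    and YW: "\<And>m n k. iterate_side W m n k = product_side Y m n k - reverse_side Y' m n k"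
    using assms by (auto simp: borcherds_triple_def)
  note tc = trunc2_conv[OF t(1,4)] trunc2_conv_transposed[OF t(2,5)] trunc2_conv_transposed[OF t(3,6)]
  note pX = pascal3_product_side[OF t(1)] and pY = pascal3_product_side[OF t(4)]
    and tX = trunc3_product_side[OF t(1)] and tY = trunc3_product_side[OF t(4)]
  note boxP = boxed_trunc2[OF trunc3_slices(1)[OF tX] trunc3_slices(1)[OF tY]]
    and boxP' = boxed_trunc2[OF trunc3_slices(2)[OF tX] trunc3_slices(2)[OF tY]]
    and boxR = boxed_transposed[OF trunc2_reverse_side[OF t(2)] trunc2_reverse_side[OF t(5)]]
    and boxI = boxed_transposed[OF trunc2_iterate_side[OF t(3)] trunc2_iterate_side[OF t(6)]]
  obtain N1 where N1: "\<And>m n k. n \<ge> N1 \<Longrightarrow> iterate_side Z m n k = 0"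
    using iterate_side_vanish[OF t(3)] by blast
  obtain N2 where N2: "\<And>m n k. n \<ge> N2 \<Longrightarrow> iterate_side W m n k = 0"
    using iterate_side_vanish[OF t(6)] by blast
  obtain N3 where N3: "\<And>m n k. n \<ge> N3 \<Longrightarrow> iterate_side (conv Z W) m n k = 0"
    using iterate_side_vanish[OF tc(3)] by blast
  obtain M1 where M1: "\<And>m n k. m \<ge> M1 \<Longrightarrow> reverse_side X' m n k = 0"
    using reverse_side_vanish[OF t(2)] by blast
  obtain M2 where M2: "\<And>m n k. m \<ge> M2 \<Longrightarrow> reverse_side Y' m n k = 0"
    using reverse_side_vanish[OF t(5)] by blast
  obtain M3 where M3: "\<And>m n k. m \<ge> M3 \<Longrightarrow> reverse_side (conv X' Y') m n k = 0"
    using reverse_side_vanish[OF tc(2)] by blast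
  define D where "D m n k = product_side (conv X Y) m n k - reverse_side (conv X' Y') m n k
    - iterate_side (conv Z W) m n k" for m n k
  have pD: "pascal3 D"
    unfolding D_def
    by (intro pascal3_diff pascal3_product_side pascal3_reverse_side pascal3_iterate_side tc)
  have Dn: "D m n k = 0" if n: "n \<ge> max N3 (N1 + N2)" for m n k
  proof -
    \<comment> \<open>Writing \<open>n\<close> as \<open>(n - N2) + N2\<close> puts both factors
      where their iterate vanishes, so that product and reversed product coincide there.\<close>
    have "product_side (conv X Y) m n k =
        conv (\<lambda>m k. product_side X m (n - N2) k) (\<lambda>m k. product_side Y m N2 k) m k"
      by (simp add: product_side_conv[OF t(1,4)] conv_slices_n(1)[OF pX pY boxP, of "n - N2" N2])
    also have "(\<lambda>m k. product_side X m (n - N2) k) = (\<lambda>m k. reverse_side X' m (n - N2) k)"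
      using XZ N1 n by (simp add: fun_eq_iff)
    also have "(\<lambda>m k. product_side Y m N2 k) = (\<lambda>m k. reverse_side Y' m N2 k)"
      using YW N2 by (simp add: fun_eq_iff)
    also have "conv (\<lambda>m k. reverse_side X' m (n - N2) k) (\<lambda>m k. reverse_side Y' m N2 k) m k =
        reverse_side (conv X' Y') m n k"
      by (simp add: reverse_side_conv[OF t(2,5)] conv_slices_n(1)[OF pascal3_reverse_side[OF t(2)]
            pascal3_reverse_side[OF t(5)] boxR, of "n - N2" N2])
    finally show ?thesis using N3 n by (simp add: D_def)
  qed
  have Dm: "D m n k = 0" if m: "m \<ge> max M3 (M1 + M2)" for m n k
  proof -
    \<comment> \<open>Writing \<open>m\<close> as \<open>(m - M2) + M2\<close> puts both factors
      where the reversed product vanishes, so that iterate and product coincide there.\<close>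
    have "iterate_side (conv Z W) m n k =
        conv (\<lambda>n k. iterate_side Z (m - M2) n k) (\<lambda>n k. iterate_side W M2 n k) n k"
      by (simp add: iterate_side_conv[OF t(3,6)] conv_slices_m(1)[OF pascal3_iterate_side[OF t(3)]
            pascal3_iterate_side[OF t(6)] boxI, of "m - M2" M2])
    also have "(\<lambda>n k. iterate_side Z (m - M2) n k) = (\<lambda>n k. product_side X (m - M2) n k)"
      using XZ M1 m by (simp add: fun_eq_iff)
    also have "(\<lambda>n k. iterate_side W M2 n k) = (\<lambda>n k. product_side Y M2 n k)"
      using YW M2 by (simp add: fun_eq_iff)
    also have "conv (\<lambda>n k. product_side X (m - M2) n k) (\<lambda>n k. product_side Y M2 n k) n k =
        product_side (conv X Y) m n k"
      \<comment> \<open>The product side was multiplied in \<open>(z1, z2)\<close> and the iterate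
        in \<open>(z0, z2)\<close>; the change of coordinates reconciles the two.\<close>
      by (simp add: product_side_conv[OF t(1,4)] conv_change_coordinates[OF pX tX pY tY]
          conv_slices_m(1)[OF pX pY boxP', of "m - M2" M2])
    finally show ?thesis using M3 m by (simp add: D_def)
  qed
  have "D m n k = 0" for m n k
    by (rule pascal3_zero_nm[OF pD Dn Dm])
  then show ?thesis
    using tc by (simp add: borcherds_triple_def D_def)
qed

lemma product_side_add:
  assumes "trunc2 X" "trunc2 Y"
  shows "product_side (\<lambda>m k. X m k + Y m k) m n k = product_side X m n k + product_side Y m n k"
  unfolding product_side_def cscale_add_right
  by (intro Sum_any.distrib finite_scaled product_side_finite assms)

lemma reverse_side_add:
  assumes "trunc2 (\<lambda>k m. X m k)" "trunc2 (\<lambda>k m. Y m k)"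
  shows "reverse_side (\<lambda>m k. X m k + Y m k) m n k = reverse_side X m n k + reverse_side Y m n k"
  unfolding reverse_side_def cscale_add_right
  by (subst Sum_any.distrib) (intro finite_scaled reverse_side_finite assms cscale_add_right)+

lemma iterate_side_add:
  assumes "trunc2 (\<lambda>k n. X n k)" "trunc2 (\<lambda>k n. Y n k)"
  shows "iterate_side (\<lambda>n k. X n k + Y n k) m n k = iterate_side X m n k + iterate_side Y m n k"
  unfolding iterate_side_def cscale_add_right
  by (intro Sum_any.distrib finite_scaled iterate_side_finite assms)

lemma trunc2_add:
  assumes "trunc2 X" "trunc2 Y" shows "trunc2 (\<lambda>m k. X m k + Y m k)"
proof -
  have max: "(\<exists>M::int. \<forall>m\<ge>M. P m) \<Longrightarrow> (\<exists>M. \<forall>m\<ge>M. Q m) \<Longrightarrow> (\<exists>M. \<forall>m\<ge>M. P m \<and> Q m)" for P Q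
    by (metis (full_types) max.boundedE)
  from assms have "\<exists>K. \<forall>k\<ge>K. (\<forall>m. X m k = 0) \<and> (\<forall>m. Y m k = 0)"
    "\<exists>M. \<forall>m\<ge>M. X m k = 0 \<and> Y m k = 0" for k
    unfolding trunc2_def by (intro max; blast)+
  then show ?thesis unfolding trunc2_def by (metis add.right_neutral)
qed

lemma borcherds_triple_add:
  assumes "borcherds_triple X X' Z" "borcherds_triple Y Y' W"
  shows "borcherds_triple (\<lambda>m k. X m k + Y m k) (\<lambda>m k. X' m k + Y' m k) (\<lambda>n k. Z n k + W n k)"
proof -
  have t: "trunc2 X" "trunc2 (\<lambda>k m. X' m k)" "trunc2 (\<lambda>k n. Z n k)"
    "trunc2 Y" "trunc2 (\<lambda>k m. Y' m k)" "trunc2 (\<lambda>k n. W n k)"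
    using assms by (auto simp: borcherds_triple_def)
  show ?thesis
    using assms trunc2_add[OF t(1,4)] trunc2_add[OF t(2,5)] trunc2_add[OF t(3,6)]
    by (simp add: borcherds_triple_def product_side_add[OF t(1,4)] reverse_side_add[OF t(2,5)]
        iterate_side_add[OF t(3,6)])
qed

section \<open>Modules\<close>

text \<open>\<open>module_triple Y P e u v w\<close> is the Borcherds identity for \<open>u\<close>, \<open>v\<close> of sign \<open>e\<close> on the
  vector \<open>w\<close>, where \<open>P\<close> gives the products of the algebra.\<close>

definition module_triple ::
  "('v::complex_vs \<Rightarrow> int \<Rightarrow> 'w::complex_vs \<Rightarrow> 'w) \<Rightarrow> ('v \<Rightarrow> int \<Rightarrow> 'v \<Rightarrow> 'v) \<Rightarrow> complex \<Rightarrow>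
   'v \<Rightarrow> 'v \<Rightarrow> 'w \<Rightarrow> bool" where
  "module_triple Y P e u v w \<longleftrightarrow>
     borcherds_triple (\<lambda>m k. Y u m (Y v k w)) (\<lambda>m k. e *\<^sub>C Y v k (Y u m w)) (\<lambda>n k. Y (P u n v) k w)"

lemma field_action_zero:
  assumes "field_action Y" shows "Y u n 0 = 0" "Y 0 n w = 0"
  using clinear_zero[OF field_action_linear[OF assms]]
    clinear_zero[OF field_action_linear_left[OF assms], of n w] by auto

lemma field_action_trunc2:
  assumes Y: "field_action Y"
  shows "trunc2 (\<lambda>m k. Y u m (Y v k w))"
    and "trunc2 (\<lambda>k m. e *\<^sub>C Y v k (Y u m w))"
    and "field_action P \<Longrightarrow> trunc2 (\<lambda>k n. Y (P u n v) k w)"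
proof -
  show "trunc2 (\<lambda>m k. Y u m (Y v k w))"
    unfolding trunc2_def using field_action_bounded[OF Y] by (metis field_action_zero(1)[OF Y])
  show "trunc2 (\<lambda>k m. e *\<^sub>C Y v k (Y u m w))"
    unfolding trunc2_def
    using field_action_bounded[OF Y] by (metis field_action_zero(1)[OF Y] cvs.scale_zero_right)
  show "trunc2 (\<lambda>k n. Y (P u n v) k w)" if P: "field_action P"
    unfolding trunc2_def
    using field_action_bounded[OF Y] field_action_bounded[OF P] by (metis field_action_zero(2)[OF Y])
qed

text \<open>Truncation allows the single sum to be split in two. The sign \<open>e\<close> moves
  into the reversed series, while \<open>(-1)^n\<close> belongs to expanding
  \<open>(z1 - z2)^n\<close> in powers of \<open>z1\<close>.\<close>

lemma borcherds_right_side: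
  assumes Y: "field_action Y"
  shows "Sum_any (\<lambda>j::nat. ((-1) ^ j * (of_int n gchoose j)) *\<^sub>C
          (Y u (m + n - int j) (Y v (k + int j) w)
           - (e * (-1) powi n) *\<^sub>C Y v (n + k - int j) (Y u (m + int j) w))) =
    product_side (\<lambda>m k. Y u m (Y v k w)) m n k - reverse_side (\<lambda>m k. e *\<^sub>C Y v k (Y u m w)) m n k"
proof -
  have f1: "finite {j. ((-1) ^ j * (complex_of_int n gchoose j)) *\<^sub>C
      Y u (m + n - int j) (Y v (k + int j) w) \<noteq> 0}"
    by (rule finite_scaled[OF product_side_finite[OF field_action_trunc2(1)[OF Y]]])
  have f2: "finite {j. ((-1) ^ j * (complex_of_int n gchoose j)) *\<^sub>C
      e *\<^sub>C Y v (n + k - int j) (Y u (m + int j) w) \<noteq> 0}"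
    by (rule finite_scaled[OF reverse_side_finite[OF field_action_trunc2(2)[OF Y]]])
  have f3: "finite {j. (-1) powi n *\<^sub>C ((-1) ^ j * (complex_of_int n gchoose j)) *\<^sub>C
      (e *\<^sub>C Y v (n + k - int j) (Y u (m + int j) w)) \<noteq> 0}"
    by (rule finite_subset[OF _ f2]) auto
  show ?thesis
    unfolding product_side_def reverse_side_def Sum_any_scale[OF f2, symmetric]
      Sum_any_diff[OF f1 f3, symmetric]
    by (rule Sum_any.cong) (simp add: cvs.scale_right_diff_distrib mult_ac)
qed

lemma borcherds_identity_iff:
  assumes Y: "field_action Y" and P: "field_action (prd V)"
  shows "borcherds_identity V Y \<longleftrightarrow>
    (\<forall>p q. \<forall>u\<in>part V p. \<forall>v\<in>part V q. \<forall>w. module_triple Y (prd V) (koszul p q) u v w)"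
  unfolding borcherds_identity_def module_triple_def borcherds_triple_def
    borcherds_right_side[OF Y] iterate_side_def
  by (simp add: field_action_trunc2[OF Y] P)

lemma vsa_module_triple:
  assumes "vertex_superalgebra V" "vsa_module V Y" "u \<in> part V p" "v \<in> part V q"
  shows "module_triple Y (prd V) (koszul p q) u v w"
proof -
  have "field_action (prd V)"
    using assms(1) vsa_module_field_action by (auto simp: vertex_superalgebra_def)
  then show ?thesis
    using assms borcherds_identity_iff[OF vsa_module_field_action[OF assms(2)]]
    by (auto simp: vsa_module_def)
qed

text \<open>The case \<open>m = 0\<close> of the Borcherds identity, which writes modes of a product
  through modes of its factors.\<close>

lemma module_triple_iterate:
  assumes "field_action Y" "module_triple Y P e u v w"
  shows "Y (P u n v) k w = Sum_any (\<lambda>j::nat. ((-1) ^ j * (of_int n gchoose j)) *\<^sub>C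
          (Y u (n - int j) (Y v (k + int j) w)
           - (e * (-1) powi n) *\<^sub>C Y v (n + k - int j) (Y u (int j) w)))"
proof -
  have "iterate_side (\<lambda>n k. Y (P u n v) k w) 0 n k = product_side (\<lambda>m k. Y u m (Y v k w)) 0 n k
      - reverse_side (\<lambda>m k. e *\<^sub>C Y v k (Y u m w)) 0 n k"
    using assms(2) unfolding module_triple_def borcherds_triple_def by blast
  then show ?thesis
    using borcherds_right_side[OF assms(1), of n u 0 v k w e] by (simp add: iterate_side_0)
qed

lemma minus_one_gchoose: "(-1) ^ j * ((-1 :: complex) gchoose j) = 1"
  using gbinomial_minus[of "1::complex" j]
  by (simp add: power_mult_distrib[symmetric] mult.assoc[symmetric] binomial_gbinomial[symmetric])

text \<open>For \<open>n = -1\<close> all coefficients become 1 and the factor \<open>(-1)^n\<close>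
  turns the difference into a sum.\<close>

lemma module_triple_normal_ordered:
  assumes "field_action Y" "module_triple Y P e u v w"
  shows "Y (P u (-1) v) k w = Sum_any (\<lambda>j::nat.
          Y u (-1 - int j) (Y v (k + int j) w) + e *\<^sub>C Y v (k - 1 - int j) (Y u (int j) w))"
  unfolding module_triple_iterate[OF assms]
  by (rule Sum_any.cong) (simp add: minus_one_gchoose diff_diff_eq)

text \<open>The case \<open>n = 0\<close>, where nothing is expanded on the right and only the
  singular products of \<open>u\<close> and \<open>v\<close> enter.\<close>

lemma module_triple_commutator:
  assumes "module_triple Y P e u v w"
  shows "Y u m (Y v k w) - e *\<^sub>C Y v k (Y u m w) =
    Sum_any (\<lambda>j::nat. (of_int m gchoose j) *\<^sub>C Y (P u (int j) v) (m + k - int j) w)"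
proof -
  have "iterate_side (\<lambda>n k. Y (P u n v) k w) m 0 k = product_side (\<lambda>m k. Y u m (Y v k w)) m 0 k
      - reverse_side (\<lambda>m k. e *\<^sub>C Y v k (Y u m w)) m 0 k"
    using assms unfolding module_triple_def borcherds_triple_def by blast
  then show ?thesis by (simp add: product_side_0 reverse_side_0 iterate_side_def)
qed

text \<open>Modes of \<open>P u n v\<close> are finite sums of compositions of modes of
  \<open>u\<close> and \<open>v\<close>, so stability passes from generators to everything generated
  by them.\<close>

lemma module_triple_closed:
  assumes Y: "field_action Y" and U: "cvs.subspace U"
    and t: "\<And>w. w \<in> U \<Longrightarrow> module_triple Y P e u v w"
    and u: "\<And>n w. w \<in> U \<Longrightarrow> Y u n w \<in> U" and v: "\<And>n w. w \<in> U \<Longrightarrow> Y v n w \<in> U"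
    and w: "w \<in> U"
  shows "Y (P u n v) k w \<in> U"
  unfolding module_triple_iterate[OF Y t[OF w]]
  by (intro Sum_any_subspace U cvs.subspace_scale[OF U] cvs.subspace_diff[OF U] u v w)

lemma part_subspace: "vertex_superalgebra V \<Longrightarrow> cvs.subspace (part V p)"
  by (simp add: vertex_superalgebra_def internal_direct_sum_def)

lemma part_decomposition:
  assumes "vertex_superalgebra V"
  obtains v0 v1 where "v0 \<in> part V False" "v1 \<in> part V True" "v = v0 + v1"
proof -
  obtain f where f: "\<forall>i\<in>UNIV. f i \<in> part V i" "v = (\<Sum>i | f i \<noteq> 0. f i)"
    using assms unfolding vertex_superalgebra_def internal_direct_sum_def by blast
  have "v = sum f UNIV"
    unfolding f(2) by (rule sum.mono_neutral_left) auto
  then have "v = f False + f True" by (simp add: UNIV_bool)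
  then show ?thesis using f(1) that by blast
qed

lemma vertex_superalgebra_field_action: "vertex_superalgebra V \<Longrightarrow> field_action (prd V)"
  unfolding vertex_superalgebra_def by (blast intro: vsa_module_field_action)

text \<open>The Borcherds identity is available for parity homogeneous vectors only, so closure of
  \<open>K\<close> can be tested only on these. The sum \<open>K'\<close> of the homogeneous parts
  of \<open>K\<close> is an honest subalgebra between \<open>X\<close> and \<open>K\<close>.\<close>

lemma generated_subalgebra_subset:
  assumes V: "vertex_superalgebra V" and K: "cvs.subspace K" "vac V \<in> K"
    and X: "X \<subseteq> K" "\<And>x. x \<in> X \<Longrightarrow> \<exists>p. x \<in> part V p"
    and prd: "\<And>u v p q n. u \<in> K \<Longrightarrow> v \<in> K \<Longrightarrow> u \<in> part V p \<Longrightarrow> v \<in> part V q \<Longrightarrow> prd V u n v \<in> K"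
  shows "generated_subalgebra V X \<subseteq> K"
proof -
  define K' where "K' = {u0 + u1 | u0 u1. u0 \<in> K \<inter> part V False \<and> u1 \<in> K \<inter> part V True}"
  note ps = part_subspace[OF V]
  have zero: "0 \<in> K \<inter> part V p" for p
    using ps K(1) by (simp add: cvs.subspace_0)
  have in_K': "u \<in> K'" if "u \<in> K" "u \<in> part V p" for u p
  proof (cases p)
    case True
    then have "u = 0 + u" "u \<in> K \<inter> part V True" using that by auto
    then show ?thesis unfolding K'_def using zero[of False] by blast
  next
    case False
    then have "u = u + 0" "u \<in> K \<inter> part V False" using that by auto
    then show ?thesis unfolding K'_def using zero[of True] by blast
  qed
  have sub: "cvs.subspace K'"
  proof (rule cvs.subspaceI)
    show "0 \<in> K'" using in_K' zero by blast
    fix x y assume "x \<in> K'" "y \<in> K'"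
    then obtain x0 x1 y0 y1 where "x = x0 + x1" "y = y0 + y1"
      "x0 \<in> K \<inter> part V False" "y0 \<in> K \<inter> part V False"
      "x1 \<in> K \<inter> part V True" "y1 \<in> K \<inter> part V True" unfolding K'_def by blast
    moreover from this have "x + y = (x0 + y0) + (x1 + y1)" by (simp add: algebra_simps)
    ultimately show "x + y \<in> K'"
      unfolding K'_def using cvs.subspace_add[OF K(1)] cvs.subspace_add[OF ps] by blast
  next
    fix c x assume "x \<in> K'"
    then obtain x0 x1 where "x = x0 + x1" "x0 \<in> K \<inter> part V False" "x1 \<in> K \<inter> part V True"
      unfolding K'_def by blast
    moreover from this have "c *\<^sub>C x = c *\<^sub>C x0 + c *\<^sub>C x1" by (simp add: cscale_add_right)
    ultimately show "c *\<^sub>C x \<in> K'"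
      unfolding K'_def using cvs.subspace_scale[OF K(1)] cvs.subspace_scale[OF ps] by blast
  qed
  have "vertex_subalgebra V K'"
    unfolding vertex_subalgebra_def
  proof (intro conjI ballI allI sub)
    show "vac V \<in> K'" using in_K'[OF K(2)] V by (auto simp: vertex_superalgebra_def)
    fix u v n assume "u \<in> K'" "v \<in> K'"
    then obtain u0 u1 v0 v1 where uv: "u = u0 + u1" "v = v0 + v1"
      and K: "u0 \<in> K" "u1 \<in> K" "v0 \<in> K" "v1 \<in> K"
      and p: "u0 \<in> part V False" "u1 \<in> part V True" "v0 \<in> part V False" "v1 \<in> part V True"
      unfolding K'_def by blast
    have *: "prd V x n y \<in> K'" if "x \<in> K" "y \<in> K" "x \<in> part V p" "y \<in> part V q" for x y p q
    proof -
      have "prd V x n y \<in> part V (p \<noteq> q)" using V that unfolding vertex_superalgebra_def by blast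
      then show ?thesis by (rule in_K'[OF prd[OF that]])
    qed
    note F = vertex_superalgebra_field_action[OF V]
    have "prd V u n v = (prd V u0 n v0 + prd V u0 n v1) + (prd V u1 n v0 + prd V u1 n v1)"
      by (simp add: uv clinear_add[OF field_action_linear[OF F]] clinear_add[OF field_action_linear_left[OF F]])
    then show "prd V u n v \<in> K'"
      by (simp only:) (intro cvs.subspace_add[OF sub] *[OF K(1,3) p(1,3)] *[OF K(1,4) p(1,4)]
          *[OF K(2,3) p(2,3)] *[OF K(2,4) p(2,4)])
  qed
  moreover have "X \<subseteq> K'" using X in_K' by blast
  moreover have "K' \<subseteq> K" unfolding K'_def using cvs.subspace_add[OF K(1)] by blast
  ultimately show ?thesis unfolding generated_subalgebra_def by blast
qed

section \<open>The Borcherds identity on a tensor product\<close>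

lemma conv_scale_right:
  assumes "boxed X Y" shows "conv X (\<lambda>i l. s *\<^sub>C Y i l) m k = s *\<^sub>C conv X Y m k"
  unfolding conv_def Sum_any_scale[OF boxed_finite[OF assms, of m k], symmetric]
  by (simp add: tens_scale_right)

text \<open>On pure tensors the three series are coefficientwise products of the series of the
  factors. The left factor is even, so the whole sign sits in the second triple.\<close>

lemma module_triple_tens:
  assumes M: "vertex_superalgebra M" "vsa_module M Y" and F: "vertex_superalgebra F" "vsa_module F Z"
    and uv: "u \<in> part M False" "v \<in> part M False" and fg: "f \<in> part F p" "g \<in> part F q"
  shows "module_triple (tensor_action Y Z) (tensor_action (prd M) (prd F)) (koszul p q)
    (u \<otimes> f) (v \<otimes> g) (w \<otimes> h)"
proof -
  note Y = vsa_module_field_action[OF M(2)] and Z = vsa_module_field_action[OF F(2)]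
    and P = vertex_superalgebra_field_action[OF M(1)] and Q = vertex_superalgebra_field_action[OF F(1)]
  define X1 where "X1 m k = Y u m (Y v k w)" for m k
  define X2 where "X2 m k = Y v k (Y u m w)" for m k
  define X3 where "X3 n k = Y (prd M u n v) k w" for n k
  define Y1 where "Y1 m k = Z f m (Z g k h)" for m k
  define Y2 where "Y2 m k = Z g k (Z f m h)" for m k
  define Y3 where "Y3 n k = Z (prd F f n g) k h" for n k
  have XT: "borcherds_triple X1 X2 X3"
    using vsa_module_triple[OF M uv, of w]
    by (simp add: module_triple_def koszul_def X1_def[abs_def] X2_def[abs_def] X3_def[abs_def])
  have YT: "borcherds_triple Y1 (\<lambda>m k. koszul p q *\<^sub>C Y2 m k) Y3"
    using vsa_module_triple[OF F fg, of h]
    by (simp add: module_triple_def Y1_def[abs_def] Y2_def[abs_def] Y3_def[abs_def])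
  have b1: "boxed X1 Y1"
    unfolding X1_def Y1_def by (intro boxed_trunc2 field_action_trunc2 Y Z)
  have b2: "boxed X2 Y2"
    using boxed_transposed[OF field_action_trunc2(2)[OF Y, of 1 v u w] field_action_trunc2(2)[OF Z, of 1 g f h]]
    by (simp add: X2_def[abs_def] Y2_def[abs_def])
  have b3: "boxed X3 Y3"
    using boxed_transposed[OF field_action_trunc2(3)[OF Y P, of u v w] field_action_trunc2(3)[OF Z Q, of f g h]]
    by (simp add: X3_def[abs_def] Y3_def[abs_def])
  note lin = clinear_tensor_action[OF Y Z] and linl = clinear_tensor_action_left[OF Y Z]
  have "tensor_action Y Z (u \<otimes> f) m (tensor_action Y Z (v \<otimes> g) k (w \<otimes> h)) = conv X1 Y1 m k" for m k
    unfolding tensor_action_tens[OF Y Z, of v g] clinear_Sum_any[OF lin finite_tensor_terms[OF Y Z]]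
      tensor_action_tens[OF Y Z] conv_iterated(2)[OF b1]
    by (simp add: X1_def Y1_def algebra_simps)
  moreover have "tensor_action Y Z (v \<otimes> g) k (tensor_action Y Z (u \<otimes> f) m (w \<otimes> h)) = conv X2 Y2 m k" for m k
    unfolding tensor_action_tens[OF Y Z, of u f] clinear_Sum_any[OF lin finite_tensor_terms[OF Y Z]]
      tensor_action_tens[OF Y Z] conv_iterated(1)[OF b2]
    by (simp add: X2_def Y2_def algebra_simps)
  moreover have "tensor_action Y Z (tensor_action (prd M) (prd F) (u \<otimes> f) n (v \<otimes> g)) k (w \<otimes> h) = conv X3 Y3 n k" for n k
    unfolding tensor_action_tens[OF P Q] clinear_Sum_any[OF linl finite_tensor_terms[OF P Q]]
      tensor_action_tens[OF Y Z] conv_iterated(1)[OF b3]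
    by (simp add: X3_def Y3_def algebra_simps)
  moreover have "conv X2 (\<lambda>m k. koszul p q *\<^sub>C Y2 m k) = (\<lambda>m k. koszul p q *\<^sub>C conv X2 Y2 m k)"
    by (intro ext conv_scale_right[OF b2])
  ultimately show ?thesis
    using borcherds_triple_conv[OF XT YT] by (simp add: module_triple_def)
qed

lemma module_triple_add:
  assumes Y: "field_action Y" and P: "field_action P"
  shows "module_triple Y P e u v w \<Longrightarrow> module_triple Y P e u' v w \<Longrightarrow> module_triple Y P e (u + u') v w"
    and "module_triple Y P e u v w \<Longrightarrow> module_triple Y P e u v' w \<Longrightarrow> module_triple Y P e u (v + v') w"
    and "module_triple Y P e u v w \<Longrightarrow> module_triple Y P e u v w' \<Longrightarrow> module_triple Y P e u v (w + w')"
  unfolding module_triple_def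
  by (drule (1) borcherds_triple_add,
      simp add: clinear_add[OF field_action_linear[OF Y]] clinear_add[OF field_action_linear_left[OF Y]]
        clinear_add[OF field_action_linear[OF P]] clinear_add[OF field_action_linear_left[OF P]]
        cscale_add_right)+

theorem module_triple_tensor:
  assumes M: "vertex_superalgebra M" "part M True = {0}" "vsa_module M Y"
    and F: "vertex_superalgebra F" "vsa_module F Z"
    and s: "s \<in> part (tensor_vsa M F) p" and s': "s' \<in> part (tensor_vsa M F) q"
  shows "module_triple (tensor_action Y Z) (tensor_action (prd M) (prd F)) (koszul p q) s s' t"
proof -
  note Y = vsa_module_field_action[OF M(3)] and Z = vsa_module_field_action[OF F(2)]
    and P = vertex_superalgebra_field_action[OF M(1)] and Q = vertex_superalgebra_field_action[OF F(1)]
  note add = module_triple_add[OF field_action_tensor[OF Y Z] field_action_tensor[OF P Q]]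
  have even: "u \<in> part M False" for u
    using part_decomposition[OF M(1), of u] M(2) by auto
  have tens: "module_triple (tensor_action Y Z) (tensor_action (prd M) (prd F)) (koszul p q) (u \<otimes> f) (v \<otimes> g) t"
    if "f \<in> part F p" "g \<in> part F q" for u f v g
    by (induction t rule: tensor_induct)
       (intro module_triple_tens M F even that add(3); assumption)+
  have left: "module_triple (tensor_action Y Z) (tensor_action (prd M) (prd F)) (koszul p q) (u \<otimes> f) s' t"
    if f: "f \<in> part F p" for u f
    using s' unfolding tensor_vsa_def vsa.simps
  proof (induction rule: cvs.span_induct_alt)
    case base
    show ?case using tens[OF f, of 0 u 0] cvs.subspace_0[OF part_subspace[OF F(1)]] by simp
  next
    case (step c x y)
    then obtain v g where "x = v \<otimes> g" "g \<in> part F q" by blast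
    then show ?case
      using add(2)[OF tens[OF f, of g u "c *\<^sub>C v"] step(2)] by (simp add: tens_scale_left)
  qed
  show ?thesis
    using s unfolding tensor_vsa_def vsa.simps
  proof (induction rule: cvs.span_induct_alt)
    case base
    show ?case using left[of 0 0] cvs.subspace_0[OF part_subspace[OF F(1)]] by simp
  next
    case (step c x y)
    then obtain u f where "x = u \<otimes> f" "f \<in> part F p" by blast
    then show ?case
      using add(1)[OF left[of f "c *\<^sub>C u"] step(2)] by (simp add: tens_scale_left)
  qed
qed

section \<open>The Clifford vertex algebra\<close>

lemma cvs_double_zero: "x + x = 0 \<Longrightarrow> x = (0::'a::complex_vs)"
proof -
  assume "x + x = 0"
  then have "(1 / 2 :: complex) *\<^sub>C (x + x) = 0" by simp
  then have "(1 / 2 + 1 / 2 :: complex) *\<^sub>C x = 0" unfolding cscale_add_right cscale_add_left .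
  then show ?thesis by (simp add: cscale_one)
qed

lemma part_prd:
  "vertex_superalgebra V \<Longrightarrow> u \<in> part V p \<Longrightarrow> v \<in> part V q \<Longrightarrow> prd V u n v \<in> part V (p \<noteq> q)"
  unfolding vertex_superalgebra_def by blast

text \<open>Folding \<open>-1 - l\<close> onto \<open>l\<close> matches normally ordered sums, whose
  terms combine one creating and one annihilating mode.\<close>

lemma Sum_any_int_split:
  fixes f :: "int \<Rightarrow> 'a::ab_group_add"
  assumes "finite {p. f p \<noteq> 0}"
  shows "Sum_any f = Sum_any (\<lambda>l::nat. f (- 1 - int l) + f (int l))"
proof -
  have "finite (abs ` {p. f p \<noteq> 0})" using assms by simp
  then obtain b where b: "\<And>p. f p \<noteq> 0 \<Longrightarrow> \<bar>p\<bar> \<le> b"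
    by (metis (mono_tags, lifting) finite_has_maximal2 image_eqI mem_Collect_eq Max_ge)
  define B where "B = nat (b + 1)"
  have "sum f {- int n..<int n} = (\<Sum>l<n. f (- 1 - int l) + f (int l))" for n
  proof (induction n)
    case (Suc n)
    have "{- int (Suc n)..<int (Suc n)} = insert (- 1 - int n) (insert (int n) {- int n..<int n})"
      by auto
    then show ?case using Suc by simp
  qed simp
  moreover have "Sum_any f = sum f {- int B..<int B}"
    using b by (intro Sum_any_eq_sum) (force simp: B_def)+
  moreover have "Sum_any (\<lambda>l::nat. f (- 1 - int l) + f (int l)) = (\<Sum>l<B. f (- 1 - int l) + f (int l))"
  proof (rule Sum_any_eq_sum)
    fix l assume "l \<notin> {..<B}"
    then have "f (- 1 - int l) = 0" "f (int l) = 0"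
      using b[of "- 1 - int l"] b[of "int l"] by (cases "f (- 1 - int l) = 0"; cases "f (int l) = 0"; simp add: B_def)+
    then show "f (- 1 - int l) + f (int l) = 0" by simp
  qed simp
  ultimately show ?thesis by simp
qed

lemma subspace_eigenspace: "clinear T \<Longrightarrow> cvs.subspace (eigenspace T c)"
  by (rule cvs.subspaceI)
     (auto simp: eigenspace_def clinear_zero clinear_add clinear_scale cscale_add_right mult.commute)

lemma gbinomial_negative:
  "(-1) ^ l * ((- of_nat (Suc j)) gchoose l :: complex) = of_nat (j + l choose l)"
  using gbinomial_minus[of "of_nat (Suc j) :: complex" l]
  by (simp add: power_mult_distrib[symmetric] mult.assoc[symmetric] binomial_gbinomial)

text \<open>The fermionic normal ordering \<open>:X_p Y_q:\<close>, in which modes of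
  \<open>X\<close> with \<open>p \<ge> 0\<close> count as annihilators.\<close>

definition normal_product ::
  "(int \<Rightarrow> 'a::complex_vs \<Rightarrow> 'a) \<Rightarrow> (int \<Rightarrow> 'a \<Rightarrow> 'a) \<Rightarrow> int \<Rightarrow> int \<Rightarrow> 'a \<Rightarrow> 'a" where
  "normal_product X Y p q w = (if p < 0 then X p (Y q w) else - Y q (X p w))"

context
  fixes F :: "'f::complex_vs vsa" and x y :: 'f
  assumes F: "clifford_vertex_algebra F x y"
begin

lemma clifford_vsa: "vertex_superalgebra F"
  and clifford_odd: "x \<in> part F True" "y \<in> part F True"
  and clifford_xy: "prd F x m (prd F y n v) + prd F y n (prd F x m v) = (if m + n + 1 = 0 then v else 0)"
  and clifford_xx: "prd F x m (prd F x n v) = - prd F x n (prd F x m v)"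
  and clifford_yy: "prd F y m (prd F y n v) = - prd F y n (prd F y m v)"
  using F by (auto simp: clifford_vertex_algebra_def eq_neg_iff_add_eq_0)

lemma clifford_field_action: "field_action (prd F)"
  and clifford_vac: "vac F \<in> part F False" "prd F v (- 1) (vac F) = v" "n \<ge> 0 \<Longrightarrow> prd F v n (vac F) = 0"
  and clifford_vac_modes: "prd F (vac F) n v = (if n = - 1 then v else 0)"
  and clifford_module: "vsa_module F (prd F)"
  using clifford_vsa vertex_superalgebra_field_action[OF clifford_vsa]
  by (auto simp: vertex_superalgebra_def vsa_module_def)

lemmas clifford_linear = field_action_linear[OF clifford_field_action]

lemma clifford_square: "prd F x m (prd F x m v) = 0" "prd F y m (prd F y m v) = 0"
  using clifford_xx[of m m v] clifford_yy[of m m v] cvs_double_zero by (metis add.right_inverse)+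

lemma clifford_yx: "prd F y n (prd F x m v) = (if m + n + 1 = 0 then v else 0) - prd F x m (prd F y n v)"
  unfolding clifford_xy[of m n v, symmetric] by simp

lemma clifford_triple:
  "u \<in> part F p \<Longrightarrow> v \<in> part F q \<Longrightarrow> module_triple (prd F) (prd F) (koszul p q) u v w"
  by (rule vsa_module_triple[OF clifford_vsa clifford_module])

lemma clifford_vac_nonzero: "vac F \<noteq> 0"
proof
  assume "vac F = 0"
  then have "v = 0" for v :: 'f
    using clifford_vac(2)[of v] field_action_zero(1)[OF clifford_field_action] by simp
  then show False using F by (auto simp: clifford_vertex_algebra_def)
qed

text \<open>The vectors all of whose modes preserve \<open>S\<close> are closed under products and
  contain the generators, hence are all of \<open>F\<close>; applying the mode \<open>-1\<close> of
  each to the vacuum gives the vector itself.\<close>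

lemma clifford_stable_UNIV:
  assumes S: "cvs.subspace S" "vac F \<in> S"
    and x: "\<And>n w. w \<in> S \<Longrightarrow> prd F x n w \<in> S" and y: "\<And>n w. w \<in> S \<Longrightarrow> prd F y n w \<in> S"
  shows "S = UNIV"
proof -
  define K where "K = {u. \<forall>n. \<forall>s\<in>S. prd F u n s \<in> S}"
  have "generated_subalgebra F {x, y} \<subseteq> K"
  proof (rule generated_subalgebra_subset[OF clifford_vsa])
    show "cvs.subspace K"
      by (rule cvs.subspaceI)
         (auto simp: K_def field_action_zero(2)[OF clifford_field_action] cvs.subspace_0[OF S(1)]
           clinear_add[OF field_action_linear_left[OF clifford_field_action]] cvs.subspace_add[OF S(1)]
           clinear_scale[OF field_action_linear_left[OF clifford_field_action]] cvs.subspace_scale[OF S(1)])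
    show "vac F \<in> K" using cvs.subspace_0[OF S(1)] by (auto simp: K_def clifford_vac_modes)
    show "{x, y} \<subseteq> K" using x y by (auto simp: K_def)
    show "\<exists>p. z \<in> part F p" if "z \<in> {x, y}" for z using that clifford_odd by auto
    fix u v p q n
    assume "u \<in> K" "v \<in> K" "u \<in> part F p" "v \<in> part F q"
    then show "prd F u n v \<in> K"
      unfolding K_def using module_triple_closed[OF clifford_field_action S(1) clifford_triple]
      by blast
  qed
  then have "K = UNIV" using F by (auto simp: clifford_vertex_algebra_def)
  then have "prd F u (- 1) (vac F) \<in> S" for u using S(2) by (auto simp: K_def)
  then show ?thesis by (auto simp: clifford_vac(2))
qed

abbreviation (input) "gam \<equiv> clifford_gamma F x y"

lemma clifford_gamma_even: "gam \<in> part F False"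
  using part_prd[OF clifford_vsa clifford_odd] by (simp add: clifford_gamma_def)

lemma clifford_gamma_modes:
  "prd F gam k w = Sum_any (\<lambda>j::nat. prd F x (- 1 - int j) (prd F y (k + int j) w)
     - prd F y (k - 1 - int j) (prd F x (int j) w))"
  unfolding clifford_gamma_def
  by (simp add: module_triple_normal_ordered[OF clifford_field_action clifford_triple[OF clifford_odd]]
      koszul_def)

lemma clifford_generators:
  assumes "l \<ge> 0"
  shows "prd F x l x = 0" "prd F y l y = 0"
    "prd F x l y = (if l = 0 then vac F else 0)" "prd F y l x = (if l = 0 then vac F else 0)"
proof -
  note z = field_action_zero(1)[OF clifford_field_action]
  show "prd F x l x = 0" "prd F y l y = 0"
    using clifford_xx[of l "- 1" "vac F"] clifford_yy[of l "- 1" "vac F"] assms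
    by (simp_all add: clifford_vac z)
  show "prd F x l y = (if l = 0 then vac F else 0)"
    using clifford_xy[of l "- 1" "vac F"] assms by (simp add: clifford_vac z)
  show "prd F y l x = (if l = 0 then vac F else 0)"
    using clifford_xy[of "- 1" l "vac F"] assms by (simp add: clifford_vac z)
qed

text \<open>Only a simple pole occurs, so the commutators of \<open>gamma\<close> with the
  generators have a single term.\<close>

lemma clifford_gamma_generators:
  assumes "l \<ge> 0"
  shows "prd F gam l x = (if l = 0 then x else 0)" "prd F gam l y = (if l = 0 then - y else 0)"
proof -
  note z = field_action_zero(1)[OF clifford_field_action]
  show "prd F gam l x = (if l = 0 then x else 0)"
    unfolding clifford_gamma_modes
    using assms by (subst Sum_any_single[of 0]) (auto simp: clifford_generators clifford_vac z)
  show "prd F gam l y = (if l = 0 then - y else 0)"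
    unfolding clifford_gamma_modes
    using assms by (subst Sum_any_single[of 0]) (auto simp: clifford_generators clifford_vac z)
qed

lemma clifford_gamma_commutator:
  shows "prd F gam m (prd F x k w) = prd F x k (prd F gam m w) + prd F x (m + k) w"
    and "prd F gam m (prd F y k w) = prd F y k (prd F gam m w) - prd F y (m + k) w"
proof -
  note z = field_action_zero(2)[OF clifford_field_action]
  have "prd F gam m (prd F x k w) - prd F x k (prd F gam m w) = prd F x (m + k) w"
    using module_triple_commutator[OF clifford_triple[OF clifford_gamma_even clifford_odd(1)], of m k w]
    by (subst (asm) Sum_any_single[of 0])
       (simp_all add: clifford_gamma_generators z koszul_def cscale_one)
  then show "prd F gam m (prd F x k w) = prd F x k (prd F gam m w) + prd F x (m + k) w"
    by (simp add: algebra_simps)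
  have "prd F gam m (prd F y k w) - prd F y k (prd F gam m w) = - prd F y (m + k) w"
    using module_triple_commutator[OF clifford_triple[OF clifford_gamma_even clifford_odd(2)], of m k w]
    by (subst (asm) Sum_any_single[of 0])
       (simp_all add: clifford_gamma_generators z koszul_def cscale_one
        clinear_minus[OF field_action_linear_left[OF clifford_field_action]])
  then show "prd F gam m (prd F y k w) = prd F y k (prd F gam m w) - prd F y (m + k) w"
    by (simp add: algebra_simps)
qed

section \<open>The charge grading of the Fock space\<close>

lemma clifford_charge_shift:
  assumes "f \<in> eigenspace (prd F gam 0) c"
  shows "prd F x n f \<in> eigenspace (prd F gam 0) (c + 1)"
    and "prd F y n f \<in> eigenspace (prd F gam 0) (c - 1)"
  using assms
  by (simp_all add: eigenspace_def clifford_gamma_commutator clinear_scale[OF clifford_linear]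
      cscale_add_left cscale_one cvs.scale_left_diff_distrib)

abbreviation (input) "F_charge r \<equiv> eigenspace (prd F gam 0) (of_int (r::int))"

lemma clifford_charge_span: "cvs.span (\<Union>r. F_charge r) = UNIV"
proof (rule clifford_stable_UNIV)
  let ?E = "\<Union>r. F_charge r"
  show "cvs.subspace (cvs.span ?E)" by simp
  have "vac F \<in> F_charge 0"
    by (simp add: eigenspace_def clifford_vac)
  then show "vac F \<in> cvs.span ?E" by (blast intro: cvs.span_base)
  fix n w assume w: "w \<in> cvs.span ?E"
  show "prd F x n w \<in> cvs.span ?E"
  proof (rule clinear_span_mem[OF clifford_linear cvs.subspace_span _ w])
    fix w assume "w \<in> ?E"
    then obtain r where "w \<in> F_charge r" by blast
    then have "prd F x n w \<in> F_charge (r + 1)"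
      using clifford_charge_shift(1) by simp
    then show "prd F x n w \<in> cvs.span ?E" by (blast intro: cvs.span_base)
  qed
  show "prd F y n w \<in> cvs.span ?E"
  proof (rule clinear_span_mem[OF clifford_linear cvs.subspace_span _ w])
    fix w assume "w \<in> ?E"
    then obtain r where "w \<in> F_charge r" by blast
    then have "prd F y n w \<in> F_charge (r - 1)"
      using clifford_charge_shift(2) by simp
    then show "prd F y n w \<in> cvs.span ?E" by (blast intro: cvs.span_base)
  qed
qed

text \<open>Some mode \<open>N\<close> of \<open>y\<close> kills \<open>f\<close>; the Clifford
  relation then gives \<open>y_N x_(-N-1) f = f\<close>, so \<open>x_(-N-1) f\<close> is nonzero of
  charge one higher. Exchanging the roles of \<open>x\<close> and \<open>y\<close> lowers the
  charge.\<close>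

lemma clifford_charge_nonzero: "\<exists>f \<in> F_charge r. f \<noteq> 0"
proof (induction r rule: int_induct[of _ 0])
  case base
  show ?case using clifford_vac_nonzero by (intro bexI[of _ "vac F"]) (auto simp: eigenspace_def clifford_vac)
next
  case (step1 r)
  then obtain f where f: "f \<in> F_charge r" "f \<noteq> 0" by blast
  obtain N where "prd F y N f = 0" using field_action_bounded[OF clifford_field_action] by blast
  then have "prd F x (- N - 1) f \<noteq> 0"
    using clifford_xy[of "- N - 1" N f] f(2) by (auto simp: field_action_zero(1)[OF clifford_field_action])
  then show ?case using clifford_charge_shift(1)[OF f(1), of "- N - 1"] by auto
next
  case (step2 r)
  then obtain f where f: "f \<in> F_charge r" "f \<noteq> 0" by blast
  obtain N where "prd F x N f = 0" using field_action_bounded[OF clifford_field_action] by blast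
  then have "prd F y (- N - 1) f \<noteq> 0"
    using clifford_xy[of N "- N - 1" f] f(2) by (auto simp: field_action_zero(1)[OF clifford_field_action])
  then show ?case using clifford_charge_shift(2)[OF f(1), of "- N - 1"] by auto
qed

section \<open>Quadratic vectors and their modes\<close>

abbreviation (input) "ymode j \<equiv> prd F y (- int j - 1) (vac F)"

definition clifford_pair :: "nat \<Rightarrow> 'f" where
  "clifford_pair j = prd F x (- 1) (ymode j)"

lemma ymode_odd: "ymode j \<in> part F True"
  using part_prd[OF clifford_vsa clifford_odd(2) clifford_vac(1)] by simp

lemma clifford_pair_even: "clifford_pair j \<in> part F False"
  using part_prd[OF clifford_vsa clifford_odd(1) ymode_odd] by (simp add: clifford_pair_def)

text \<open>\<open>ymode j\<close> is the \<open>j\<close>-th divided derivative of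
  \<open>y\<close>. Since the vacuum has only the mode \<open>-1\<close>, at most one term of the
  iterate formula survives: in the first half for \<open>k < 0\<close>, in the second for
  \<open>k \<ge> j\<close>, and none in between, where the binomial coefficient is zero as
  well.\<close>

lemma ymode_modes: "prd F (ymode j) k w = ((-1) ^ j * (of_int k gchoose j)) *\<^sub>C prd F y (k - int j) w"
proof -
  note z = field_action_zero(1)[OF clifford_field_action]
  have "module_triple (prd F) (prd F) 1 y (vac F) w"
    using clifford_triple[OF clifford_odd(2) clifford_vac(1), of w] by (simp add: koszul_def)
  note it = module_triple_iterate[OF clifford_field_action this, of "- int j - 1" k]
  have shift: "of_int (- int j - 1) = (- of_nat (Suc j) :: complex)" by simp
  show ?thesis
  proof (cases "k < 0")
    case True
    define l where "l = nat (- 1 - k)"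
    have l: "k = - 1 - int l" using True by (simp add: l_def)
    have "prd F (ymode j) k w = ((-1) ^ l * (of_int (- int j - 1) gchoose l)) *\<^sub>C prd F y (- int j - 1 - int l) w"
      unfolding it unfolding l by (subst Sum_any_single[of l]) (auto simp: clifford_vac_modes z)
    also have "(-1) ^ l * (of_int (- int j - 1) gchoose l :: complex) = of_nat (j + l choose l)"
      using gbinomial_negative[of l j] by (simp only: shift)
    also have "of_nat (j + l choose l) = (-1) ^ j * (of_int k gchoose j :: complex)"
      using gbinomial_negative[of j l] binomial_symmetric[of l "j + l"] by (simp add: l algebra_simps)
    finally have "prd F (ymode j) k w = ((-1) ^ j * (of_int k gchoose j)) *\<^sub>C prd F y (- int j - 1 - int l) w" .
    moreover have "- int j - 1 - int l = k - int j" using l by simp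
    ultimately show ?thesis by simp
  next
    case nonneg: False
    show ?thesis
    proof (cases "k < int j")
      case True
      have "prd F (ymode j) k w = 0"
        unfolding it using True nonneg by (subst Sum_any_single[of 0]) (auto simp: clifford_vac_modes z)
      moreover have "(of_int k gchoose j :: complex) = 0"
        using True nonneg by (metis binomial_eq_0 binomial_gbinomial nat_less_iff not_le of_int_of_nat_eq of_nat_0 int_nat_eq nat_0_le leI)
      ultimately show ?thesis by simp
    next
      case False
      define l where "l = nat (k - int j)"
      have l: "k = int (j + l)" using False by (simp add: l_def)
      have "prd F (ymode j) k w = (- ((-1) ^ l * (of_int (- int j - 1) gchoose l) * (-1) powi (- int j - 1))) *\<^sub>C prd F y (int l) w"
        unfolding it unfolding l by (subst Sum_any_single[of l]) (auto simp: clifford_vac_modes z)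
      also have "(-1) ^ l * (of_int (- int j - 1) gchoose l :: complex) = of_nat (j + l choose l)"
        using gbinomial_negative[of l j] by (simp only: shift)
      also have "(-1::complex) powi (- int j - 1) = - ((-1) ^ j)"
        by (simp add: power_int_diff power_int_minus power_inverse[symmetric])
      also have "of_nat (j + l choose l) = (of_int k gchoose j :: complex)"
        using binomial_symmetric[of l "j + l"] by (simp add: l binomial_gbinomial)
      finally show ?thesis by (simp add: l mult.commute)
    qed
  qed
qed

lemma clifford_pair_0: "clifford_pair 0 = gam"
  by (simp add: clifford_pair_def clifford_gamma_def clifford_vac)

text \<open>With \<open>u = psi(-3/2) psi*(-j-1/2) 1\<close>, translation gives
  \<open>(j + 1)\<close> times the next pair plus \<open>u\<close>, while the mode \<open>-1\<close>
  of \<open>gamma\<close> gives \<open>u\<close> minus the next pair, its remaining term vanishing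
  because \<open>psi(-1/2)\<close> squares to zero. The difference eliminates
  \<open>u\<close>.\<close>

lemma clifford_pair_rec:
  "of_nat (j + 2) *\<^sub>C clifford_pair (Suc j) =
    prd F (clifford_pair j) (- 2) (vac F) - prd F gam (- 1) (clifford_pair j)"
proof -
  note z = field_action_zero(1)[OF clifford_field_action]
  define u where "u = prd F x (- 2) (ymode j)"
  have "prd F gam (- 1) (clifford_pair j) = prd F x (- 1) (prd F y (- int j - 1) (prd F x (- 1) y))
      - clifford_pair (Suc j) + u"
    by (simp add: clifford_pair_def clifford_gamma_commutator clifford_vac u_def
        clinear_diff[OF clifford_linear] algebra_simps)
       (simp add: clifford_gamma_def)
  also have "prd F x (- 1) (prd F y (- int j - 1) (prd F x (- 1) y)) = 0"
    by (simp add: clifford_yx[of _ "- 1"] clinear_minus[OF clifford_linear] clifford_square)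
  finally have 1: "prd F gam (- 1) (clifford_pair j) = u - clifford_pair (Suc j)" by simp
  have y1: "prd F (ymode j) (- 1) (vac F) = ymode j" by (rule clifford_vac(2))
  have y2: "prd F (ymode j) (- 2) (vac F) = of_nat (j + 1) *\<^sub>C ymode (Suc j)"
  proof -
    have "(-1) ^ j * ((- 2) gchoose j :: complex) = of_nat (j + 1)"
      using gbinomial_negative[of j 1] by (simp add: binomial_symmetric[of 1 "Suc j"])
    moreover have "- 2 - int j = - int (Suc j) - 1" by simp
    ultimately show ?thesis by (simp only: ymode_modes of_int_numeral of_int_minus)
  qed
  have "module_triple (prd F) (prd F) (- 1) x (ymode j) (vac F)"
    using clifford_triple[OF clifford_odd(1) ymode_odd] by (simp add: koszul_def)
  note it = module_triple_normal_ordered[OF clifford_field_action this, of "- 2"]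
  have "prd F (clifford_pair j) (- 2) (vac F) =
     Sum_any (\<lambda>l::nat. prd F x (- 1 - int l) (prd F (ymode j) (- 2 + int l) (vac F)))"
    unfolding clifford_pair_def it by (simp add: clifford_vac z)
  also have "\<dots> = (\<Sum>l\<in>{0, 1::nat}. prd F x (- 1 - int l) (prd F (ymode j) (- 2 + int l) (vac F)))"
    by (rule Sum_any_eq_sum) (auto simp: clifford_vac z)
  also have "\<dots> = of_nat (j + 1) *\<^sub>C clifford_pair (Suc j) + u"
    by (simp add: y1 y2 clinear_scale[OF clifford_linear] clifford_pair_def u_def)
  finally show ?thesis
    unfolding 1 by (simp add: cscale_add_left cscale_one algebra_simps)
       (metis cscale_add_left cscale_one one_add_one)
qed

lemma clifford_pair_generated:
  assumes K: "cvs.subspace K" "vac F \<in> K" "gam \<in> K"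
    and prd: "\<And>u v n. u \<in> K \<Longrightarrow> v \<in> K \<Longrightarrow> u \<in> part F False \<Longrightarrow> v \<in> part F False \<Longrightarrow> prd F u n v \<in> K"
  shows "clifford_pair j \<in> K"
proof (induction j)
  case 0 show ?case by (simp add: clifford_pair_0 K)
next
  case (Suc j)
  have "of_nat (j + 2) *\<^sub>C clifford_pair (Suc j) \<in> K"
    unfolding clifford_pair_rec
    by (intro cvs.subspace_diff[OF K(1)] prd Suc K clifford_pair_even clifford_vac clifford_gamma_even)
  then have "(1 / of_nat (j + 2)) *\<^sub>C of_nat (j + 2) *\<^sub>C clifford_pair (Suc j) \<in> K"
    by (rule cvs.subspace_scale[OF K(1)])
  moreover have "(of_nat (j + 2) :: complex) \<noteq> 0" by (metis add_2_eq_Suc' nat.distinct(1) of_nat_eq_0_iff)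
  ultimately show ?case by (simp only: cscale_cscale) (simp add: cscale_one)
qed

abbreviation (input) "npair \<equiv> normal_product (prd F x) (prd F y)"

lemma finite_normal_product: "finite {p. npair p (d - p) w \<noteq> 0}"
proof -
  obtain N1 N2 where N: "\<And>n. n \<ge> N1 \<Longrightarrow> prd F x n w = 0" "\<And>n. n \<ge> N2 \<Longrightarrow> prd F y n w = 0"
    using field_action_bounded[OF clifford_field_action] by metis
  have z: "npair p (d - p) w = 0" if "p < min 0 (d - N2) \<or> p > max 0 N1" for p
    using that by (auto simp: normal_product_def N field_action_zero(1)[OF clifford_field_action])
  show ?thesis
    using z by (intro finite_int_bounded[of _ "min 0 (d - N2)" "max 0 N1"]) (meson not_le)+
qed

text \<open>The mode number is shifted by \<open>j\<close> so that every pair involves the same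
  products \<open>npair p (d - p)\<close>. Only the weight depends on \<open>j\<close>, as a
  polynomial of degree \<open>j\<close> in \<open>p\<close>.\<close>

lemma clifford_pair_modes:
  "prd F (clifford_pair j) (d + 1 + int j) w =
     (-1) ^ j *\<^sub>C Sum_any (\<lambda>p. (of_int (d - p) + of_nat j gchoose j) *\<^sub>C npair p (d - p) w)"
proof -
  define f where "f p = (of_int (d - p) + of_nat j gchoose j) *\<^sub>C npair p (d - p) w" for p
  have fin: "finite {p. f p \<noteq> 0}"
    unfolding f_def by (rule finite_scaled[OF finite_normal_product])
  have fin': "finite {l::nat. f (- 1 - int l) + f (int l) \<noteq> 0}"
  proof -
    have "finite {l::nat. f (- 1 - int l) \<noteq> 0}" "finite {l::nat. f (int l) \<noteq> 0}"
      using finite_vimageI[OF fin, of "\<lambda>l::nat. - 1 - int l"] finite_vimageI[OF fin, of int]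
      by (simp_all add: vimage_def inj_def)
    from finite_UnI[OF this] show ?thesis by (rule rev_finite_subset) auto
  qed
  have "module_triple (prd F) (prd F) (- 1) x (ymode j) w"
    using clifford_triple[OF clifford_odd(1) ymode_odd] by (simp add: koszul_def)
  note it = module_triple_normal_ordered[OF clifford_field_action this, of "d + 1 + int j"]
  have "prd F (clifford_pair j) (d + 1 + int j) w =
      Sum_any (\<lambda>l::nat. (-1) ^ j *\<^sub>C (f (- 1 - int l) + f (int l)))"
    unfolding clifford_pair_def it
    by (rule Sum_any.cong)
       (simp add: f_def normal_product_def ymode_modes clinear_scale[OF clifford_linear]
          cvs.scale_right_distrib cvs.scale_right_diff_distrib algebra_simps)
  also have "\<dots> = (-1) ^ j *\<^sub>C Sum_any f"
    unfolding Sum_any_int_split[OF fin] by (rule Sum_any_scale[OF fin'])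
  finally show ?thesis by (simp add: f_def)
qed

end

section \<open>The Weyl vertex algebra\<close>

context
  fixes M :: "'m::complex_vs vsa" and a b :: 'm
  assumes M: "weyl_vertex_algebra M a b"
begin

lemma weyl_vsa: "vertex_superalgebra M"
  and weyl_part: "part M True = {0}"
  and weyl_simple: "simple_weyl_module (\<lambda>n. prd M a n) (\<lambda>n. prd M b (n - 1))"
  and weyl_cyclic: "\<And>W. weyl_submodule (\<lambda>n. prd M a n) (\<lambda>n. prd M b (n - 1)) W \<Longrightarrow> vac M \<in> W \<Longrightarrow> W = UNIV"
  using M by (simp_all add: weyl_vertex_algebra_def Let_def)

lemma weyl_even: "u \<in> part M False"
  using part_decomposition[OF weyl_vsa, of u] weyl_part by auto

lemma weyl_field_action: "field_action (prd M)"
  and weyl_vac: "prd M v (- 1) (vac M) = v" "n \<ge> 0 \<Longrightarrow> prd M v n (vac M) = 0"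
  and weyl_vac_modes: "prd M (vac M) n v = (if n = - 1 then v else 0)"
  and weyl_module: "vsa_module M (prd M)"
  using weyl_vsa vertex_superalgebra_field_action[OF weyl_vsa]
  by (auto simp: vertex_superalgebra_def vsa_module_def)

lemma weyl_relations:
  "prd M a n (prd M b m v) = prd M b m (prd M a n v) + (if n + m + 1 = 0 then v else 0)"
  "prd M a n (prd M a m v) = prd M a m (prd M a n v)"
  "prd M b n (prd M b m v) = prd M b m (prd M b n v)"
proof -
  have ab: "\<forall>n m v. prd M a n (prd M b (m - 1) v) - prd M b (m - 1) (prd M a n v) = (if n + m = 0 then v else 0)"
    and aa: "\<forall>n m v. prd M a n (prd M a m v) = prd M a m (prd M a n v)"
    and bb: "\<forall>n m v. prd M b (n - 1) (prd M b (m - 1) v) = prd M b (m - 1) (prd M b (n - 1) v)"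
    using weyl_simple by (simp_all add: simple_weyl_module_def weyl_module_def)
  have "prd M a n (prd M b m v) - prd M b m (prd M a n v) = (if n + m + 1 = 0 then v else 0)"
    using ab[rule_format, of n "m + 1" v] by (simp add: add.assoc)
  then show "prd M a n (prd M b m v) = prd M b m (prd M a n v) + (if n + m + 1 = 0 then v else 0)"
    by (simp only: diff_eq_eq add.commute)
  show "prd M a n (prd M a m v) = prd M a m (prd M a n v)" using aa by blast
  show "prd M b n (prd M b m v) = prd M b m (prd M b n v)"
    using bb[rule_format, of "n + 1" "m + 1" v] by simp
qed

lemma weyl_triple: "vsa_module M Y \<Longrightarrow> module_triple Y (prd M) 1 u v w"
  using vsa_module_triple[OF weyl_vsa _ weyl_even weyl_even] by (metis koszul_def)

lemma weyl_generators:
  assumes "l \<ge> 0"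
  shows "prd M a l a = 0" "prd M b l b = 0"
    "prd M a l b = (if l = 0 then vac M else 0)" "prd M b l a = (if l = 0 then - vac M else 0)"
proof -
  note z = field_action_zero(1)[OF weyl_field_action]
  show "prd M a l a = 0" "prd M b l b = 0"
    using weyl_relations(2)[of l "- 1" "vac M"] weyl_relations(3)[of l "- 1" "vac M"] assms
    by (simp_all add: weyl_vac z)
  show "prd M a l b = (if l = 0 then vac M else 0)"
    using weyl_relations(1)[of l "- 1" "vac M"] assms by (simp add: weyl_vac z)
  have "prd M b l a + (if l = 0 then vac M else 0) = 0"
    using weyl_relations(1)[of "- 1" l "vac M"] assms by (simp add: weyl_vac z)
  then show "prd M b l a = (if l = 0 then - vac M else 0)"
    by (auto simp: eq_neg_iff_add_eq_0 split: if_splits)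
qed

abbreviation (input) "bet \<equiv> weyl_beta M a b"

lemma weyl_beta_generators:
  shows "prd M bet 0 a = - a" "prd M bet 0 b = b"
proof -
  note z = field_action_zero(1)[OF weyl_field_action]
  note modes = module_triple_normal_ordered[OF weyl_field_action weyl_triple[OF weyl_module], of a b 0]
  show "prd M bet 0 a = - a"
    unfolding weyl_beta_def modes
    by (subst Sum_any_single[of 0])
       (auto simp: weyl_generators z cscale_one weyl_vac clinear_minus[OF field_action_linear[OF weyl_field_action]])
  show "prd M bet 0 b = b"
    unfolding weyl_beta_def modes
    by (subst Sum_any_single[of 0]) (auto simp: weyl_generators z cscale_one weyl_vac)
qed

context
  fixes Y :: "'m \<Rightarrow> int \<Rightarrow> 'n::complex_vs \<Rightarrow> 'n"
  assumes Y: "vsa_module M Y"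
begin

lemma weyl_module_field_action: "field_action Y"
  and weyl_module_vac: "Y (vac M) n w = (if n = - 1 then w else 0)"
  using Y vsa_module_field_action[OF Y] by (auto simp: vsa_module_def)

text \<open>The Weyl relations are given on the vertex algebra itself. The commutator formula
  carries them to every module, because it depends only on the singular products of the
  generators.\<close>

lemma weyl_module_relations:
  "Y a n (Y b m w) = Y b m (Y a n w) + (if n + m + 1 = 0 then w else 0)"
  "Y a n (Y a m w) = Y a m (Y a n w)"
  "Y b n (Y b m w) = Y b m (Y b n w)"
proof -
  note z = field_action_zero(2)[OF weyl_module_field_action]
  have "Y a n (Y b m w) - Y b m (Y a n w) = (if n + m + 1 = 0 then w else 0)"
    using module_triple_commutator[OF weyl_triple[OF Y], of a n b m w]
    by (subst (asm) Sum_any_single[of 0])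
       (auto simp: weyl_generators weyl_module_vac z cscale_one)
  then show "Y a n (Y b m w) = Y b m (Y a n w) + (if n + m + 1 = 0 then w else 0)"
    by (simp only: diff_eq_eq add.commute)
  show "Y a n (Y a m w) = Y a m (Y a n w)" "Y b n (Y b m w) = Y b m (Y b n w)"
    using module_triple_commutator[OF weyl_triple[OF Y], of a n a m w]
      module_triple_commutator[OF weyl_triple[OF Y], of b n b m w]
    by (simp_all add: weyl_generators z cscale_one)
qed

lemma weyl_charge_commutator:
  "Y bet 0 (Y a n w) = Y a n (Y bet 0 w) - Y a n w"
  "Y bet 0 (Y b n w) = Y b n (Y bet 0 w) + Y b n w"
proof -
  have zero: "(\<Sum>j::nat. ((of_int 0 :: complex) gchoose j) *\<^sub>C f j) = f 0" for f :: "nat \<Rightarrow> 'n"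
    by (subst Sum_any_single[of 0]) (auto simp: gchoose_zero_left cscale_one)
  have "Y bet 0 (Y a n w) - Y a n (Y bet 0 w) = - Y a n w"
    using module_triple_commutator[OF weyl_triple[OF Y], of bet 0 a n w] unfolding zero
    by (simp add: weyl_beta_generators cscale_one
        clinear_minus[OF field_action_linear_left[OF weyl_module_field_action]])
  then show "Y bet 0 (Y a n w) = Y a n (Y bet 0 w) - Y a n w"
    by (simp add: diff_eq_eq)
  have "Y bet 0 (Y b n w) - Y b n (Y bet 0 w) = Y b n w"
    using module_triple_commutator[OF weyl_triple[OF Y], of bet 0 b n w] unfolding zero
    by (simp add: weyl_beta_generators cscale_one)
  then show "Y bet 0 (Y b n w) = Y b n (Y bet 0 w) + Y b n w"
    by (simp add: diff_eq_eq add.commute)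
qed

text \<open>The vectors of \<open>M\<close> whose modes preserve \<open>S\<close> form a Weyl
  submodule containing the vacuum, hence all of \<open>M\<close>. Irreducibility over the vertex
  algebra thus becomes irreducibility under the operators \<open>a(n)\<close>,
  \<open>a*(n)\<close>.\<close>

lemma weyl_stable_submodule:
  assumes S: "cvs.subspace S"
    and a: "\<And>n w. w \<in> S \<Longrightarrow> Y a n w \<in> S" and b: "\<And>n w. w \<in> S \<Longrightarrow> Y b n w \<in> S"
  shows "vsa_submodule Y S"
proof -
  define K where "K = {u. \<forall>n. \<forall>s\<in>S. Y u n s \<in> S}"
  note lin = field_action_linear_left[OF weyl_module_field_action]
  have closed: "prd M u n v \<in> K" if "u \<in> K" "v \<in> K" for u v n
    using module_triple_closed[OF weyl_module_field_action S weyl_triple[OF Y]] that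
    unfolding K_def by blast
  have ab: "a \<in> K" "b \<in> K" using a b by (auto simp: K_def)
  have "K = UNIV"
  proof (rule weyl_cyclic)
    have "cvs.subspace K"
      by (rule cvs.subspaceI)
         (auto simp: K_def field_action_zero(2)[OF weyl_module_field_action] cvs.subspace_0[OF S]
           clinear_add[OF lin] cvs.subspace_add[OF S] clinear_scale[OF lin] cvs.subspace_scale[OF S])
    then show "weyl_submodule (\<lambda>n. prd M a n) (\<lambda>n. prd M b (n - 1)) K"
      using closed ab by (simp add: weyl_submodule_def)
    show "vac M \<in> K" using cvs.subspace_0[OF S] by (auto simp: K_def weyl_module_vac)
  qed
  then show ?thesis using S by (auto simp: vsa_submodule_def K_def)
qed

end

end

section \<open>Linear algebra of gradings\<close>

lemma eigenvectors_independent: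
  assumes T: "clinear T" and inj: "inj \<mu>" and S: "finite S"
    and f: "\<And>i. i \<in> S \<Longrightarrow> f i \<in> eigenspace T (\<mu> i)" and sum: "sum f S = 0"
  shows "i \<in> S \<Longrightarrow> f i = 0"
  using S f sum
proof (induction S arbitrary: f i rule: finite_induct)
  case (insert s S)
  have T_f: "T (f i) = \<mu> i *\<^sub>C f i" if "i \<in> insert s S" for i
    using insert.prems(2)[OF that] by (simp add: eigenspace_def)
  have total: "f s + sum f S = 0" using insert.prems(3) insert.hyps by simp
  have "0 = T (f s + sum f S) - \<mu> s *\<^sub>C (f s + sum f S)"
    by (simp add: total clinear_zero[OF T])
  also have "\<dots> = (\<Sum>i\<in>S. \<mu> i *\<^sub>C f i) - (\<Sum>i\<in>S. \<mu> s *\<^sub>C f i)"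
    by (simp add: clinear_add[OF T] clinear_sum[OF T] T_f cscale_add_right cvs.scale_sum_right)
  also have "\<dots> = (\<Sum>i\<in>S. (\<mu> i - \<mu> s) *\<^sub>C f i)"
    by (simp add: sum_subtractf cvs.scale_left_diff_distrib)
  finally have "(\<Sum>i\<in>S. (\<mu> i - \<mu> s) *\<^sub>C f i) = 0" by simp
  moreover have "(\<mu> i - \<mu> s) *\<^sub>C f i \<in> eigenspace T (\<mu> i)" if "i \<in> S" for i
    using T_f[of i] that by (simp add: eigenspace_def clinear_scale[OF T] mult.commute)
  ultimately have "(\<mu> i - \<mu> s) *\<^sub>C f i = 0" if "i \<in> S" for i
    using insert.IH[of i "\<lambda>i. (\<mu> i - \<mu> s) *\<^sub>C f i"] that by blast
  then have zero: "f i = 0" if "i \<in> S" for i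
    using that insert.hyps inj by (auto simp: inj_eq)
  then have "f s = 0" using total by simp
  then show ?case using insert.prems(1) zero by blast
qed simp

lemma span_Union_finite_sum:
  fixes E :: "'i \<Rightarrow> 'w::complex_vs set"
  assumes sub: "\<And>i. cvs.subspace (E i)" and v: "v \<in> cvs.span (\<Union>i. E i)"
  shows "\<exists>f. (\<forall>i. f i \<in> E i) \<and> finite {i. f i \<noteq> 0} \<and> v = Sum_any f"
  using v
proof (induction rule: cvs.span_induct_alt)
  case base
  show ?case by (intro exI[of _ "\<lambda>_. 0"]) (simp add: cvs.subspace_0[OF sub])
next
  case (step c x y)
  then obtain i0 f where x: "x \<in> E i0"
    and f: "\<And>i. f i \<in> E i" "finite {i. f i \<noteq> 0}" "y = Sum_any f" by blast
  define g where "g i = (if i = i0 then c *\<^sub>C x else 0)" for i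
  have g: "finite {i. g i \<noteq> 0}" by (rule finite_subset[of _ "{i0}"]) (auto simp: g_def)
  have "Sum_any g = c *\<^sub>C x" by (subst Sum_any_single[of i0]) (auto simp: g_def)
  then have "c *\<^sub>C x + y = Sum_any (\<lambda>i. g i + f i)"
    by (simp add: Sum_any.distrib[OF g f(2)] f(3))
  moreover have "g i + f i \<in> E i" for i
    using x f(1)[of i] cvs.subspace_add[OF sub] cvs.subspace_scale[OF sub]
    by (cases "i = i0") (simp_all add: g_def)
  moreover have "finite {i. g i + f i \<noteq> 0}"
    by (rule rev_finite_subset[OF finite_UnI[OF g f(2)]]) auto
  ultimately show ?case by (intro exI[of _ "\<lambda>i. g i + f i"]) simp
qed

lemma eigenspaces_direct_sum:
  assumes T: "clinear T" and inj: "inj \<mu>"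
    and span: "cvs.span (\<Union>i. eigenspace T (\<mu> i)) = UNIV"
  shows "internal_direct_sum UNIV (\<lambda>i. eigenspace T (\<mu> i))"
  unfolding internal_direct_sum_def
proof (intro conjI ballI allI ex_ex1I)
  show sub: "cvs.subspace (eigenspace T (\<mu> i))" for i by (rule subspace_eigenspace[OF T])
  fix v
  have "\<exists>f. (\<forall>i. f i \<in> eigenspace T (\<mu> i)) \<and> finite {i. f i \<noteq> 0} \<and> v = Sum_any f"
    by (rule span_Union_finite_sum[OF sub]) (simp add: span)
  then show "\<exists>f. (\<forall>i\<in>UNIV. f i \<in> eigenspace T (\<mu> i)) \<and> (\<forall>i. i \<notin> UNIV \<longrightarrow> f i = 0) \<and>
      finite {i. f i \<noteq> 0} \<and> v = (\<Sum>i | f i \<noteq> 0. f i)"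
    by (simp add: Sum_any.expand_set)
  fix f g
  assume f: "(\<forall>i\<in>UNIV. f i \<in> eigenspace T (\<mu> i)) \<and> (\<forall>i. i \<notin> UNIV \<longrightarrow> f i = 0) \<and>
      finite {i. f i \<noteq> 0} \<and> v = (\<Sum>i | f i \<noteq> 0. f i)"
    and g: "(\<forall>i\<in>UNIV. g i \<in> eigenspace T (\<mu> i)) \<and> (\<forall>i. i \<notin> UNIV \<longrightarrow> g i = 0) \<and>
      finite {i. g i \<noteq> 0} \<and> v = (\<Sum>i | g i \<noteq> 0. g i)"
  define S where "S = {i. f i \<noteq> 0} \<union> {i. g i \<noteq> 0}"
  have S: "finite S" using f g by (simp add: S_def)
  have "sum f S = (\<Sum>i | f i \<noteq> 0. f i)" "sum g S = (\<Sum>i | g i \<noteq> 0. g i)"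
    using S by (intro sum.mono_neutral_right; auto simp: S_def)+
  moreover have "v = (\<Sum>i | f i \<noteq> 0. f i)" "v = (\<Sum>i | g i \<noteq> 0. g i)" using f g by blast+
  ultimately have "sum f S = v" "sum g S = v" by (simp_all only:)
  then have zero: "(\<Sum>i\<in>S. f i - g i) = 0" by (simp add: sum_subtractf)
  have "f i - g i = 0" if "i \<in> S" for i
  proof (rule eigenvectors_independent[where f = "\<lambda>i. f i - g i", OF T inj S _ zero that])
    fix i
    have "f i \<in> eigenspace T (\<mu> i)" "g i \<in> eigenspace T (\<mu> i)" using f g by blast+
    then show "f i - g i \<in> eigenspace T (\<mu> i)" by (rule cvs.subspace_diff[OF sub])
  qed
  moreover have "f i = g i" if "i \<notin> S" for i using that by (simp add: S_def)
  ultimately show "f = g" by (metis eq_iff_diff_eq_0 ext)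
qed

text \<open>The weights whose weighted sum lies in \<open>U\<close> form a vector space containing
  all polynomials in \<open>p\<close>; one that vanishes on the rest of the finite support isolates
  \<open>h p0\<close>.\<close>

lemma interpolation:
  fixes h :: "int \<Rightarrow> 'w::complex_vs"
  assumes U: "cvs.subspace U" and fin: "finite {p. h p \<noteq> 0}"
    and mem: "\<And>j::nat. Sum_any (\<lambda>p. (of_int (d - p) + of_nat j gchoose j) *\<^sub>C h p) \<in> U"
  shows "h p0 \<in> U"
proof -
  define B where "B = {\<phi>. Sum_any (\<lambda>p. \<phi> p *\<^sub>C h p) \<in> U}"
  note fin' = finite_scaled[OF fin]
  have add: "(\<lambda>p. \<phi> p + \<psi> p) \<in> B" if "\<phi> \<in> B" "\<psi> \<in> B" for \<phi> \<psi>
    using that cvs.subspace_add[OF U]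
    by (simp add: B_def cscale_add_left Sum_any.distrib[OF fin' fin'])
  have scale: "(\<lambda>p. c * \<phi> p) \<in> B" if "\<phi> \<in> B" for c \<phi>
    using that cvs.subspace_scale[OF U]
    by (simp add: B_def cscale_cscale[symmetric] Sum_any_scale[OF fin'] del: cscale_cscale cvs.scale_scale)
  define q where "q p = (of_int (d - p) :: complex)" for p
  define c where "c j p = (q p + of_nat j gchoose j)" for j p
  \<comment> \<open>Since \<open>binom(q+j+1, j+1)\<close> equals \<open>(q+j+1)/(j+1)\<close> times
    \<open>binom(q+j, j)\<close>, multiplication by \<open>q\<close> stays within the span of the
    given weights.\<close>
  have q_c: "q p * c j p = of_nat (Suc j) * (c (Suc j) p + (- 1) * c j p)" for j p
    using gbinomial_factors[of "q p + of_nat j" j]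
    by (simp add: c_def field_simps del: of_nat_Suc) (simp add: algebra_simps)
  have power_c: "(\<lambda>p. q p ^ r * c j p) \<in> B" for r j
  proof (induction r arbitrary: j)
    case 0
    show ?case using mem[of j] by (simp add: B_def c_def q_def)
  next
    case (Suc r)
    have "(\<lambda>p. of_nat (Suc j) * (q p ^ r * c (Suc j) p + (- 1) * (q p ^ r * c j p))) \<in> B"
      by (intro scale add Suc.IH)
    moreover have "q p ^ Suc r * c j p = of_nat (Suc j) * (q p ^ r * c (Suc j) p + (- 1) * (q p ^ r * c j p))" for p
      by (simp only: power_Suc2 mult.assoc q_c) (simp add: algebra_simps)
    ultimately show ?case by simp
  qed
  have prod: "(\<lambda>p. (\<Prod>p'\<in>S. of_int (p' - p)) * q p ^ r) \<in> B" if "finite S" for S r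
    using that
  proof (induction S arbitrary: r rule: finite_induct)
    case empty
    show ?case using power_c[of r 0] by (simp add: c_def)
  next
    case (insert s S)
    \<comment> \<open>The new linear factor is \<open>s - p = q p - q s\<close>.\<close>
    have "(\<lambda>p. (\<Prod>p'\<in>S. of_int (p' - p)) * q p ^ Suc r + (- q s) * ((\<Prod>p'\<in>S. of_int (p' - p)) * q p ^ r)) \<in> B"
      by (intro add scale insert.IH)
    then show ?case using insert.hyps by (simp add: algebra_simps q_def)
  qed
  define S where "S = {p. h p \<noteq> 0} - {p0}"
  have S: "finite S" using fin by (simp add: S_def)
  define \<phi> where "\<phi> p = (\<Prod>p'\<in>S. of_int (p' - p) :: complex)" for p
  have "Sum_any (\<lambda>p. \<phi> p *\<^sub>C h p) \<in> U" using prod[OF S, of 0] by (simp add: B_def \<phi>_def)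
  moreover have "\<phi> p *\<^sub>C h p = 0" if "p \<noteq> p0" for p
    using that S by (cases "h p = 0") (auto simp: \<phi>_def S_def intro!: prod_zero)
  ultimately have "\<phi> p0 *\<^sub>C h p0 \<in> U" by (metis (no_types, lifting) Sum_any_single)
  then have "(1 / \<phi> p0) *\<^sub>C \<phi> p0 *\<^sub>C h p0 \<in> U" by (rule cvs.subspace_scale[OF U])
  moreover have "\<phi> p0 \<noteq> 0" using S by (simp add: \<phi>_def S_def)
  ultimately show ?thesis by (simp add: cscale_cscale cscale_one)
qed

text \<open>Filtering by the creation operators \<open>c 0, c 1, \<dots>\<close> lets the annihilators strip any nonzero
  vector of a stable subspace down to a vacuum vector.\<close>

lemma annihilation:
  fixes c d :: "nat \<Rightarrow> 'w::complex_vs \<Rightarrow> 'w"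
  assumes lin: "\<And>i. clinear (c i)" "\<And>i. clinear (d i)"
    and dc: "\<And>i j w. d i (c j w) = (if i = j then w else 0) - c j (d i w)"
    and cc: "\<And>i j w. c i (c j w) = - c j (c i w)"
    and H0: "cvs.subspace H0" "\<And>i h. h \<in> H0 \<Longrightarrow> d i h = 0"
    and gen: "\<And>W. cvs.subspace W \<Longrightarrow> H0 \<subseteq> W \<Longrightarrow> (\<And>i w. w \<in> W \<Longrightarrow> c i w \<in> W \<and> d i w \<in> W) \<Longrightarrow> W = UNIV"
    and S: "\<And>i t. t \<in> S \<Longrightarrow> d i t \<in> S" "cvs.subspace S" and t: "t \<in> S" "t \<noteq> 0"
  obtains h where "h \<in> S" "h \<in> H0" "h \<noteq> 0"
proof -
  \<comment> \<open>\<open>H m\<close> is what \<open>c 0\<close>, ..., \<open>c (m - 1)\<close>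
    generate from \<open>H0\<close>. One power of each operator suffices because \<open>c m\<close>
    squares to zero.\<close>
  define H where "H = rec_nat H0 (\<lambda>m A. {s + c m s' | s s'. s \<in> A \<and> s' \<in> A})"
  have H_0: "H 0 = H0" and H_Suc: "H (Suc m) = {s + c m s' | s s'. s \<in> H m \<and> s' \<in> H m}" for m
    by (simp_all add: H_def)
  have sub: "cvs.subspace (H m)" for m
  proof (induction m)
    case (Suc m)
    show ?case
    proof (rule cvs.subspaceI)
      show "0 \<in> H (Suc m)"
        unfolding H_Suc using cvs.subspace_0[OF Suc] clinear_zero[OF lin(1)[of m]] by force
      fix u v assume "u \<in> H (Suc m)" "v \<in> H (Suc m)"
      then obtain u1 u2 v1 v2 where "u = u1 + c m u2" "v = v1 + c m v2"
        "u1 \<in> H m" "u2 \<in> H m" "v1 \<in> H m" "v2 \<in> H m" unfolding H_Suc by blast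
      moreover from this have "u + v = (u1 + v1) + c m (u2 + v2)"
        by (simp add: clinear_add[OF lin(1)] algebra_simps)
      ultimately show "u + v \<in> H (Suc m)"
        unfolding H_Suc using cvs.subspace_add[OF Suc] by blast
    next
      fix z u assume "u \<in> H (Suc m)"
      then obtain u1 u2 where "u = u1 + c m u2" "u1 \<in> H m" "u2 \<in> H m" unfolding H_Suc by blast
      moreover from this have "z *\<^sub>C u = z *\<^sub>C u1 + c m (z *\<^sub>C u2)"
        by (simp add: clinear_scale[OF lin(1)] cscale_add_right)
      ultimately show "z *\<^sub>C u \<in> H (Suc m)"
        unfolding H_Suc using cvs.subspace_scale[OF Suc] by blast
    qed
  qed (simp add: H_0 H0)
  have step: "H m \<subseteq> H (Suc m)" for m
  proof
    fix u assume "u \<in> H m"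
    moreover have "u = u + c m 0" by (simp add: clinear_zero[OF lin(1)])
    ultimately show "u \<in> H (Suc m)" unfolding H_Suc using cvs.subspace_0[OF sub] by blast
  qed
  have mono: "m \<le> n \<Longrightarrow> H m \<subseteq> H n" for m n by (rule lift_Suc_mono_le[of H, OF step])
  have d_kill: "i \<ge> m \<Longrightarrow> u \<in> H m \<Longrightarrow> d i u = 0" for i m u
  proof (induction m arbitrary: u)
    case (Suc m)
    then show ?case
      by (auto simp: H_Suc clinear_add[OF lin(2)] dc clinear_zero[OF lin(1)])
  qed (simp add: H_0 H0)
  have d_H: "u \<in> H m \<Longrightarrow> d i u \<in> H m" for i m u
  proof (induction m arbitrary: u)
    case 0
    then show ?case using cvs.subspace_0[OF H0(1)] by (simp add: H_0 H0)
  next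
    case (Suc m)
    then obtain s s' where u: "u = s + c m s'" "s \<in> H m" "s' \<in> H m" unfolding H_Suc by blast
    have "d i u = (d i s + (if i = m then s' else 0)) + c m (- d i s')"
      by (simp add: u(1) clinear_add[OF lin(2)] dc clinear_minus[OF lin(1)])
    moreover have "d i s + (if i = m then s' else 0) \<in> H m" "- d i s' \<in> H m"
      using u Suc.IH cvs.subspace_add[OF sub] cvs.subspace_neg[OF sub] by auto
    ultimately show ?case unfolding H_Suc by blast
  qed
  have c_H: "i < m \<Longrightarrow> u \<in> H m \<Longrightarrow> c i u \<in> H m" for i m u
  proof (induction m arbitrary: u)
    case (Suc m)
    then obtain s s' where u: "u = s + c m s'" "s \<in> H m" "s' \<in> H m" unfolding H_Suc by blast
    show ?case
    proof (cases "i = m")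
      case True
      have "c m (c m s') = 0" using cc[of m m s'] cvs_double_zero by (metis add.right_inverse)
      then have "c i u = 0 + c m s" by (simp add: True u(1) clinear_add[OF lin(1)])
      then show ?thesis unfolding H_Suc using u cvs.subspace_0[OF sub] by blast
    next
      case False
      then have im: "i < m" using Suc.prems by simp
      have "c i u = c i s + c m (- c i s')"
        by (simp add: u(1) clinear_add[OF lin(1)] cc[of i m] clinear_minus[OF lin(1)])
      then show ?thesis
        unfolding H_Suc using Suc.IH[OF im u(2)] cvs.subspace_neg[OF sub Suc.IH[OF im u(3)]] by blast
    qed
  qed simp
  have "(\<Union>m. H m) = UNIV"
  proof (rule gen)
    show "cvs.subspace (\<Union>m. H m)"
    proof (rule cvs.subspaceI)
      show "0 \<in> (\<Union>m. H m)" using cvs.subspace_0[OF sub] by blast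
      fix u v assume "u \<in> (\<Union>m. H m)" "v \<in> (\<Union>m. H m)"
      then obtain m n where "u \<in> H m" "v \<in> H n" by blast
      then have "u \<in> H (max m n)" "v \<in> H (max m n)" using mono[of m "max m n"] mono[of n "max m n"] by auto
      then show "u + v \<in> (\<Union>m. H m)" using cvs.subspace_add[OF sub] by blast
    qed (use cvs.subspace_scale[OF sub] in blast)
    show "H0 \<subseteq> (\<Union>m. H m)" using H_0 by blast
    fix i w assume "w \<in> (\<Union>m. H m)"
    then obtain m where m: "w \<in> H m" by blast
    then have "w \<in> H (max m (Suc i))" using mono[of m "max m (Suc i)"] by auto
    then have "c i w \<in> H (max m (Suc i))" by (intro c_H) auto
    then show "c i w \<in> (\<Union>m. H m) \<and> d i w \<in> (\<Union>m. H m)" using d_H[OF m] by blast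
  qed
  then obtain m where "t \<in> H m" by blast
  then have "\<exists>h. h \<in> S \<and> h \<in> H 0 \<and> h \<noteq> 0"
    using t
  proof (induction m arbitrary: t)
    case (Suc m)
    then obtain s s' where u: "t = s + c m s'" "s \<in> H m" "s' \<in> H m" unfolding H_Suc by blast
    \<comment> \<open>\<open>d m\<close> kills all of \<open>H m\<close>, hence both
      \<open>s\<close> and \<open>s'\<close>, and strips \<open>c m\<close> from the second summand.
      If \<open>s' = 0\<close> then \<open>t\<close> itself already lies in
      \<open>H m\<close>.\<close>
    have "d m t = s'"
      by (simp add: u(1) clinear_add[OF lin(2)] dc d_kill[OF order_refl u(2)] d_kill[OF order_refl u(3)]
          clinear_zero[OF lin(1)])
    then have "s' \<in> S" using S(1)[OF Suc.prems(2), of m] by simp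
    then show ?case
      using Suc u clinear_zero[OF lin(1)] by (cases "s' = 0") auto
  qed blast
  then show ?thesis using that H_0 by blast
qed

section \<open>Extending a subspace to a graded one\<close>

definition raised :: "('w::complex_vs \<Rightarrow> 'w) set \<Rightarrow> 'w set \<Rightarrow> nat \<Rightarrow> 'w set" where
  "raised P U = rec_nat U (\<lambda>_ A. cvs.span {p t | p t. p \<in> P \<and> t \<in> A})"

lemma raised_0: "raised P U 0 = U"
  and raised_Suc: "raised P U (Suc n) = cvs.span {p t | p t. p \<in> P \<and> t \<in> raised P U n}"
  by (simp_all add: raised_def)

lemma raised_up: "p \<in> P \<Longrightarrow> t \<in> raised P U n \<Longrightarrow> p t \<in> raised P U (Suc n)"
  unfolding raised_Suc by (rule cvs.span_base) blast

lemma raised_subspace: "cvs.subspace U \<Longrightarrow> cvs.subspace (raised P U n)"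
  by (cases n) (simp_all add: raised_0 raised_Suc)

text \<open>Moving \<open>q\<close> past one \<open>p\<close> costs a multiple of the vector without
  \<open>p\<close>, which already has the lower degree. In the remaining term \<open>q\<close> meets
  one operator fewer, until closedness of \<open>U\<close> ends the induction.\<close>

lemma raised_down:
  assumes U: "cvs.subspace U" and q: "clinear q"
    and comm: "\<And>p. p \<in> P \<Longrightarrow> \<exists>e c. \<forall>t. q (p t) = e *\<^sub>C p (q t) + c *\<^sub>C t"
    and closed: "\<And>p t. p \<in> P \<Longrightarrow> t \<in> U \<Longrightarrow> p (q t) \<in> U"
  shows "t \<in> raised P U (Suc n) \<Longrightarrow> q t \<in> raised P U n"
proof (induction n arbitrary: t)
  have step: "q t \<in> raised P U n" if t: "t \<in> raised P U (Suc n)"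
    and pq: "\<And>p t. p \<in> P \<Longrightarrow> t \<in> raised P U n \<Longrightarrow> p (q t) \<in> raised P U n" for t n
  proof (rule clinear_span_mem[OF q raised_subspace[OF U] _ t[unfolded raised_Suc]])
    fix x assume "x \<in> {p t | p t. p \<in> P \<and> t \<in> raised P U n}"
    then obtain p t where x: "x = p t" "p \<in> P" "t \<in> raised P U n" by blast
    obtain e c' where ec: "\<And>t. q (p t) = e *\<^sub>C p (q t) + c' *\<^sub>C t" using comm[OF x(2)] by blast
    note sub = raised_subspace[OF U]
    show "q x \<in> raised P U n"
      unfolding x(1) ec
      by (intro cvs.subspace_add[OF sub] cvs.subspace_scale[OF sub] pq x)
  qed
  {
    case 0
    then show ?case by (intro step) (simp_all add: raised_0 closed)
  next
    case (Suc n)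
    show ?case
    proof (rule step[OF Suc.prems])
      fix p t assume "p \<in> P" "t \<in> raised P U (Suc n)"
      from raised_up[OF this(1) Suc.IH[OF this(2)]] show "p (q t) \<in> raised P U (Suc n)" .
    qed
  }
qed

text \<open>\<open>W k\<close> is spanned by \<open>k\<close>-fold products from \<open>P\<close>
  applied to \<open>U\<close>, or by \<open>-k\<close>-fold products from \<open>Q\<close>. The
  essential conclusion is \<open>W 0 = U\<close>: the extension does not enlarge degree zero. The
  spaces \<open>L k\<close> record that the new degrees are compatible with a given grading.\<close>

lemma graded_extension:
  fixes P Q :: "('w::complex_vs \<Rightarrow> 'w) set"
  assumes U: "cvs.subspace U"
    and lin: "\<And>p. p \<in> P \<Longrightarrow> clinear p" "\<And>q. q \<in> Q \<Longrightarrow> clinear q"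
    and comm: "\<And>p q. p \<in> P \<Longrightarrow> q \<in> Q \<Longrightarrow> \<exists>e c. \<forall>t. q (p t) = e *\<^sub>C p (q t) + c *\<^sub>C t"
      "\<And>p q. p \<in> P \<Longrightarrow> q \<in> Q \<Longrightarrow> \<exists>e c. \<forall>t. p (q t) = e *\<^sub>C q (p t) + c *\<^sub>C t"
    and closed: "\<And>p q t. p \<in> P \<Longrightarrow> q \<in> Q \<Longrightarrow> t \<in> U \<Longrightarrow> p (q t) \<in> U"
    and L: "\<And>k. cvs.subspace (L k)" "U \<subseteq> L (0::int)"
      "\<And>p k t. p \<in> P \<Longrightarrow> t \<in> L k \<Longrightarrow> p t \<in> L (k + 1)"
      "\<And>q k t. q \<in> Q \<Longrightarrow> t \<in> L k \<Longrightarrow> q t \<in> L (k - 1)"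
  obtains W where "W 0 = U" "\<And>k. cvs.subspace (W k)" "\<And>k. W k \<subseteq> L k"
    "\<And>p k t. p \<in> P \<Longrightarrow> t \<in> W k \<Longrightarrow> p t \<in> W (k + 1)"
    "\<And>q k t. q \<in> Q \<Longrightarrow> t \<in> W k \<Longrightarrow> q t \<in> W (k - 1)"
proof -
  define W where "W k = (if k \<ge> 0 then raised P U (nat k) else raised Q U (nat (- k)))" for k
  have closed': "q (p t) \<in> U" if pq: "p \<in> P" "q \<in> Q" "t \<in> U" for p q t
  proof -
    obtain e c where "q (p t) = e *\<^sub>C p (q t) + c *\<^sub>C t" using comm(1)[OF pq(1,2)] by blast
    then show ?thesis
      using closed[OF pq] pq(3) cvs.subspace_add[OF U] cvs.subspace_scale[OF U] by simp
  qed
  have W: "W (int n) = raised P U n" "W (- int n) = raised Q U n" for n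
    by (simp_all add: W_def raised_0)
  have sub: "cvs.subspace (W k)" for k by (simp add: W_def raised_subspace[OF U])
  have up: "p t \<in> W (k + 1)" if "p \<in> P" "t \<in> W k" for p k t
  proof (cases k rule: int_cases3)
    case zero
    then show ?thesis using raised_up[OF that(1), of t U 0] that W(1)[of 0] W(1)[of 1] by simp
  next
    case (pos n)
    then show ?thesis using raised_up[OF that(1), of t U n] that W(1)[of n] W(1)[of "Suc n"] by (simp add: add.commute)
  next
    case (neg n)
    then obtain n' where n: "n = Suc n'" by (cases n) auto
    have k: "k + 1 = - int n'" using neg n by simp
    have "t \<in> raised Q U (Suc n')" using that(2) unfolding neg(1) n W .
    then show ?thesis
      unfolding k W
    proof (rule raised_down[where P = Q and q = p and U = U, rotated 4])
      fix q t assume "q \<in> Q" "t \<in> U"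
      from closed'[OF that(1) this] show "q (p t) \<in> U" .
    qed (use U lin(1) comm(2) that(1) in blast)+
  qed
  have down: "q t \<in> W (k - 1)" if "q \<in> Q" "t \<in> W k" for q k t
  proof (cases k rule: int_cases3)
    case zero
    then show ?thesis using raised_up[OF that(1), of t U 0] that W(2)[of 0] W(2)[of 1] by simp
  next
    case (neg n)
    moreover have "- int n - 1 = - int (Suc n)" by simp
    ultimately show ?thesis using raised_up[OF that(1), of t U n] that W(2)[of n] W(2)[of "Suc n"] by metis
  next
    case (pos n)
    then obtain n' where n: "n = Suc n'" by (cases n) auto
    have k: "k - 1 = int n'" using pos n by simp
    have "t \<in> raised P U (Suc n')" using that(2) unfolding pos(1) n W .
    then show ?thesis
      unfolding k W
    proof (rule raised_down[where P = P and q = q and U = U, rotated 4])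
      fix p t assume "p \<in> P" "t \<in> U"
      from closed[OF this(1) that(1) this(2)] show "p (q t) \<in> U" .
    qed (use U lin(2) comm(1) that(1) in blast)+
  qed
  have "raised P U n \<subseteq> L (int n)" for n
  proof (induction n)
    case (Suc n)
    show ?case
      unfolding raised_Suc using Suc L(3)[of _ _ "int n"]
      by (intro cvs.span_minimal L(1)) (auto simp: add.commute)
  qed (simp add: raised_0 L)
  moreover have "raised Q U n \<subseteq> L (- int n)" for n
  proof (induction n)
    case (Suc n)
    have eq: "- int n - 1 = - int (Suc n)" by simp
    have "q t \<in> L (- int (Suc n))" if "q \<in> Q" "t \<in> L (- int n)" for q t
      using L(4)[OF that] unfolding eq .
    then show ?case
      unfolding raised_Suc using Suc by (intro cvs.span_minimal L(1)) blast
  qed (simp add: raised_0 L)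
  ultimately have "W k \<subseteq> L k" for k
    by (cases k rule: int_cases2) (simp_all only: W)
  then show ?thesis
    using that[of W] sub up down W(1)[of 0] by (simp add: raised_0)
qed

lemma clinear_if: "clinear (\<lambda>t. if P then t else 0)"
  by (cases P) (simp_all add: clinear_iff)

lemma tensor_action_vac_left:
  assumes "field_action Y" "field_action Z" and vac: "\<And>n w. Y e n w = (if n = - 1 then w else 0)"
  shows "tensor_action Y Z (e \<otimes> f) n t = tensor_map (\<lambda>w. w) (Z f n) t"
proof (rule clinear_tensor_eqI[where t = t])
  note Z = field_action_linear[OF assms(2)]
  show "clinear (tensor_action Y Z (e \<otimes> f) n)" by (rule clinear_tensor_action[OF assms(1,2)])
  show "clinear (tensor_map (\<lambda>w. w) (Z f n))" by (intro clinear_tensor_map clinear_id Z)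
  fix w g
  show "tensor_action Y Z (e \<otimes> f) n (w \<otimes> g) = tensor_map (\<lambda>w. w) (Z f n) (w \<otimes> g)"
    by (simp add: tensor_action_tens[OF assms(1,2)] tensor_map_tens clinear_id Z)
       (subst Sum_any_single[of "- 1"], auto simp: vac)
qed

lemma tensor_action_vac_right:
  assumes "field_action Y" "field_action Z" and vac: "\<And>n w. Z e n w = (if n = - 1 then w else 0)"
  shows "tensor_action Y Z (u \<otimes> e) n t = tensor_map (Y u n) (\<lambda>w. w) t"
proof (rule clinear_tensor_eqI[where t = t])
  note Y = field_action_linear[OF assms(1)]
  show "clinear (tensor_action Y Z (u \<otimes> e) n)" by (rule clinear_tensor_action[OF assms(1,2)])
  show "clinear (tensor_map (Y u n) (\<lambda>w. w))" by (intro clinear_tensor_map clinear_id Y)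
  fix w g
  show "tensor_action Y Z (u \<otimes> e) n (w \<otimes> g) = tensor_map (Y u n) (\<lambda>w. w) (w \<otimes> g)"
    by (simp add: tensor_action_tens[OF assms(1,2)] tensor_map_tens clinear_id Y)
       (subst Sum_any_single[of n], auto simp: vac)
qed

lemma tens_in_part: "f \<in> part F p \<Longrightarrow> u \<otimes> f \<in> part (tensor_vsa M F) p"
  unfolding tensor_vsa_def by (auto intro!: cvs.span_base)

section \<open>The free field realization on a tensor product\<close>

context
  fixes M :: "'m::complex_vs vsa" and a b :: 'm and F :: "'f::complex_vs vsa" and x y :: 'f
    and Y :: "'m \<Rightarrow> int \<Rightarrow> 'n::complex_vs \<Rightarrow> 'n"
  assumes M: "weyl_vertex_algebra M a b" and F: "clifford_vertex_algebra F x y"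
    and Y: "vsa_module M Y"
begin

abbreviation (input) "TA \<equiv> tensor_action Y (prd F)"
abbreviation (input) "TP \<equiv> tensor_action (prd M) (prd F)"

text \<open>In the usual notation these are \<open>a(n)\<close>, \<open>a*(n+1)\<close>,
  \<open>psi(n+1/2)\<close> and \<open>psi*(n+1/2)\<close>, each acting on its own factor. With
  vertex algebra indices every canonical pair has mode numbers of sum \<open>-1\<close>.\<close>

definition "Aop n = tensor_map (Y a n) (\<lambda>g::'f. g)"
definition "Bop n = tensor_map (Y b n) (\<lambda>g::'f. g)"
definition "Xop n = tensor_map (\<lambda>w::'n. w) (prd F x n)"
definition "Yop n = tensor_map (\<lambda>w::'n. w) (prd F y n)"

lemmas Y_action = weyl_module_field_action[OF M Y]
lemmas Y_lin = field_action_linear[OF Y_action]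
lemmas F_action = clifford_field_action[OF F]
lemmas F_lin = clifford_linear[OF F]
lemmas TA_lin = clinear_tensor_action[OF Y_action F_action]
lemmas TA_lin_left = clinear_tensor_action_left[OF Y_action F_action]

lemma op_lin: "clinear (Aop n)" "clinear (Bop n)" "clinear (Xop n)" "clinear (Yop n)"
  unfolding Aop_def Bop_def Xop_def Yop_def
  by (intro clinear_tensor_map clinear_id Y_lin F_lin)+

lemma op_tens: "Aop n (w \<otimes> g) = Y a n w \<otimes> g" "Bop n (w \<otimes> g) = Y b n w \<otimes> g"
  "Xop n (w \<otimes> g) = w \<otimes> prd F x n g" "Yop n (w \<otimes> g) = w \<otimes> prd F y n g"
  unfolding Aop_def Bop_def Xop_def Yop_def by (simp_all add: tensor_map_tens clinear_id Y_lin F_lin)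

lemma op_relations:
  "Aop n (Bop m t) = Bop m (Aop n t) + (if n + m + 1 = 0 then t else 0)"
  "Xop n (Yop m t) = (if n + m + 1 = 0 then t else 0) - Yop m (Xop n t)"
  "Xop n (Xop m t) = - Xop m (Xop n t)"
  "Yop n (Yop m t) = - Yop m (Yop n t)"
  "Xop n (Aop m t) = Aop m (Xop n t)" "Xop n (Bop m t) = Bop m (Xop n t)"
  "Yop n (Aop m t) = Aop m (Yop n t)" "Yop n (Bop m t) = Bop m (Yop n t)"
proof -
  have xy: "prd F x n (prd F y m v) = (if n + m + 1 = 0 then v else 0) - prd F y m (prd F x n v)" for v
    using clifford_yx[OF F, of m n v] by simp
  note lin = op_lin clinear_compose[OF op_lin(1)] clinear_compose[OF op_lin(2)]
    clinear_compose[OF op_lin(3)] clinear_compose[OF op_lin(4)] clinear_plus clinear_minus_fun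
    clinear_uminus clinear_if
  show "Aop n (Bop m t) = Bop m (Aop n t) + (if n + m + 1 = 0 then t else 0)"
    by (rule clinear_tensor_eqI[where t = t]; (intro lin)?)
       (simp add: op_tens weyl_module_relations(1)[OF M Y] tens_add_left)
  show "Xop n (Yop m t) = (if n + m + 1 = 0 then t else 0) - Yop m (Xop n t)"
    by (rule clinear_tensor_eqI[where t = t]; (intro lin)?) (simp add: op_tens xy tens_diff_right tens_uminus_right)
  show "Xop n (Xop m t) = - Xop m (Xop n t)"
    by (rule clinear_tensor_eqI[where t = t]; (intro lin)?)
       (simp add: op_tens clifford_xx[OF F, of n m] tens_uminus_right)
  show "Yop n (Yop m t) = - Yop m (Yop n t)"
    by (rule clinear_tensor_eqI[where t = t]; (intro lin)?)
       (simp add: op_tens clifford_yy[OF F, of n m] tens_uminus_right)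
  show "Xop n (Aop m t) = Aop m (Xop n t)" "Xop n (Bop m t) = Bop m (Xop n t)"
    "Yop n (Aop m t) = Aop m (Yop n t)" "Yop n (Bop m t) = Bop m (Yop n t)"
    by (rule clinear_tensor_eqI[where t = t]; (intro lin)?; simp add: op_tens; fail)+
qed

lemma TA_vac_left: "TA (vac M \<otimes> f) n t = tensor_map (\<lambda>w. w) (prd F f n) t"
  by (rule tensor_action_vac_left[OF Y_action F_action weyl_module_vac[OF M Y]])

lemma TA_vac_right: "TA (u \<otimes> vac F) n t = tensor_map (Y u n) (\<lambda>w. w) t"
  by (rule tensor_action_vac_right[OF Y_action F_action clifford_vac_modes[OF F]])

lemma TA_vac: "TA (vac M \<otimes> vac F) n t = (if n = - 1 then t else 0)"
proof (rule clinear_tensor_eqI[where t = t])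
  show "clinear (TA (vac M \<otimes> vac F) n)" by (rule TA_lin)
  show "clinear (\<lambda>t :: ('n, 'f) tensor. if n = - 1 then t else 0)" by (rule clinear_if)
  show "TA (vac M \<otimes> vac F) n (w \<otimes> g) = (if n = - 1 then w \<otimes> g else 0)" for w g
    by (simp add: TA_vac_left tensor_map_tens clinear_id F_lin clifford_vac_modes[OF F])
qed

lemma TP_vac_left: "TP (vac M \<otimes> f) n (vac M \<otimes> g) = vac M \<otimes> prd F f n g"
  by (simp add: tensor_action_vac_left[OF weyl_field_action[OF M] F_action weyl_vac_modes[OF M]]
      tensor_map_tens clinear_id F_lin)

lemma TA_triple:
  assumes "s \<in> part (tensor_vsa M F) p" "s' \<in> part (tensor_vsa M F) q"
  shows "module_triple TA TP (koszul p q) s s' t"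
  by (rule module_triple_tensor[OF weyl_vsa[OF M] weyl_part[OF M] Y clifford_vsa[OF F]
        clifford_module[OF F] assms])

section \<open>The charge operator and its commutators\<close>

definition charge :: "('n, 'f) tensor \<Rightarrow> ('n, 'f) tensor" where
  "charge = TA (gl11_vector M a b F x y gE) 0"

lemma charge_lin: "clinear charge"
  unfolding charge_def by (rule TA_lin)

lemma charge_tens:
  "charge (w \<otimes> g) = w \<otimes> prd F (clifford_gamma F x y) 0 g + Y (weyl_beta M a b) 0 w \<otimes> g"
  by (simp add: charge_def clinear_add[OF TA_lin_left] TA_vac_left TA_vac_right tensor_map_tens
      clinear_id Y_lin F_lin)

lemma charge_commutator:
  "charge (Aop n t) = Aop n (charge t) - Aop n t" "charge (Bop n t) = Bop n (charge t) + Bop n t"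
  "charge (Xop n t) = Xop n (charge t) + Xop n t" "charge (Yop n t) = Yop n (charge t) - Yop n t"
proof -
  note lin = clinear_compose[OF charge_lin] op_lin clinear_compose[OF op_lin(1)]
    clinear_compose[OF op_lin(2)] clinear_compose[OF op_lin(3)] clinear_compose[OF op_lin(4)]
    clinear_plus clinear_minus_fun charge_lin
  show "charge (Aop n t) = Aop n (charge t) - Aop n t"
    "charge (Bop n t) = Bop n (charge t) + Bop n t"
    "charge (Xop n t) = Xop n (charge t) + Xop n t" "charge (Yop n t) = Yop n (charge t) - Yop n t"
    by (rule clinear_tensor_eqI[where t = t]; (intro lin)?;
        simp add: charge_tens op_tens weyl_charge_commutator[OF M Y] clifford_gamma_commutator[OF F]
          tens_add_left tens_add_right tens_diff_left tens_diff_right clinear_add[OF op_lin(1)]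
          clinear_add[OF op_lin(2)] clinear_add[OF op_lin(3)] clinear_add[OF op_lin(4)])+
qed

lemma charge_shift:
  assumes "t \<in> eigenspace charge c"
  shows "Bop n t \<in> eigenspace charge (c + 1)" "Xop n t \<in> eigenspace charge (c + 1)"
    "Aop n t \<in> eigenspace charge (c - 1)" "Yop n t \<in> eigenspace charge (c - 1)"
  using assms
  by (simp_all add: eigenspace_def charge_commutator clinear_scale op_lin cscale_add_left cscale_one
      cvs.scale_left_diff_distrib)

lemma normal_product_lin: "clinear (normal_product (prd F x) (prd F y) p q)"
proof (cases "p < 0")
  case True
  then have "normal_product (prd F x) (prd F y) p q = (\<lambda>w. prd F x p (prd F y q w))"
    by (simp add: normal_product_def fun_eq_iff)
  then show ?thesis using clinear_compose[OF F_lin F_lin] by simp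
next
  case False
  then have "normal_product (prd F x) (prd F y) p q = (\<lambda>w. - prd F y q (prd F x p w))"
    by (simp add: normal_product_def fun_eq_iff)
  then show ?thesis using clinear_uminus[OF clinear_compose[OF F_lin F_lin]] by simp
qed

lemma clifford_pair_modes_tensor:
  defines "h \<equiv> \<lambda>d p. tensor_map (\<lambda>w::'n. w) (normal_product (prd F x) (prd F y) p (d - p))"
  shows "finite {p. h d p t \<noteq> 0}"
    and "TA (vac M \<otimes> clifford_pair F x y j) (d + 1 + int j) t =
      (-1) ^ j *\<^sub>C Sum_any (\<lambda>p. (of_int (d - p) + of_nat j gchoose j) *\<^sub>C h d p t)"
proof -
  note hlin = clinear_tensor_map[OF clinear_id normal_product_lin]
  have h_tens: "h d p (w \<otimes> g) = w \<otimes> normal_product (prd F x) (prd F y) p (d - p) g" for d p w g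
    unfolding h_def by (rule tensor_map_tens[OF clinear_id normal_product_lin])
  have h_add: "h d p (s + t) = h d p s + h d p t" for d p s t
    unfolding h_def by (rule clinear_add[OF hlin])
  have fin: "finite {p. h d p t \<noteq> 0}" for d t
  proof (induction t rule: tensor_induct)
    case (tens w g)
    show ?case
      by (rule finite_subset[OF _ finite_normal_product[OF F, of d g]]) (auto simp: h_tens)
  next
    case (add s t)
    show ?case by (rule finite_subset[OF _ finite_UnI[OF add]]) (auto simp: h_add)
  qed
  then show "finite {p. h d p t \<noteq> 0}" .
  show "TA (vac M \<otimes> clifford_pair F x y j) (d + 1 + int j) t =
      (-1) ^ j *\<^sub>C Sum_any (\<lambda>p. (of_int (d - p) + of_nat j gchoose j) *\<^sub>C h d p t)"
  proof (induction t rule: tensor_induct)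
    case (tens w g)
    show ?case
      unfolding TA_vac_left tensor_map_tens[OF clinear_id F_lin] clifford_pair_modes[OF F] h_tens
        tens_scale_right clinear_Sum_any[OF clinear_tens_right finite_scaled[OF finite_normal_product[OF F]]] ..
  next
    case (add s t)
    then show ?case
      by (simp add: clinear_add[OF TA_lin] h_add cscale_add_right
          Sum_any.distrib[OF finite_scaled[OF fin] finite_scaled[OF fin]])
  qed
qed

lemma stable_vac_UNIV:
  assumes W: "cvs.subspace W" and vac: "\<And>w. w \<otimes> vac F \<in> W"
    and X: "\<And>n t. t \<in> W \<Longrightarrow> Xop n t \<in> W" and Y': "\<And>n t. t \<in> W \<Longrightarrow> Yop n t \<in> W"
  shows "W = UNIV"
proof -
  have tens: "w \<otimes> f \<in> W" for w f
  proof -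
    have "{f. w \<otimes> f \<in> W} = UNIV"
    proof (rule clifford_stable_UNIV[OF F])
      show "cvs.subspace {f. w \<otimes> f \<in> W}"
        using W by (intro cvs.subspaceI)
          (simp_all add: cvs.subspace_0 tens_add_right tens_scale_right cvs.subspace_add cvs.subspace_scale)
      show "vac F \<in> {f. w \<otimes> f \<in> W}" using vac by simp
      show "prd F x n f \<in> {f. w \<otimes> f \<in> W}" "prd F y n f \<in> {f. w \<otimes> f \<in> W}"
        if "f \<in> {f. w \<otimes> f \<in> W}" for n f
        using X[of "w \<otimes> f" n] Y'[of "w \<otimes> f" n] that by (simp_all add: op_tens)
    qed
    then show ?thesis by blast
  qed
  have "t \<in> W" for t
    by (induction t rule: tensor_induct) (simp_all add: tens cvs.subspace_add[OF W])
  then show ?thesis by blast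
qed

text \<open>The annihilators strip a nonzero vector of \<open>T\<close> down to some
  \<open>w \<otimes> vac F\<close>. The vectors \<open>w\<close> that occur in this way form a
  nonzero submodule of the irreducible module, so \<open>T\<close> contains every such vector and,
  by creation, everything.\<close>

lemma stable_UNIV:
  assumes irr: "irreducible_submodule Y UNIV" and T: "cvs.subspace T" "t0 \<in> T" "t0 \<noteq> 0"
    and ops: "\<And>n t. t \<in> T \<Longrightarrow> Aop n t \<in> T" "\<And>n t. t \<in> T \<Longrightarrow> Bop n t \<in> T"
      "\<And>n t. t \<in> T \<Longrightarrow> Xop n t \<in> T" "\<And>n t. t \<in> T \<Longrightarrow> Yop n t \<in> T"
  shows "T = UNIV"
proof -
  \<comment> \<open>The two families of creation operators are interleaved into one sequence. The
    partner of a \<open>psi\<close> mode is a \<open>psi*\<close> mode, so the roles are exchanged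
    in \<open>d\<close>.\<close>
  define c where "c i = (if even i then Xop else Yop) (- int (i div 2) - 1)" for i :: nat
  define d where "d i = (if even i then Yop else Xop) (int (i div 2))" for i :: nat
  have cXY: "Xop (- int n - 1) = c (2 * n)" "Yop (- int n - 1) = c (2 * n + 1)"
    "Xop (int n) = d (2 * n + 1)" "Yop (int n) = d (2 * n)" for n
    by (simp_all add: c_def d_def)
  have XY: "\<exists>i. Xop n = c i \<or> Xop n = d i" "\<exists>i. Yop n = c i \<or> Yop n = d i" for n
  proof -
    obtain k where "n = int k \<or> n = - int k - 1"
    proof (cases "n \<ge> 0")
      case True
      then show ?thesis using that[of "nat n"] by simp
    next
      case False
      then show ?thesis using that[of "nat (- n - 1)"] by simp
    qed
    then show "\<exists>i. Xop n = c i \<or> Xop n = d i" "\<exists>i. Yop n = c i \<or> Yop n = d i"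
      using cXY[of k] by auto
  qed
  have dc: "d i (c j w) = (if i = j then w else 0) - c j (d i w)" for i j w
  proof -
    have YX: "Yop n (Xop m w) = (if m + n + 1 = 0 then w else 0) - Xop m (Yop n w)" for n m
      using op_relations(2)[of m n w] by (simp add: algebra_simps)
    have div: "i = j" if "i div 2 = j div 2" "even i = even j"
      using that by (metis div_mult_mod_eq parity_cases)
    have eq: "- int (j div 2) - 1 + int (i div 2) + 1 = 0 \<longleftrightarrow> i div 2 = j div 2"
      "int (i div 2) + (- int (j div 2) - 1) + 1 = 0 \<longleftrightarrow> i div 2 = j div 2" by auto
    show ?thesis
    proof (cases "even i = even j")
      case True
      then have ij: "i = j \<longleftrightarrow> i div 2 = j div 2" using div by auto
      show ?thesis
      proof (cases "even i")
        case even: True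
        have "d i = Yop (int (i div 2))" "c j = Xop (- int (j div 2) - 1)"
          using even True by (simp_all add: c_def d_def)
        then show ?thesis unfolding ij by (simp only: YX eq)
      next
        case odd: False
        have "d i = Xop (int (i div 2))" "c j = Yop (- int (j div 2) - 1)"
          using odd True by (simp_all add: c_def d_def)
        then show ?thesis unfolding ij by (simp only: op_relations(2) eq)
      qed
    next
      case False
      then have "i \<noteq> j" by blast
      show ?thesis
      proof (cases "even i")
        case True
        then have "d i = Yop (int (i div 2))" "c j = Yop (- int (j div 2) - 1)"
          using False by (simp_all add: c_def d_def)
        then show ?thesis using \<open>i \<noteq> j\<close> op_relations(4)[of "int (i div 2)" "- int (j div 2) - 1" w] by simp
      next
        case odd: False
        then have "d i = Xop (int (i div 2))" "c j = Xop (- int (j div 2) - 1)"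
          using False by (simp_all add: c_def d_def)
        then show ?thesis using \<open>i \<noteq> j\<close> op_relations(3)[of "int (i div 2)" "- int (j div 2) - 1" w] by simp
      qed
    qed
  qed
  have cc: "c i (c j w) = - c j (c i w)" for i j w
  proof -
    have YX: "Yop (- int n - 1) (Xop (- int m - 1) w) = - Xop (- int m - 1) (Yop (- int n - 1) w)" for n m
      using op_relations(2)[of "- int m - 1" "- int n - 1" w] by (simp add: algebra_simps)
    have XY: "Xop (- int n - 1) (Yop (- int m - 1) w) = - Yop (- int m - 1) (Xop (- int n - 1) w)" for n m
      using op_relations(2)[of "- int n - 1" "- int m - 1" w] by simp
    show ?thesis
      using YX[of "i div 2" "j div 2"] XY[of "i div 2" "j div 2"]
        op_relations(3)[of "- int (i div 2) - 1" "- int (j div 2) - 1" w]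
        op_relations(4)[of "- int (i div 2) - 1" "- int (j div 2) - 1" w]
      unfolding c_def by (cases "even i"; cases "even j") simp_all
  qed
  define H0 where "H0 = range (\<lambda>w::'n. w \<otimes> vac F)"
  have H0: "cvs.subspace H0"
    unfolding H0_def
  proof (rule cvs.subspaceI)
    show "0 \<in> range (\<lambda>w::'n. w \<otimes> vac F)" by (metis rangeI tens_zero(1))
  qed (auto simp: tens_add_left[symmetric] tens_scale_left[symmetric])
  have kill: "d i h = 0" if "h \<in> H0" for i h
    using that by (auto simp: H0_def d_def op_tens clifford_vac[OF F])
  have gen: "W = UNIV" if "cvs.subspace W" "H0 \<subseteq> W" "\<And>i w. w \<in> W \<Longrightarrow> c i w \<in> W \<and> d i w \<in> W" for W
  proof (rule stable_vac_UNIV[OF that(1)])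
    show "w \<otimes> vac F \<in> W" for w using that(2) by (auto simp: H0_def)
    show "Xop n t \<in> W" "Yop n t \<in> W" if "t \<in> W" for n t
      using XY[of n] \<open>\<And>i w. w \<in> W \<Longrightarrow> c i w \<in> W \<and> d i w \<in> W\<close>[OF that] by auto
  qed
  have "d i t \<in> T" if "t \<in> T" for i t using ops that by (simp add: d_def)
  moreover have "clinear (c i)" "clinear (d i)" for i by (simp_all add: c_def d_def op_lin)
  ultimately obtain h where h: "h \<in> T" "h \<in> H0" "h \<noteq> 0"
    using annihilation[of c d H0 T t0, OF _ _ dc cc H0 kill gen _ T] by blast
  then obtain w where w': "h = w \<otimes> vac F" by (auto simp: H0_def)
  then have w: "w \<otimes> vac F \<in> T" "w \<noteq> 0" using h by auto
  define S where "S = {w. w \<otimes> vac F \<in> T}"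
  have "vsa_submodule Y S"
  proof (rule weyl_stable_submodule[OF M Y])
    show "cvs.subspace S"
      using T(1) by (intro cvs.subspaceI)
        (simp_all add: S_def cvs.subspace_0 tens_add_left tens_scale_left cvs.subspace_add cvs.subspace_scale)
    show "Y a n w \<in> S" "Y b n w \<in> S" if "w \<in> S" for n w
      using ops(1,2)[of "w \<otimes> vac F" n] that by (simp_all add: S_def op_tens)
  qed
  then have "S = UNIV" using irr w by (auto simp: irreducible_submodule_def S_def)
  then show ?thesis
    by (intro stable_vac_UNIV T ops) (auto simp: S_def)
qed

lemma ops_tensor_map:
  "tensor_map (Y a n) (prd F x p) t = Aop n (Xop p t)"
  "tensor_map (Y b n) (\<lambda>g. - prd F y p g) t = - Bop n (Yop p t)"
  by (rule clinear_tensor_eqI[where t = t];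
      (intro clinear_tensor_map clinear_uminus clinear_compose[OF op_lin(1)] clinear_compose[OF op_lin(2)]
        op_lin Y_lin F_lin)?;
      simp add: tensor_map_tens Y_lin F_lin clinear_uminus op_tens tens_uminus_right)+

text \<open>The mode of \<open>u \<otimes> z\<close> is the series of all
  \<open>u_i \<otimes> z_(n-i-1)\<close>. The fermion pair touches the second factor only, and by
  hypothesis its commutator picks out \<open>i = n\<close>.\<close>

lemma TA_commutator:
  assumes R: "clinear R"
    and comm: "\<And>i g. prd F x p (prd F y q (prd F z (n - i - 1) g)) - prd F z (n - i - 1) (prd F x p (prd F y q g))
      = (if i = n then R g else 0)"
  shows "Xop p (Yop q (TA (u \<otimes> z) n t)) - TA (u \<otimes> z) n (Xop p (Yop q t)) = tensor_map (Y u n) R t"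
proof (rule clinear_tensor_eqI[where t = t])
  let ?T = "TA (u \<otimes> z) n"
  show "clinear (\<lambda>t. Xop p (Yop q (?T t)) - ?T (Xop p (Yop q t)))"
    by (intro clinear_minus_fun clinear_compose[OF op_lin(3)] clinear_compose[OF op_lin(4)]
        clinear_compose[OF TA_lin] TA_lin op_lin)
  show "clinear (tensor_map (Y u n) R)" by (rule clinear_tensor_map[OF Y_lin R])
  fix w g
  note fin = finite_tensor_terms[OF Y_action F_action, of u w z n]
  have lin: "clinear (\<lambda>t. Xop p (Yop q t))" by (rule clinear_compose[OF op_lin(3,4)])
  have fin': "finite {i. Xop p (Yop q (Y u i w \<otimes> prd F z (n - i - 1) g)) \<noteq> 0}"
    by (rule finite_subset[OF _ fin[of g]]) (auto simp: clinear_zero[OF lin])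
  have "Xop p (Yop q (?T (w \<otimes> g))) - ?T (Xop p (Yop q (w \<otimes> g))) =
      Sum_any (\<lambda>i. Xop p (Yop q (Y u i w \<otimes> prd F z (n - i - 1) g)) -
        Y u i w \<otimes> prd F z (n - i - 1) (prd F x p (prd F y q g)))"
    unfolding op_tens(3,4)[of _ w g] op_tens(3,4)[of _ w "prd F _ _ _"]
      tensor_action_tens[OF Y_action F_action] clinear_Sum_any[OF lin fin]
    by (rule Sum_any_diff[OF fin' fin, symmetric])
  also have "\<dots> = Sum_any (\<lambda>i. if i = n then Y u n w \<otimes> R g else 0)"
    by (rule Sum_any.cong) (simp add: op_tens tens_diff_right[symmetric] comm)
  finally show "Xop p (Yop q (?T (w \<otimes> g))) - ?T (Xop p (Yop q (w \<otimes> g))) = tensor_map (Y u n) R (w \<otimes> g)"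
    by (simp add: tensor_map_tens[OF Y_lin R])
qed

context
  fixes U :: "('n, 'f) tensor set"
  assumes U: "cvs.subspace U"
    and gl11: "\<And>g n t. t \<in> U \<Longrightarrow> TA (gl11_vector M a b F x y g) n t \<in> U"
begin

lemma gamma_stable: "t \<in> U \<Longrightarrow> TA (vac M \<otimes> clifford_gamma F x y) n t \<in> U"
proof -
  assume t: "t \<in> U"
  let ?c = "vac M \<otimes> clifford_gamma F x y" and ?d = "weyl_beta M a b \<otimes> vac F"
  have "?c = (1 / 2) *\<^sub>C gl11_vector M a b F x y gE + gl11_vector M a b F x y gN"
    by (simp add: cscale_add_right cvs.scale_right_diff_distrib cscale_add_left[symmetric] cscale_one)
  then have "TA ?c n t = (1 / 2) *\<^sub>C TA (gl11_vector M a b F x y gE) n t + TA (gl11_vector M a b F x y gN) n t"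
    by (simp only: clinear_add[OF TA_lin_left] clinear_scale[OF TA_lin_left])
  then show ?thesis
    by (simp only:) (intro cvs.subspace_add[OF U] cvs.subspace_scale[OF U] gl11 t)
qed

text \<open>The vectors \<open>f\<close> for which all modes of \<open>vac M \<otimes> f\<close>
  preserve \<open>U\<close> include the vacuum and \<open>gamma\<close>, and are closed under
  products of even vectors, which is all that generating the pairs requires.\<close>

lemma pair_stable: "t \<in> U \<Longrightarrow> TA (vac M \<otimes> clifford_pair F x y j) n t \<in> U"
proof -
  define K where "K = {f. \<forall>n. \<forall>t\<in>U. TA (vac M \<otimes> f) n t \<in> U}"
  have "clifford_pair F x y j \<in> K"
  proof (rule clifford_pair_generated[OF F])
    show "cvs.subspace K"
    proof (rule cvs.subspaceI)
      show "0 \<in> K"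
        using clinear_zero[OF TA_lin_left] cvs.subspace_0[OF U] by (simp add: K_def)
      show "f + g \<in> K" if "f \<in> K" "g \<in> K" for f g
        using that by (simp add: K_def tens_add_right clinear_add[OF TA_lin_left] cvs.subspace_add[OF U])
      show "c *\<^sub>C f \<in> K" if "f \<in> K" for c f
        using that by (simp add: K_def tens_scale_right clinear_scale[OF TA_lin_left] cvs.subspace_scale[OF U])
    qed
    show "vac F \<in> K"
      using cvs.subspace_0[OF U] by (simp add: K_def TA_vac)
    show "clifford_gamma F x y \<in> K" using gamma_stable by (simp add: K_def)
    fix f g n assume fg: "f \<in> K" "g \<in> K" "f \<in> part F False" "g \<in> part F False"
    have "TA (TP (vac M \<otimes> f) m (vac M \<otimes> g)) k t \<in> U" if "t \<in> U" for m k t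
      by (rule module_triple_closed[OF field_action_tensor[OF Y_action F_action] U
            TA_triple[OF tens_in_part[OF fg(3)] tens_in_part[OF fg(4)]]])
         (use fg that in \<open>auto simp: K_def\<close>)
    then show "prd F f n g \<in> K" by (simp add: K_def TP_vac_left)
  qed
  then show "t \<in> U \<Longrightarrow> TA (vac M \<otimes> clifford_pair F x y j) n t \<in> U" by (simp add: K_def)
qed

lemma XY_stable: "t \<in> U \<Longrightarrow> Xop p (Yop q t) \<in> U"
proof -
  assume t: "t \<in> U"
  let ?h = "\<lambda>d p. tensor_map (\<lambda>w::'n. w) (normal_product (prd F x) (prd F y) p (d - p))"
  have "?h (p + q) p t \<in> U"
  proof (rule interpolation[OF U clifford_pair_modes_tensor(1)])
    fix j
    have "(-1) ^ j *\<^sub>C TA (vac M \<otimes> clifford_pair F x y j) (p + q + 1 + int j) t \<in> U"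
      by (intro cvs.subspace_scale[OF U] pair_stable t)
    then show "Sum_any (\<lambda>p'. (of_int (p + q - p') + of_nat j gchoose j) *\<^sub>C ?h (p + q) p' t) \<in> U"
      unfolding clifford_pair_modes_tensor(2)
      by (simp add: cscale_cscale power_mult_distrib[symmetric] cscale_one)
  qed
  \<comment> \<open>Undoing the normal ordering costs at most a multiple of \<open>t\<close> itself,
    which lies in \<open>U\<close>.\<close>
  moreover have "Xop p (Yop q t) = ?h (p + q) p t + (if p \<ge> 0 \<and> p + q + 1 = 0 then t else 0)"
  proof (rule clinear_tensor_eqI[where t = t])
    show "clinear (\<lambda>t. Xop p (Yop q t))" by (rule clinear_compose[OF op_lin(3) op_lin(4)])
    show "clinear (\<lambda>t. ?h (p + q) p t + (if p \<ge> 0 \<and> p + q + 1 = 0 then t else 0))"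
      by (intro clinear_plus clinear_tensor_map clinear_id normal_product_lin clinear_if)
    fix w g
    show "Xop p (Yop q (w \<otimes> g)) = ?h (p + q) p (w \<otimes> g) + (if p \<ge> 0 \<and> p + q + 1 = 0 then w \<otimes> g else 0)"
      using clifford_yx[OF F, of q p g]
      by (simp add: op_tens tensor_map_tens[OF clinear_id normal_product_lin] normal_product_def
          tens_diff_right tens_uminus_right)
  qed
  ultimately show ?thesis using cvs.subspace_add[OF U _ t] by simp
qed

text \<open>\<open>Yop 0\<close> pairs only with \<open>Xop (-1)\<close>, which in the series for
  \<open>Psi+\<close> accompanies exactly \<open>Aop n\<close>; what remains of the probe is
  \<open>Xop p\<close>.\<close>

lemma AX_stable: "t \<in> U \<Longrightarrow> Aop n (Xop p t) \<in> U"
proof -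
  assume t: "t \<in> U"
  have T: "TA (a \<otimes> x) n t \<in> U" if "t \<in> U" for t using gl11[OF that, of gPsi_plus] by simp
  have "prd F x p (prd F y 0 (prd F x (n - i - 1) g)) - prd F x (n - i - 1) (prd F x p (prd F y 0 g))
      = (if i = n then prd F x p g else 0)" for i g
    by (simp add: clifford_yx[OF F] clinear_diff[OF F_lin] clinear_zero[OF F_lin] clifford_xx[OF F, of p "n - i - 1"])
  from TA_commutator[OF F_lin this, of a t]
  have "Aop n (Xop p t) = Xop p (Yop 0 (TA (a \<otimes> x) n t)) - TA (a \<otimes> x) n (Xop p (Yop 0 t))"
    by (simp add: ops_tensor_map)
  also have "\<dots> \<in> U" by (intro cvs.subspace_diff[OF U] XY_stable T t)
  finally show ?thesis .
qed

text \<open>Now \<open>Xop 0\<close> is the probe and pairs only with \<open>Yop (-1)\<close>.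
  Moving it past \<open>Yop q\<close> first produces the minus sign.\<close>

lemma BY_stable: "t \<in> U \<Longrightarrow> Bop n (Yop q t) \<in> U"
proof -
  assume t: "t \<in> U"
  have T: "TA (b \<otimes> y) n t \<in> U" if "t \<in> U" for t using gl11[OF that, of gPsi_minus] by simp
  have "prd F x 0 (prd F y q (prd F y (n - i - 1) g)) - prd F y (n - i - 1) (prd F x 0 (prd F y q g))
      = (if i = n then - prd F y q g else 0)" for i g
    by (simp add: clifford_yx[OF F] clifford_yy[OF F, of q "n - i - 1"] clinear_minus[OF F_lin])
  from TA_commutator[OF clinear_uminus[OF F_lin] this, of b t]
  have "Xop 0 (Yop q (TA (b \<otimes> y) n t)) - TA (b \<otimes> y) n (Xop 0 (Yop q t)) = - Bop n (Yop q t)"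
    by (simp add: ops_tensor_map)
  then have "Bop n (Yop q t) = TA (b \<otimes> y) n (Xop 0 (Yop q t)) - Xop 0 (Yop q (TA (b \<otimes> y) n t))"
    by (simp add: algebra_simps)
  also have "\<dots> \<in> U" by (intro cvs.subspace_diff[OF U] XY_stable T t)
  finally show ?thesis .
qed

text \<open>The pair \<open>Yop (-1)\<close>, \<open>Xop 0\<close> has anticommutator 1. Distributed
  over the two stable products \<open>Bop m (Yop (-1) t)\<close> and \<open>Aop n (Xop 0 t)\<close>,
  taken in both orders, it cancels out, up to a scalar multiple of the stable operator
  \<open>Xop 0\<close> after \<open>Yop (-1)\<close>.\<close>

lemma BA_stable: "t \<in> U \<Longrightarrow> Bop m (Aop n t) \<in> U"
proof -
  assume t: "t \<in> U"
  have "Bop m (Yop (- 1) (Aop n (Xop 0 t))) + Aop n (Xop 0 (Bop m (Yop (- 1) t)))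
      = Bop m (Aop n t) + (if n + m + 1 = 0 then Xop 0 (Yop (- 1) t) else 0)"
    by (simp add: op_relations clinear_diff op_lin)
  then have "Bop m (Aop n t) = Bop m (Yop (- 1) (Aop n (Xop 0 t))) + Aop n (Xop 0 (Bop m (Yop (- 1) t)))
      - (if n + m + 1 = 0 then Xop 0 (Yop (- 1) t) else 0)"
    by (simp add: algebra_simps)
  also have "\<dots> \<in> U"
    using cvs.subspace_0[OF U]
    by (intro cvs.subspace_diff[OF U] cvs.subspace_add[OF U] BY_stable AX_stable t; simp add: XY_stable t)
  finally show ?thesis .
qed

text \<open>\<open>P\<close> raises the charge by one and \<open>Q\<close> lowers it by one. The
  graded extension of \<open>U\<close> sums to a subspace stable under all operators, hence to the
  whole space; comparing components of charge \<open>e\<close> returns to \<open>U\<close>.\<close>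

lemma stable_subspace_full:
  assumes irr: "irreducible_submodule Y UNIV"
    and sub: "U \<subseteq> eigenspace charge e" and t0: "t0 \<in> U" "t0 \<noteq> 0"
  shows "U = eigenspace charge e"
proof -
  define P where "P = range Bop \<union> range Xop"
  define Q where "Q = range Aop \<union> range Yop"
  define L where "L k = eigenspace charge (of_int k + e)" for k :: int
  have lin: "clinear p" if "p \<in> P \<union> Q" for p
    using that op_lin by (auto simp: P_def Q_def)
  have comm: "\<exists>e c. \<forall>t. q (p t) = e *\<^sub>C p (q t) + c *\<^sub>C t" "\<exists>e c. \<forall>t. p (q t) = e *\<^sub>C q (p t) + c *\<^sub>C t"
    if "p \<in> P" "q \<in> Q" for p q
  proof -
    have "\<exists>n. p = Bop n \<or> p = Xop n" "\<exists>m. q = Aop m \<or> q = Yop m"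
      using that by (auto simp: P_def Q_def)
    then obtain n m where "p = Bop n \<or> p = Xop n" "q = Aop m \<or> q = Yop m" by blast
    then consider "p = Bop n" "q = Aop m" | "p = Xop n" "q = Yop m"
      | "(p = Bop n \<and> q = Yop m) \<or> (p = Xop n \<and> q = Aop m)" by blast
    then have "(\<forall>t. q (p t) = 1 *\<^sub>C p (q t) + (if n + m + 1 = 0 then 1 else 0) *\<^sub>C t) \<or>
        (\<forall>t. q (p t) = (-1) *\<^sub>C p (q t) + (if n + m + 1 = 0 then 1 else 0) *\<^sub>C t) \<or>
        (\<forall>t. q (p t) = 1 *\<^sub>C p (q t) + 0 *\<^sub>C t)"
    proof cases
      case 1
      then show ?thesis by (simp add: op_relations(1) cscale_one add.commute)
    next
      case 2
      then show ?thesis by (simp add: op_relations(2) cscale_one)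
    next
      case 3
      then show ?thesis by (auto simp: op_relations(5-8) cscale_one)
    qed
    \<comment> \<open>The scalar \<open>s\<close> is 1 or -1, so the same relation can be solved for
      \<open>p (q t)\<close>.\<close>
    then obtain s c where s: "s \<noteq> 0" and *: "\<And>t. q (p t) = s *\<^sub>C p (q t) + c *\<^sub>C t"
      by (metis one_neq_zero zero_neq_neg_one)
    then show "\<exists>e c. \<forall>t. q (p t) = e *\<^sub>C p (q t) + c *\<^sub>C t" by blast
    have "p (q t) = (1 / s) *\<^sub>C q (p t) + (- c / s) *\<^sub>C t" for t
      using s by (simp add: * cscale_add_right cscale_one)
    then show "\<exists>e c. \<forall>t. p (q t) = e *\<^sub>C q (p t) + c *\<^sub>C t" by blast
  qed
  have closed: "p (q t) \<in> U" if "p \<in> P" "q \<in> Q" "t \<in> U" for p q t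
    using that(1,2) BA_stable[OF that(3)] BY_stable[OF that(3)] XY_stable[OF that(3)] AX_stable[OF that(3)]
    by (auto simp: P_def Q_def op_relations(5))
  have L_up: "p t \<in> L (k + 1)" if "p \<in> P" "t \<in> L k" for p k t
    using that charge_shift(1,2)[of t "of_int k + e"] by (auto simp: P_def L_def algebra_simps)
  have L_down: "q t \<in> L (k - 1)" if "q \<in> Q" "t \<in> L k" for q k t
    using that charge_shift(3,4)[of t "of_int k + e"] by (auto simp: Q_def L_def algebra_simps)
  obtain W where W: "W 0 = U" "\<And>k. cvs.subspace (W k)" "\<And>k. W k \<subseteq> L k"
    "\<And>p k t. p \<in> P \<Longrightarrow> t \<in> W k \<Longrightarrow> p t \<in> W (k + 1)"
    "\<And>q k t. q \<in> Q \<Longrightarrow> t \<in> W k \<Longrightarrow> q t \<in> W (k - 1)"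
  proof (rule graded_extension[of U P Q L])
    show "cvs.subspace (L k)" for k unfolding L_def by (rule subspace_eigenspace[OF charge_lin])
    show "U \<subseteq> L 0" using sub by (simp add: L_def)
  qed (use U lin comm closed L_up L_down in \<open>auto\<close>)
  define T where "T = cvs.span (\<Union>k. W k)"
  have T_stable: "r t \<in> T" if r: "r \<in> P \<union> Q" and t: "t \<in> T" for r t
    unfolding T_def
  proof (rule clinear_span_mem[OF lin[OF r] cvs.subspace_span _ t[unfolded T_def]])
    fix u assume "u \<in> (\<Union>k. W k)"
    then obtain k where "u \<in> W k" by blast
    then have "r u \<in> W (k + 1) \<or> r u \<in> W (k - 1)"
      using r W(4)[of r u k] W(5)[of r u k] by auto
    then show "r u \<in> cvs.span (\<Union>k. W k)" by (blast intro: cvs.span_base)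
  qed
  have "T = UNIV"
  proof (rule stable_UNIV[OF irr _ _ t0(2)])
    show "cvs.subspace T" by (simp add: T_def)
    show "t0 \<in> T" using t0 W(1) unfolding T_def by (blast intro: cvs.span_base)
  qed (rule T_stable; simp add: P_def Q_def)+
  show ?thesis
  proof (intro equalityI sub subsetI)
    fix t assume t: "t \<in> eigenspace charge e"
    have "t \<in> T" by (simp add: \<open>T = UNIV\<close>)
    then obtain f where f: "\<And>k. f k \<in> W k" "finite {k. f k \<noteq> 0}" "t = Sum_any f"
      using span_Union_finite_sum[of W t] W(2) unfolding T_def by blast
    \<comment> \<open>Zero is inserted so that the component of index 0 is present even if
      \<open>f 0 = 0\<close>. Subtracting \<open>t\<close> there yields eigenvectors of distinct
      charges with sum zero, whence \<open>t = f 0\<close>.\<close>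
    define S where "S = insert 0 {k. f k \<noteq> 0}"
    have S: "finite S" "0 \<in> S" using f(2) by (simp_all add: S_def)
    define g where "g k = f k - (if k = 0 then t else 0)" for k
    have "t = sum f S" unfolding f(3) using S by (intro Sum_any_eq_sum) (auto simp: S_def)
    then have zero: "sum g S = 0" using S by (simp add: g_def sum_subtractf)
    have "g 0 = 0"
    proof (rule eigenvectors_independent[OF charge_lin _ S(1) _ zero S(2)])
      show "inj (\<lambda>k::int. of_int k + e)" by (simp add: inj_def)
      fix k
      have "f k \<in> eigenspace charge (of_int k + e)" using f(1)[of k] W(3)[of k] by (auto simp: L_def)
      then show "g k \<in> eigenspace charge (of_int k + e)"
        using t by (cases "k = 0")
          (auto simp: g_def intro: cvs.subspace_diff[OF subspace_eigenspace[OF charge_lin]])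
    qed
    then have "t = f 0" by (simp add: g_def)
    then show "t \<in> U" using f(1)[of 0] W(1) by simp
  qed
qed

end

end

section \<open>The decomposition\<close>

text \<open>Complete reducibility is formulated with a set of submodules indexed by itself. Distinct
  indices must give distinct summands for the sum over integers to be rewritten in that
  form.\<close>

lemma direct_sum_range:
  assumes L: "internal_direct_sum UNIV L" and inj: "inj L"
  shows "internal_direct_sum (range L) (\<lambda>W. W)"
  unfolding internal_direct_sum_def
proof (intro conjI ballI allI ex_ex1I)
  have ex1: "\<exists>!f. (\<forall>i\<in>UNIV. f i \<in> L i) \<and> (\<forall>i. i \<notin> UNIV \<longrightarrow> f i = 0) \<and>
      finite {i. f i \<noteq> 0} \<and> v = (\<Sum>i | f i \<noteq> 0. f i)" for v
    using L by (simp add: internal_direct_sum_def)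
  show "cvs.subspace W" if "W \<in> range L" for W
    using that L by (auto simp: internal_direct_sum_def)
  fix v
  let ?D = "\<lambda>g. (\<forall>W\<in>range L. g W \<in> W) \<and> (\<forall>W. W \<notin> range L \<longrightarrow> g W = 0) \<and>
      finite {W. g W \<noteq> 0} \<and> v = (\<Sum>W | g W \<noteq> 0. g W)"
  obtain f where f: "\<And>i. f i \<in> L i" "finite {i. f i \<noteq> 0}" "v = (\<Sum>i | f i \<noteq> 0. f i)"
    using ex1[of v] by blast
  define G where "G W = (if W \<in> range L then f (inv L W) else 0)" for W
  have G: "G (L i) = f i" for i using inj by (simp add: G_def)
  have supp: "{W. G W \<noteq> 0} = L ` {i. f i \<noteq> 0}"
  proof (intro equalityI subsetI)
    fix W assume "W \<in> {W. G W \<noteq> 0}"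
    then have W: "G W \<noteq> 0" by simp
    then have "W \<in> range L" by (auto simp: G_def split: if_splits)
    then obtain i where "W = L i" by blast
    then show "W \<in> L ` {i. f i \<noteq> 0}" using W G by auto
  qed (auto simp: G)
  have sum: "v = (\<Sum>W | G W \<noteq> 0. G W)"
    unfolding supp f(3) by (subst sum.reindex) (auto intro: inj_on_subset[OF inj] simp: G)
  have "\<forall>W\<in>range L. G W \<in> W" using f(1) G by auto
  moreover have "\<forall>W. W \<notin> range L \<longrightarrow> G W = 0" by (simp add: G_def)
  moreover have "finite {W. G W \<noteq> 0}" unfolding supp using f(2) by simp
  ultimately show "\<exists>g. ?D g"
    using sum by blast
  have pull: "(\<forall>i\<in>UNIV. (g \<circ> L) i \<in> L i) \<and> (\<forall>i. i \<notin> UNIV \<longrightarrow> (g \<circ> L) i = 0) \<and>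
      finite {i. (g \<circ> L) i \<noteq> 0} \<and> v = (\<Sum>i | (g \<circ> L) i \<noteq> 0. (g \<circ> L) i)"
    if g: "?D g" for g
  proof -
    have supp: "{W. g W \<noteq> 0} = L ` {i. (g \<circ> L) i \<noteq> 0}"
    proof (intro equalityI subsetI)
      fix W assume "W \<in> {W. g W \<noteq> 0}"
      then have W: "g W \<noteq> 0" by simp
      then have "W \<in> range L" using g by blast
      then show "W \<in> L ` {i. (g \<circ> L) i \<noteq> 0}" using W by auto
    qed auto
    have inj': "inj_on L A" for A by (rule inj_on_subset[OF inj]) simp
    have "finite {i. (g \<circ> L) i \<noteq> 0}"
      using g supp finite_image_iff[OF inj'] by metis
    moreover have "v = (\<Sum>i | (g \<circ> L) i \<noteq> 0. (g \<circ> L) i)"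
    proof -
      have "v = (\<Sum>W | g W \<noteq> 0. g W)" using g by blast
      also have "\<dots> = (\<Sum>i | (g \<circ> L) i \<noteq> 0. (g \<circ> L) i)"
        unfolding supp by (rule sum.reindex[OF inj'])
      finally show ?thesis .
    qed
    ultimately show ?thesis using g by auto
  qed
  fix g h
  assume g: "?D g"
    and h: "?D h"
  have eq: "g \<circ> L = h \<circ> L" using ex1[of v] pull[OF g] pull[OF h] by blast
  show "g = h"
  proof
    fix W
    show "g W = h W"
    proof (cases "W \<in> range L")
      case True
      then obtain i where "W = L i" by blast
      then show ?thesis using fun_cong[OF eq, of i] by simp
    next
      case False
      then show ?thesis using g h by metis
    qed
  qed
qed

text \<open>\<open>\<iota>\<close> respects parity and products, so the identity for
  \<open>u\<close>, \<open>v\<close> is the one on the tensor product at \<open>\<iota> u\<close>,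
  \<open>\<iota> v\<close>.\<close>

lemma vsa_module_pullback:
  assumes M: "weyl_vertex_algebra M a b" and F: "clifford_vertex_algebra F x y" and Y: "vsa_module M Y"
    and V: "vertex_superalgebra V" and hom: "vsa_hom V (tensor_vsa M F) \<iota>"
  shows "vsa_module V (\<lambda>v. tensor_action Y (prd F) (\<iota> v))"
proof -
  note TA = field_action_tensor[OF vsa_module_field_action[OF Y] clifford_field_action[OF F]]
  have lin: "clinear \<iota>" and vac: "\<iota> (vac V) = vac M \<otimes> vac F"
    and part: "\<And>p v. v \<in> part V p \<Longrightarrow> \<iota> v \<in> part (tensor_vsa M F) p"
    and prd: "\<And>u n v. \<iota> (prd V u n v) = tensor_action (prd M) (prd F) (\<iota> u) n (\<iota> v)"
    using hom by (auto simp: vsa_hom_def tensor_vsa_def)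
  have act: "field_action (\<lambda>v. tensor_action Y (prd F) (\<iota> v))"
    unfolding field_action_def cbilinear_def
    using field_action_linear[OF TA] clinear_compose[OF field_action_linear_left[OF TA] lin]
      field_action_bounded[OF TA] by blast
  have "module_triple (\<lambda>v. tensor_action Y (prd F) (\<iota> v)) (prd V) (koszul p q) u v t"
    if "u \<in> part V p" "v \<in> part V q" for p q u v t
    using TA_triple[OF M F Y part[OF that(1)] part[OF that(2)], of t]
    by (simp add: module_triple_def prd)
  then show ?thesis
    using act borcherds_identity_iff[OF act vertex_superalgebra_field_action[OF V]]
    by (simp add: vsa_module_def field_action_def vac TA_vac[OF M F Y])
qed

text \<open>\<open>E\<close> is central in the Lie superalgebra and the level term carries the
  factor \<open>m = 0\<close>, so \<open>E(0)\<close> kills the generators. By the commutator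
  formula a vector killed by \<open>E(0)\<close> has modes commuting with it, so the kernel is
  closed under products. Consequently \<open>E(0)\<close> commutes with the action on every
  module.\<close>

lemma affine_E_zero_mode:
  assumes "simple_affine_gl11 k V x" shows "prd V (x gE) 0 v = 0"
proof -
  have V: "vertex_superalgebra V" and x: "\<And>g. x g \<in> part V (gl11_odd g)"
    and aff: "affine_gl11_action k (\<lambda>g. prd V (x g))" and gen: "generated_subalgebra V (range x) = UNIV"
    using assms by (auto simp: simple_affine_gl11_def simple_vsa_def)
  note FA = vertex_superalgebra_field_action[OF V]
  have mod: "vsa_module V (prd V)" and vac: "\<And>v n. n \<ge> 0 \<Longrightarrow> prd V v n (vac V) = 0"
    "\<And>v. prd V v (- 1) (vac V) = v"
    using V by (auto simp: vertex_superalgebra_def)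
  have E: "x gE \<in> part V False" using x[of gE] by simp
  have "generated_subalgebra V (range x) \<subseteq> {v. prd V (x gE) 0 v = 0}"
  proof (rule generated_subalgebra_subset[OF V])
    show "cvs.subspace {v. prd V (x gE) 0 v = 0}"
      by (rule cvs.subspaceI)
         (simp_all add: field_action_zero[OF FA] clinear_add[OF field_action_linear[OF FA]]
           clinear_scale[OF field_action_linear[OF FA]])
    show "vac V \<in> {v. prd V (x gE) 0 v = 0}" by (simp add: vac)
    show "range x \<subseteq> {v. prd V (x gE) 0 v = 0}"
    proof (intro subsetI CollectI; elim imageE)
      fix v g assume v: "v = x g"
      have "prd V (x gE) 0 (prd V (x g) (- 1) (vac V)) - koszul False (gl11_odd g) *\<^sub>C
          prd V (x g) (- 1) (prd V (x gE) 0 (vac V)) =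
        (\<Sum>l\<in>{gE, gN, gPsi_plus, gPsi_minus}. gl11_bracket gE g l *\<^sub>C prd V (x l) (0 + - 1) (vac V))
        + (if (0::int) + - 1 = 0 then of_int 0 * gl11_form gE g * k else 0) *\<^sub>C vac V"
        using aff[unfolded affine_gl11_action_def, THEN conjunct2, rule_format, of gE 0 g "- 1" "vac V"]
        by (simp only: gl11_odd.simps(1))
      then show "prd V (x gE) 0 v = 0"
        by (cases g) (simp_all add: v vac field_action_zero[OF FA])
    qed
    show "\<exists>p. z \<in> part V p" if "z \<in> range x" for z using that x by blast
    fix u v p q n
    assume uv: "u \<in> {v. prd V (x gE) 0 v = 0}" "v \<in> {v. prd V (x gE) 0 v = 0}"
      and "u \<in> part V p"
    have zero: "(\<Sum>j::nat. ((of_int 0 :: complex) gchoose j) *\<^sub>C f j) = f 0" for f :: "nat \<Rightarrow> 'a"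
      by (subst Sum_any_single[of 0]) (auto simp: gchoose_zero_left cscale_one)
    show "prd V u n v \<in> {v. prd V (x gE) 0 v = 0}"
      using module_triple_commutator[OF vsa_module_triple[OF V mod E \<open>u \<in> part V p\<close>], of 0 n v] uv
      unfolding zero by (simp add: koszul_def field_action_zero[OF FA])
  qed
  then show ?thesis using gen by blast
qed

theorem theorem5p1:
  fixes M :: "'m::complex_vs vsa" and a b :: 'm
    and F :: "'f::complex_vs vsa" and \<psi> \<psi>' :: 'f
    and V :: "'v::complex_vs vsa" and x :: "gl11 \<Rightarrow> 'v"
    and \<iota> :: "'v \<Rightarrow> ('m, 'f) tensor"
    and Y :: "'m \<Rightarrow> int \<Rightarrow> 'n::complex_vs \<Rightarrow> 'n"
    and act :: "'v \<Rightarrow> int \<Rightarrow> ('n, 'f) tensor \<Rightarrow> ('n, 'f) tensor"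
    and L :: "int \<Rightarrow> ('n, 'f) tensor set"
    and \<Delta> :: complex
  assumes M: "weyl_vertex_algebra M a b"
    and F: "clifford_vertex_algebra F \<psi> \<psi>'"
    and V: "simple_affine_gl11 1 V x"
    and \<iota>: "vsa_hom V (tensor_vsa M F) \<iota>" "\<And>g. \<iota> (x g) = gl11_vector M a b F \<psi> \<psi>' g"
    and N_irreducible: "irreducible_module M Y"
    and N_weight: "weight_module M a b Y"
    and N_decomposition:
      "internal_direct_sum UNIV (\<lambda>s::int. eigenspace (Y (weyl_beta M a b) 0) (of_int s + \<Delta>))"
    and act: "\<And>v. act v = tensor_action Y (prd F) (\<iota> v)"
    and L: "\<And>s. L s = {t. act (x gE) 0 t = (of_int s + \<Delta>) *\<^sub>C t}"
  shows "completely_reducible_module V act \<and>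
         internal_direct_sum UNIV L \<and>
         (\<forall>s. irreducible_submodule act (L s))"
proof -
  let ?N = "\<lambda>s::int. eigenspace (Y (weyl_beta M a b) 0) (of_int s + \<Delta>)"
  let ?C = "\<lambda>r::int. eigenspace (prd F (clifford_gamma F \<psi> \<psi>') 0) (of_int r)"
  have Y: "vsa_module M Y" and irr: "irreducible_submodule Y UNIV"
    using N_irreducible by (auto simp: irreducible_module_def)
  have Vv: "vertex_superalgebra V" and "x gE \<in> part V (gl11_odd gE)"
    using V unfolding simple_affine_gl11_def simple_vsa_def by blast+
  then have E_even: "x gE \<in> part V False" by simp
  have act_eq: "act = (\<lambda>v. tensor_action Y (prd F) (\<iota> v))" by (rule ext) (rule act)
  have mod: "vsa_module V act"
    unfolding act_eq by (rule vsa_module_pullback[OF M F Y Vv \<iota>(1)])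
  note FA = vsa_module_field_action[OF mod]
  define E where "E = charge M a b F \<psi> \<psi>' Y"
  have E_act: "E = act (x gE) 0"
    by (simp add: E_def charge_def[OF M F Y] act \<iota>(2) fun_eq_iff)
  have E_lin: "clinear E" unfolding E_act by (rule field_action_linear[OF FA])
  have L_eig: "L s = eigenspace E (of_int s + \<Delta>)" for s
    by (simp add: L eigenspace_def E_act)
  have L_sub: "cvs.subspace (L s)" for s
    unfolding L_eig by (rule subspace_eigenspace[OF E_lin])
  note E_tens = charge_tens[OF M F Y, folded E_def]
  \<comment> \<open>\<open>E(0)\<close> is the sum of the two charge operators of the factors, so
    charges add on pure tensors.\<close>
  have tens_L: "w \<otimes> f \<in> L (s + r)"
    if "w \<in> ?N s"
      "f \<in> ?C r" for w f s r
    using that by (simp add: L_eig eigenspace_def E_tens tens_scale_left tens_scale_right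
        cscale_add_left[symmetric] add.commute add.left_commute)
  have N_sum: "\<exists>h. (\<forall>s::int. h s \<in> ?N s) \<and>
      w = (\<Sum>s | h s \<noteq> 0. h s)" for w
    using N_decomposition unfolding internal_direct_sum_def by blast
  have inj: "inj (\<lambda>s::int. of_int s + \<Delta>)" by (simp add: inj_def)

  have "cvs.span (\<Union>s. L s) = UNIV"
  proof -
    let ?S = "cvs.span (\<Union>s. L s)"
    have S: "cvs.subspace ?S" by simp
    have eig: "w \<otimes> f \<in> ?S" if w: "w \<in> ?N s" for w f s
    proof -
      have f: "f \<in> cvs.span (\<Union>r::int. ?C r)"
        by (simp add: clifford_charge_span[OF F])
      show ?thesis
      proof (rule clinear_span_mem[OF clinear_tens_right S _ f])
        fix u assume "u \<in> (\<Union>r::int. ?C r)"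
        then obtain r where "u \<in> ?C r" by blast
        then show "w \<otimes> u \<in> ?S" using tens_L[OF w] by (blast intro: cvs.span_base)
      qed
    qed
    have "w \<otimes> f \<in> ?S" for w f
    proof -
      obtain h where h: "\<And>s::int. h s \<in> ?N s"
        "w = (\<Sum>s | h s \<noteq> 0. h s)" using N_sum by blast
      show ?thesis
        unfolding h(2) clinear_sum[OF clinear_tens_left]
        by (rule cvs.span_sum) (rule eig[OF h(1)])
    qed
    then have "t \<in> ?S" for t
      by (induction t rule: tensor_induct) (simp_all add: cvs.span_add)
    then show ?thesis by blast
  qed
  then have direct: "internal_direct_sum UNIV L"
    using eigenspaces_direct_sum[OF E_lin inj] by (simp add: L_eig[abs_def])

  have nonzero: "\<exists>t\<in>L s. t \<noteq> 0" for s
  proof -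
    obtain w :: 'n where "w \<noteq> 0" using irr by (auto simp: irreducible_submodule_def)
    then obtain s0 h where h: "h s0 \<in> ?N s0" "h s0 \<noteq> 0"
      using N_sum[of w] by (metis (mono_tags, lifting) sum.neutral)
    \<comment> \<open>A nonzero homogeneous component of charge \<open>s0 + \<Delta>\<close> is
      completed to charge \<open>s + \<Delta>\<close> by a Fock vector; the Fock space has every
      integral charge.\<close>
    obtain f where f: "f \<in> ?C (s - s0)" "f \<noteq> 0"
      using clifford_charge_nonzero[OF F] by blast
    show ?thesis using tens_L[OF h(1) f(1)] tens_nonzero[OF h(2) f(2)] by auto
  qed

  have stable: "act v n t \<in> L s" if t: "t \<in> L s" for v n t s
  proof -
    have *: "act (x gE) 0 (act v n t) = act v n (act (x gE) 0 t)" if "v \<in> part V q" for v q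
    proof -
      have "act (x gE) 0 (act v n t) - koszul False q *\<^sub>C act v n (act (x gE) 0 t) = 0"
        unfolding module_triple_commutator[OF vsa_module_triple[OF Vv mod E_even that]]
        by (subst Sum_any_single[of 0])
           (auto simp: gchoose_zero_left affine_E_zero_mode[OF V] field_action_zero[OF FA])
      then show ?thesis by (simp add: koszul_def cscale_one)
    qed
    obtain v0 v1 where v: "v0 \<in> part V False" "v1 \<in> part V True" "v = v0 + v1"
      by (rule part_decomposition[OF Vv])
    have "E (act v n t) = act v n (E t)"
      unfolding v(3) E_act
      by (simp add: clinear_add[OF field_action_linear_left[OF FA]] clinear_add[OF field_action_linear[OF FA]]
          *[OF v(1)] *[OF v(2)])
    then show ?thesis
      using t by (simp add: L_eig eigenspace_def clinear_scale[OF field_action_linear[OF FA]])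
  qed

  have irreducible: "irreducible_submodule act (L s)" for s
    unfolding irreducible_submodule_def
  proof (intro conjI allI impI)
    show "vsa_submodule act (L s)" using L_sub stable by (simp add: vsa_submodule_def)
    show "L s \<noteq> {0}" using nonzero[of s] by blast
    fix U assume U: "U \<subseteq> L s" "vsa_submodule act U"
    have sub: "cvs.subspace U" using U(2) by (simp add: vsa_submodule_def)
    have gl11: "tensor_action Y (prd F) (gl11_vector M a b F \<psi> \<psi>' g) n t \<in> U" if "t \<in> U" for g n t
      using U(2) that unfolding vsa_submodule_def act \<iota>(2)[symmetric] by blast
    show "U = {0} \<or> U = L s"
    proof (cases "\<exists>t\<in>U. t \<noteq> 0")
      case True
      then obtain t where t: "t \<in> U" "t \<noteq> 0" by blast
      have "U = eigenspace (charge M a b F \<psi> \<psi>' Y) (of_int s + \<Delta>)"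
        by (rule stable_subspace_full[OF M F Y sub gl11 irr _ t])
           (use U(1) in \<open>simp_all add: L_eig E_def\<close>)
      then show ?thesis by (simp add: L_eig E_def)
    next
      case False
      then show ?thesis using cvs.subspace_0[OF sub] by blast
    qed
  qed

  \<comment> \<open>A nonzero vector has at most one eigenvalue, and every \<open>L s\<close>
    contains one, so distinct indices give distinct summands.\<close>
  have "inj L"
  proof (rule injI, rule ccontr)
    fix s s' assume eq: "L s = L s'" and neq: "s \<noteq> s'"
    obtain t where t: "t \<in> L s" "t \<noteq> 0" using nonzero by blast
    then have "(of_int s + \<Delta>) *\<^sub>C t = (of_int s' + \<Delta>) *\<^sub>C t"
      using eq by (metis (mono_tags, lifting) L mem_Collect_eq)
    then show False using t(2) neq by simp
  qed
  then have "completely_reducible_module V act"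
    unfolding completely_reducible_module_def
    using mod irreducible direct_sum_range[OF direct] by blast
  then show ?thesis using direct irreducible by blast
qed

end
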